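(* Assume that the weights $\mathbf W$ satisfy Conditions 1 (given in the context). There exist constants $A>0$ and $\bar A>A$ such that the following holds. Let $1\le l\le m$ (integers $l=l(n)$, $m=m(n)$) and $y=y(n)$ be such that $\left(\sqrt{m(m-l)},y\right)$ satisfies Conditions 2 (given in the context) with constant $\bar A$, $m-l\to\infty$ and $y=O(m-l)$. Then for all $n$ large enough $$\mathbb P\left[\sup_{l\le i\le j\le m}\left|\sum_{k=i}^j w_{v(k)}-\mathbb E\left[\sum_{k=i}^j w_{v(k)}\right]\right|\ge y\right]\le A\exp\left(\frac{-y^2}{A(yn^{1/3}+(m-l))}\right).$$
   Context: Weights. For each $n\ge1$, $\mathbf W=(w_1,\dots,w_n)$ is a deterministic vector of weights (depending implicitly on $n$) with $0<w_n\le w_{n-1}\le\dots\le w_1$, and $\ell_n=\sum_{i=1}^n w_i$. Conditions 1. There is a positive random variable $W$ such that: (i) the distribution of a uniformly chosen weight (uniform among $w_1,\dots,w_n$) converges weakly to $W$ as $n\to\infty$; (ii) $\mathbb E[W^3]<\infty$; (iii) $\mathbb E[W^2]=\mathbb E[W]$; (iv) $\ell_n=\mathbb E[W]n+o(n^{2/3})$; (v) $\sum_{k=1}^n w_k^2=\mathbb E[W^2]n+o(n^{2/3})$; (vi) $\sum_{k=1}^n w_k^3=\mathbb E[W^3]n+o(1)$; (vii) $\max_{i\le n}w_i=o(n^{1/3})$. Size-biased sampling without replacement. $(v(1),\dots,v(n))$ is the random permutation of $\{1,\dots,n\}$ with $\mathbb P(v(1)=j)=w_j/\ell_n$ and $\mathbb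 P(v(i+1)=j\mid v(1),\dots,v(i))=\dfrac{w_j\mathbf 1(j\notin\{v(1),\dots,v(i)\})}{\ell_n-\sum_{k=1}^i w_{v(k)}}$. Conditions 2 (with constant $\bar A$). A pair of positive sequences $(a(n),b(n))$ satisfies Conditions 2 if: for all $n$ large enough $\exp\left(\frac{-b(n)^2}{\bar A(b(n)n^{1/3}+a(n))}\right)<1/4$; $\lim_n a(n)=\lim_n b(n)=+\infty$; $a(n)=o(n)$; $b(n)=O(a(n))$; $a(n)=O(b(n)\ell_n^{1/3})$; and $a(n)^2=O(b(n)\ell_n)$. (In the paper $\bar A$ is a fixed constant independent of $n$, larger than all the other constants $A,A',\dots$ appearing.) *)

theory Defs
  imports
    "HOL-Probability.Probability"
    "HOL-Combinatorics.Permutations"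
    "HOL-Library.Landau_Symbols"
begin

(* w n i stands for the weight w_i of the n-th weight vector; only 1 \<le> i \<le> n is meaningful. *)

definition weight_vectors :: "(nat \<Rightarrow> nat \<Rightarrow> real) \<Rightarrow> bool" where
  "weight_vectors w \<longleftrightarrow>
     (\<forall>n. \<forall>i\<in>{1..n}. 0 < w n i) \<and>
     (\<forall>n. \<forall>i\<in>{1..n}. \<forall>j\<in>{1..n}. i \<le> j \<longrightarrow> w n j \<le> w n i)"

definition total_weight :: "(nat \<Rightarrow> nat \<Rightarrow> real) \<Rightarrow> nat \<Rightarrow> real" where
  "total_weight w n = (\<Sum>i=1..n. w n i)"

definition conditions1 :: "(nat \<Rightarrow> nat \<Rightarrow> real) \<Rightarrow> 'a measure \<Rightarrow> ('a \<Rightarrow> real) \<Rightarrow> bool" where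
  "conditions1 w M W \<longleftrightarrow>
     prob_space M \<and> W \<in> borel_measurable M \<and> (AE x in M. 0 < W x) \<and>
     weak_conv_m (\<lambda>n. distr (uniform_count_measure {1..n}) borel (w n)) (distr M borel W) \<and>
     integrable M (\<lambda>x. W x ^ 3) \<and>
     (\<integral>x. W x ^ 2 \<partial>M) = (\<integral>x. W x \<partial>M) \<and>
     (\<lambda>n. total_weight w n - (\<integral>x. W x \<partial>M) * real n) \<in> o(\<lambda>n. real n powr (2/3)) \<and>
     (\<lambda>n. (\<Sum>k=1..n. w n k ^ 2) - (\<integral>x. W x ^ 2 \<partial>M) * real n) \<in> o(\<lambda>n. real n powr (2/3)) \<and>
     (\<lambda>n. (\<Sum>k=1..n. w n k ^ 3) - (\<integral>x. W x ^ 3 \<partial>M) * real n) \<in> o(\<lambda>_. 1) \<and>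
     (\<lambda>n. Max (w n ` {1..n})) \<in> o(\<lambda>n. real n powr (1/3))"

(* Conditional laws given v(1), ..., v(i) are expressed on the atoms
   {v(1) = u(1), ..., v(i) = u(i)} of positive probability. *)

definition size_biased_permutation ::
    "'b measure \<Rightarrow> nat \<Rightarrow> (nat \<Rightarrow> real) \<Rightarrow> ('b \<Rightarrow> nat \<Rightarrow> nat) \<Rightarrow> bool" where
  "size_biased_permutation P n w v \<longleftrightarrow>
     prob_space P \<and>
     v \<in> measurable P (count_space {\<pi>. \<pi> permutes {1..n}}) \<and>
     (\<forall>j\<in>{1..n}. \<P>(\<omega> in P. v \<omega> 1 = j) = w j / (\<Sum>k=1..n. w k)) \<and>
     (\<forall>i\<in>{1..<n}. \<forall>u :: nat \<Rightarrow> nat. \<forall>j\<in>{1..n}.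
        0 < \<P>(\<omega> in P. \<forall>k\<in>{1..i}. v \<omega> k = u k) \<longrightarrow>
        \<P>(\<omega> in P. v \<omega> (i + 1) = j \<bar> \<forall>k\<in>{1..i}. v \<omega> k = u k) =
          w j * (if j \<notin> u ` {1..i} then 1 else 0) / ((\<Sum>k=1..n. w k) - (\<Sum>k=1..i. w (u k))))"

(* Positivity is only required for large n: with 1 \<le> l \<le> m \<le> n, the sequence sqrt (m (m - l))
   necessarily vanishes at n = 1. *)

definition conditions2 ::
    "real \<Rightarrow> (nat \<Rightarrow> real) \<Rightarrow> (nat \<Rightarrow> real) \<Rightarrow> (nat \<Rightarrow> real) \<Rightarrow> bool" where
  "conditions2 Abar ell a b \<longleftrightarrow>
     (\<forall>\<^sub>F n in sequentially. 0 < a n \<and> 0 < b n) \<and>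
     (\<forall>\<^sub>F n in sequentially.
        exp (- (b n)\<^sup>2 / (Abar * (b n * real n powr (1/3) + a n))) < 1/4) \<and>
     filterlim a at_top sequentially \<and>
     filterlim b at_top sequentially \<and>
     a \<in> o(\<lambda>n. real n) \<and>
     b \<in> O(a) \<and>
     a \<in> O(\<lambda>n. b n * ell n powr (1/3)) \<and>
     (\<lambda>n. (a n)\<^sup>2) \<in> O(\<lambda>n. b n * ell n)"

end

theory Submission
  imports Defs "HOL-Real_Asymp.Real_Asymp"
begin

text \<open>Only what is still to be drawn matters: given that the set \<open>S\<close> is left, the next draw has mean
  \<open>R(S) = \<Sum>S w\<^sup>2 / \<Sum>S w\<close>, so a window of draws is a martingale plus the sum of the \<open>R\<close>. The martingale
  is controlled by Bernstein's inequality, the \<open>R\<close> by concentration of the set of remaining elements.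

  For the latter, attach independent exponential clocks of rate \<open>w i\<close> to the elements. An increasing event
  for the set left after \<open>k\<close> draws is, up to the event that more than \<open>k\<close> clocks have rung, less likely than
  the same event for the independent set of clocks that have not rung at time \<open>t\<close>; similarly for
  decreasing events. Chernoff bounds then show that the sums of \<open>w\<close> and \<open>w\<^sup>2\<close>
  over the remaining elements of bounded weight are close to
  deterministic functions of \<open>k\<close>. Weights above a large constant \<open>T\<close> are handled through
  \<open>max w = o(n\<^sup>1\<^sup>/\<^sup>3)\<close> and the uniform integrability of \<open>w\<^sup>3\<close>: in the first half of the sample few of them
  have been drawn, in the second half few of them are left.

  In the second half the conditions force \<open>y\<close> and \<open>m - l\<close> to be comparable, so only precision of order one
  is needed for \<open>R\<close>. The window is cut when the remaining mass of the weights above a small \<open>\<kappa>\<close> falls below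
  \<open>\<kappa> (m - l)\<close>: the draws after the cut contribute little, and before the cut the mass is
  large enough for concentration.\<close>

text \<open>The order of the constants shapes the estimates. \<open>A\<close> is fixed before
  \<open>l\<close>, \<open>m\<close> and \<open>y\<close>, whereas the constants implied by the
  conditions on these sequences, collected in \<open>K\<close>, come later. So \<open>K\<close> may
  enter only terms with room to spare. The room comes from the threshold 1/4 in Conditions 2, which
  forces y >= n^(1/3), from max w = o(n^(1/3)), whose small factor may depend on \<open>K\<close>,
  and from n being large. Terms involving \<open>K\<close> are pushed below exp (- y / n^(1/3)),
  which lies below the target for every m - l. In the first half the martingale keeps the exponent
  of the target, with a variance per draw that depends on the weights only. R(S) is not monotone in
  S, but the comparison with the clocks needs monotone events; hence numerator and denominator are
  controlled as two separate sums. The centring is at the expectation, not at the deterministic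
  approximation, so their distance must also be a small fraction of y. In the second half this takes
  a bound on the second moment of a single draw, because a window sum is not bounded on the bad
  event.\<close>

section \<open>Weighted averages and the law of the draws\<close>

definition pos_weights :: "('a \<Rightarrow> real) \<Rightarrow> 'a set \<Rightarrow> bool" where
  "pos_weights w S \<longleftrightarrow> finite S \<and> (\<forall>x\<in>S. 0 < w x)"

lemma pos_weights_finite: "pos_weights w S \<Longrightarrow> finite S"
  by (simp add: pos_weights_def)

lemma pos_weightsD: "pos_weights w S \<Longrightarrow> x \<in> S \<Longrightarrow> 0 < w x"
  by (simp add: pos_weights_def)

lemma pos_weights_subset: "pos_weights w S \<Longrightarrow> S' \<subseteq> S \<Longrightarrow> pos_weights w S'"
  by (auto simp: pos_weights_def intro: finite_subset)

lemma pos_weights_sum_nonneg: "pos_weights w S \<Longrightarrow> 0 \<le> sum w S"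
  unfolding pos_weights_def by (intro sum_nonneg) (auto intro: less_imp_le)

lemma pos_weights_sum_pos: "pos_weights w S \<Longrightarrow> S \<noteq> {} \<Longrightarrow> 0 < sum w S"
  using sum_pos[of S w] by (auto simp: pos_weights_def)

text \<open>The mean of \<open>f\<close> at one size-biased draw from \<open>S\<close>, so
  \<open>avg w w S\<close> is the conditional mean R(S) of the next draw. On the empty set division
  by zero gives 0.\<close>

definition avg :: "('a \<Rightarrow> real) \<Rightarrow> ('a \<Rightarrow> real) \<Rightarrow> 'a set \<Rightarrow> real" where
  "avg w f S = (\<Sum>x\<in>S. w x * f x) / sum w S"

lemma avg_mono:
  assumes "pos_weights w S" "\<And>x. x \<in> S \<Longrightarrow> f x \<le> g x"
  shows "avg w f S \<le> avg w g S"
  unfolding avg_def using assms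
  by (intro divide_right_mono sum_mono mult_left_mono pos_weights_sum_nonneg)
    (auto simp: pos_weights_def less_imp_le)

lemma avg_cong: "(\<And>x. x \<in> S \<Longrightarrow> f x = g x) \<Longrightarrow> avg w f S = avg w g S"
  by (simp add: avg_def)

lemma avg_add: "avg w (\<lambda>x. f x + g x) S = avg w f S + avg w g S"
  by (simp add: avg_def algebra_simps sum.distrib add_divide_distrib)

lemma avg_cmult: "avg w (\<lambda>x. c * f x) S = c * avg w f S"
proof -
  have "(\<Sum>x\<in>S. w x * (c * f x)) = c * (\<Sum>x\<in>S. w x * f x)"
    by (simp add: sum_distrib_left mult_ac)
  thus ?thesis by (simp add: avg_def)
qed

lemma avg_zero [simp]: "avg w (\<lambda>x. 0) S = 0"
  by (simp add: avg_def)

lemma avg_const: "pos_weights w S \<Longrightarrow> S \<noteq> {} \<Longrightarrow> avg w (\<lambda>_. c) S = c"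
  using pos_weights_sum_pos[of w S] by (simp add: avg_def sum_distrib_right[symmetric])

lemma avg_nonneg: "pos_weights w S \<Longrightarrow> (\<And>x. x \<in> S \<Longrightarrow> 0 \<le> f x) \<Longrightarrow> 0 \<le> avg w f S"
  using avg_mono[of w S "\<lambda>_. 0" f] by simp

text \<open>\<open>draws w k S F\<close> is the expectation of \<open>F\<close> over the list of the first \<open>k\<close> draws of a
  size-biased sample without replacement from \<open>S\<close>; it is meaningful for \<open>k \<le> card S\<close>.\<close>

primrec draws :: "('a \<Rightarrow> real) \<Rightarrow> nat \<Rightarrow> 'a set \<Rightarrow> ('a list \<Rightarrow> real) \<Rightarrow> real" where
  "draws w 0 S F = F []"
| "draws w (Suc k) S F = avg w (\<lambda>x. draws w k (S - {x}) (\<lambda>xs. F (x # xs))) S"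

lemma draws_mono:
  assumes "pos_weights w S"
    "\<And>xs. length xs = k \<Longrightarrow> distinct xs \<Longrightarrow> set xs \<subseteq> S \<Longrightarrow> F xs \<le> G xs"
  shows "draws w k S F \<le> draws w k S G"
  using assms
proof (induction k arbitrary: S F G)
  case (Suc k)
  show ?case unfolding draws.simps
  proof (rule avg_mono[OF Suc.prems(1)], rule Suc.IH)
    fix x xs assume "x \<in> S" "length xs = k" "distinct xs" "set xs \<subseteq> S - {x}"
    thus "F (x # xs) \<le> G (x # xs)" by (intro Suc.prems(2)) auto
  qed (use Suc.prems(1) pos_weights_subset in blast)
qed simp

lemma draws_cong:
  assumes "\<And>xs. length xs = k \<Longrightarrow> distinct xs \<Longrightarrow> set xs \<subseteq> S \<Longrightarrow> F xs = G xs"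
  shows "draws w k S F = draws w k S G"
  using assms
proof (induction k arbitrary: S F G)
  case (Suc k)
  show ?case unfolding draws.simps
  proof (rule avg_cong, rule Suc.IH)
    fix x xs assume "x \<in> S" "length xs = k" "distinct xs" "set xs \<subseteq> S - {x}"
    thus "F (x # xs) = G (x # xs)" by (intro Suc.prems) auto
  qed
qed simp

lemma draws_add: "draws w k S (\<lambda>xs. F xs + G xs) = draws w k S F + draws w k S G"
  by (induction k arbitrary: S F G) (simp_all add: avg_add)

lemma draws_cmult: "draws w k S (\<lambda>xs. c * F xs) = c * draws w k S F"
  by (induction k arbitrary: S F) (simp_all add: avg_cmult)

lemma draws_zero [simp]: "draws w k S (\<lambda>_. 0) = 0"
  by (induction k arbitrary: S) simp_all

lemma draws_sum: "draws w k S (\<lambda>xs. \<Sum>i\<in>A. F i xs) = (\<Sum>i\<in>A. draws w k S (F i))"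
  by (induction A rule: infinite_finite_induct) (simp_all add: draws_add)

lemma draws_diff: "draws w k S (\<lambda>xs. F xs - G xs) = draws w k S F - draws w k S G"
  using draws_add[of w k S F "\<lambda>xs. (-1) * G xs"] unfolding draws_cmult by simp

lemma draws_nonneg:
  assumes "pos_weights w S"
    "\<And>xs. length xs = k \<Longrightarrow> distinct xs \<Longrightarrow> set xs \<subseteq> S \<Longrightarrow> 0 \<le> F xs"
  shows "0 \<le> draws w k S F"
  using draws_mono[of w S k "\<lambda>_. 0" F] assms by simp

lemma draws_const:
  assumes "pos_weights w S" "k \<le> card S"
  shows "draws w k S (\<lambda>_. c) = c"
  using assms
proof (induction k arbitrary: S)
  case (Suc k)
  have "S \<noteq> {}" using Suc.prems by auto
  have "avg w (\<lambda>x. draws w k (S - {x}) (\<lambda>_. c)) S = avg w (\<lambda>_. c) S"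
  proof (rule avg_cong, rule Suc.IH)
    fix x assume "x \<in> S"
    thus "k \<le> card (S - {x})" using Suc.prems by (simp add: pos_weights_finite)
  qed (use Suc.prems(1) pos_weights_subset in blast)
  thus ?case using avg_const[OF Suc.prems(1) \<open>S \<noteq> {}\<close>] by simp
qed simp

text \<open>Markov property: after the first \<open>i\<close> draws only the set of remaining
  elements matters.\<close>

lemma draws_append:
  "draws w (i + j) S F = draws w i S (\<lambda>xs. draws w j (S - set xs) (\<lambda>ys. F (xs @ ys)))"
proof (induction i arbitrary: S F)
  case (Suc i)
  have *: "S - set (x # xs) = S - {x} - set xs" for x xs by auto
  show ?case using Suc by (simp add: * del: set_simps)
qed simp

lemma draws_prefix:
  assumes "pos_weights w S" "i + j \<le> card S"
    and "\<And>xs ys. length xs = i \<Longrightarrow> F (xs @ ys) = G xs"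
  shows "draws w (i + j) S F = draws w i S G"
  unfolding draws_append
proof (rule draws_cong)
  fix xs :: "'a list" assume xs: "length xs = i" "distinct xs" "set xs \<subseteq> S"
  have "draws w j (S - set xs) (\<lambda>ys. F (xs @ ys)) = draws w j (S - set xs) (\<lambda>_. G xs)"
    using assms(3)[OF xs(1)] by simp
  also have "\<dots> = G xs"
  proof (rule draws_const)
    have "card (S - set xs) = card S - i"
      using xs by (simp add: card_Diff_subset distinct_card)
    thus "j \<le> card (S - set xs)" using assms(2) by simp
  qed (use assms(1) pos_weights_subset in blast)
  finally show "draws w j (S - set xs) (\<lambda>ys. F (xs @ ys)) = G xs" .
qed

lemma draws_take:
  assumes "pos_weights w S" "i \<le> k" "k \<le> card S"
  shows "draws w k S (\<lambda>xs. F (take i xs)) = draws w i S F"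
  using draws_prefix[of w S i "k - i" "\<lambda>xs. F (take i xs)" F] assms by simp

text \<open>Tower property: the draws after position \<open>i\<close> integrate to 1, which uses
  \<open>k \<le> card S\<close>, and given the first \<open>i\<close> draws the entry at zero-based
  position \<open>i\<close> is one draw from what is left.\<close>

lemma draws_nth:
  assumes "pos_weights w S" "i < k" "k \<le> card S"
  shows "draws w k S (\<lambda>xs. f (xs ! i)) = draws w i S (\<lambda>xs. avg w f (S - set xs))"
proof -
  have "draws w k S (\<lambda>xs. f (take (Suc i) xs ! i)) = draws w (i + 1) S (\<lambda>xs. f (xs ! i))"
    using draws_take[of w S "Suc i" k "\<lambda>xs. f (xs ! i)"] assms by simp
  also have "\<dots> = draws w i S (\<lambda>xs. avg w (\<lambda>x. f ((xs @ [x]) ! i)) (S - set xs))"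
    unfolding draws_append by simp
  also have "\<dots> = draws w i S (\<lambda>xs. avg w f (S - set xs))"
    by (rule draws_cong) (simp add: nth_append)
  finally show ?thesis by simp
qed

lemma card_Diff_draws:
  "finite S \<Longrightarrow> distinct xs \<Longrightarrow> set xs \<subseteq> S \<Longrightarrow> card (S - set xs) = card S - length xs"
  by (simp add: card_Diff_subset distinct_card)

lemma draws_nonneg_bool: "pos_weights w S \<Longrightarrow> 0 \<le> draws w k S (\<lambda>xs. of_bool (Q xs))"
  by (rule draws_nonneg) auto

subsection \<open>A maximal inequality\<close>

text \<open>The event that the martingale part of the sums of \<open>f\<close> reaches level
  \<open>c\<close> at some time, with \<open>G\<close> true of every remaining set before that time.
  Lowering the level by each increment replaces a stopping time by a recursion that matches the one
  of \<open>draws\<close>.\<close>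

fun exceeds :: "('a \<Rightarrow> real) \<Rightarrow> ('a \<Rightarrow> real) \<Rightarrow> ('a set \<Rightarrow> bool) \<Rightarrow> 'a set \<Rightarrow> real \<Rightarrow> 'a list \<Rightarrow> bool" where
  "exceeds w f G S c [] \<longleftrightarrow> c \<le> 0"
| "exceeds w f G S c (x # xs) \<longleftrightarrow>
     c \<le> 0 \<or> (G S \<and> exceeds w f G (S - {x}) (c - (f x - avg w f S)) xs)"

lemma exceedsI:
  assumes "i \<le> length xs" "\<And>j. j < i \<Longrightarrow> G (S - set (take j xs))"
    "c \<le> (\<Sum>j<i. f (xs ! j) - avg w f (S - set (take j xs)))"
  shows "exceeds w f G S c xs"
  using assms
proof (induction xs arbitrary: i S c)
  case (Cons x xs)
  show ?case
  proof (cases i)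
    case (Suc k)
    have *: "S - set (take (Suc j) (x # xs)) = S - {x} - set (take j xs)" for j by auto
    have "exceeds w f G (S - {x}) (c - (f x - avg w f S)) xs"
    proof (rule Cons.IH[of k])
      show "G (S - {x} - set (take j xs))" if "j < k" for j
        using Cons.prems(2)[of "Suc j"] that Suc by (simp add: * del: take_Suc_Cons)
      show "c - (f x - avg w f S) \<le> (\<Sum>j<k. f (xs ! j) - avg w f (S - {x} - set (take j xs)))"
        using Cons.prems(3) unfolding Suc sum.lessThan_Suc_shift by (simp add: * del: take_Suc_Cons)
    qed (use Cons.prems Suc in auto)
    moreover have "G S" using Cons.prems(2)[of 0] Suc by simp
    ultimately show ?thesis by simp
  qed (use Cons in auto)
qed auto

text \<open>\<open>exp_bound\<close> covers x >= 0. For x = - y < 0, exp x is at most 1 / (1 + y +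
  y^2/2), and (1 - y + y^2) (1 + y + y^2/2) = 1 + (y^2 + y^3 + y^4) / 2 is at least 1.\<close>

lemma exp_le_one_plus_square:
  fixes x :: real assumes "x \<le> 1" shows "exp x \<le> 1 + x + x\<^sup>2"
proof (cases "x \<ge> 0")
  case True thus ?thesis using exp_bound assms by blast
next
  case False
  let ?y = "-x"
  have y: "?y > 0" using False by simp
  have "exp ?y \<ge> 1 + ?y + ?y\<^sup>2 / 2" using y exp_lower_Taylor_quadratic[of ?y] by simp
  hence "exp x \<le> 1 / (1 + ?y + ?y\<^sup>2 / 2)"
    using y by (simp add: exp_minus divide_simps add_pos_nonneg mult.commute)
  also have "\<dots> \<le> 1 - ?y + ?y\<^sup>2"
  proof -
    have "(1 - ?y + ?y\<^sup>2) * (1 + ?y + ?y\<^sup>2 / 2) = 1 + ?y\<^sup>2 / 2 + ?y^3 / 2 + ?y^4 / 2"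
      by (simp add: algebra_simps power2_eq_square power3_eq_cube power4_eq_xxxx) (simp add: field_simps)
    also have "\<dots> \<ge> 1"
    proof -
      have "0 \<le> ?y ^ 3" using y by (intro zero_le_power) simp
      moreover have "0 \<le> ?y\<^sup>2" "0 \<le> ?y ^ 4" by simp_all
      ultimately show ?thesis by linarith
    qed
    finally show ?thesis using y by (simp add: divide_simps add_pos_nonneg)
  qed
  finally show ?thesis by simp
qed

lemma avg_exp_le:
  assumes S: "pos_weights w S" "S \<noteq> {}" and \<theta>: "\<And>x. x \<in> S \<Longrightarrow> \<theta> * (f x - avg w f S) \<le> 1"
    and V: "avg w (\<lambda>x. (f x - avg w f S)\<^sup>2) S \<le> V"
  shows "avg w (\<lambda>x. exp (\<theta> * (f x - avg w f S))) S \<le> exp (\<theta>\<^sup>2 * V)"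
proof -
  let ?m = "avg w f S"
  have "avg w (\<lambda>x. exp (\<theta> * (f x - ?m))) S
      \<le> avg w (\<lambda>x. (1 - \<theta> * ?m) + \<theta> * f x + \<theta>\<^sup>2 * (f x - ?m)\<^sup>2) S"
  proof (rule avg_mono[OF S(1)])
    fix x assume "x \<in> S"
    thus "exp (\<theta> * (f x - ?m)) \<le> (1 - \<theta> * ?m) + \<theta> * f x + \<theta>\<^sup>2 * (f x - ?m)\<^sup>2"
      using exp_le_one_plus_square[OF \<theta>, of x] unfolding power_mult_distrib
      by (simp add: right_diff_distrib)
  qed
  also have "\<dots> = 1 + \<theta>\<^sup>2 * avg w (\<lambda>x. (f x - ?m)\<^sup>2) S"
    by (simp add: avg_add avg_cmult avg_const[OF S])
  also have "\<dots> \<le> 1 + \<theta>\<^sup>2 * V" using V by (simp add: mult_left_mono)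
  also have "\<dots> \<le> exp (\<theta>\<^sup>2 * V)" by simp
  finally show ?thesis .
qed

text \<open>Bernstein's inequality for the maximum, by induction on the number of draws: the first
  increment lowers the level, and its exponential moment costs exp (\<theta>^2 V). Once the level is
  nonpositive the bound is at least 1; if \<open>G\<close> fails at a positive level the event is
  empty.\<close>

lemma maximal_inequality:
  assumes "pos_weights w S" "k \<le> card S" "0 \<le> \<theta>" "0 \<le> V"
    and "\<And>S' x. S' \<subseteq> S \<Longrightarrow> G S' \<Longrightarrow> x \<in> S' \<Longrightarrow> \<theta> * (f x - avg w f S') \<le> 1"
    and "\<And>S'. S' \<subseteq> S \<Longrightarrow> G S' \<Longrightarrow> S' \<noteq> {} \<Longrightarrow> avg w (\<lambda>x. (f x - avg w f S')\<^sup>2) S' \<le> V"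
  shows "draws w k S (\<lambda>xs. of_bool (exceeds w f G S c xs)) \<le> exp (- \<theta> * c + k * (\<theta>\<^sup>2 * V))"
  using assms
proof (induction k arbitrary: S c)
  case 0
  show ?case
  proof (cases "c \<le> 0")
    case True
    thus ?thesis using 0 by (simp add: mult_nonneg_nonpos)
  qed simp
next
  case (Suc k)
  have ne: "S \<noteq> {}" using Suc.prems by auto
  show ?case
  proof (cases "c \<le> 0")
    case True
    have "draws w (Suc k) S (\<lambda>xs. of_bool (exceeds w f G S c xs)) \<le> draws w (Suc k) S (\<lambda>_. 1)"
      by (rule draws_mono[OF Suc.prems(1)]) auto
    also have "\<dots> = 1" by (rule draws_const) (use Suc.prems in auto)
    also have "1 \<le> exp (- \<theta> * c + (Suc k) * (\<theta>\<^sup>2 * V))"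
    proof -
      have "0 \<le> - \<theta> * c" using True Suc.prems(3) by (simp add: mult_nonneg_nonpos)
      moreover have "0 \<le> real (Suc k) * (\<theta>\<^sup>2 * V)" using Suc.prems(4) by simp
      ultimately show ?thesis unfolding one_le_exp_iff by linarith
    qed
    finally show ?thesis .
  next
    case c: False
    show ?thesis
    proof (cases "G S")
      case False
      thus ?thesis using c by simp
    next
      case True
      let ?m = "avg w f S"
      have "draws w (Suc k) S (\<lambda>xs. of_bool (exceeds w f G S c xs))
          = avg w (\<lambda>x. draws w k (S - {x}) (\<lambda>xs. of_bool (exceeds w f G (S - {x}) (c - (f x - ?m)) xs))) S"
        using c True by simp
      also have "\<dots> \<le> avg w (\<lambda>x. exp (- \<theta> * c + k * (\<theta>\<^sup>2 * V)) * exp (\<theta> * (f x - ?m))) S"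
      proof (rule avg_mono[OF Suc.prems(1)])
        fix x assume x: "x \<in> S"
        have "draws w k (S - {x}) (\<lambda>xs. of_bool (exceeds w f G (S - {x}) (c - (f x - ?m)) xs))
            \<le> exp (- \<theta> * (c - (f x - ?m)) + k * (\<theta>\<^sup>2 * V))"
        proof (rule Suc.IH)
          show "pos_weights w (S - {x})" using Suc.prems(1) pos_weights_subset by blast
          show "k \<le> card (S - {x})" using Suc.prems x by (simp add: pos_weights_finite)
        qed (use Suc.prems in \<open>simp_all add: subset_Diff_insert\<close>)
        also have "\<dots> = exp (- \<theta> * c + k * (\<theta>\<^sup>2 * V)) * exp (\<theta> * (f x - ?m))"
          by (simp add: exp_add[symmetric] algebra_simps)
        finally show "draws w k (S - {x}) (\<lambda>xs. of_bool (exceeds w f G (S - {x}) (c - (f x - ?m)) xs))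
          \<le> exp (- \<theta> * c + k * (\<theta>\<^sup>2 * V)) * exp (\<theta> * (f x - ?m))" .
      qed
      also have "\<dots> = exp (- \<theta> * c + k * (\<theta>\<^sup>2 * V)) * avg w (\<lambda>x. exp (\<theta> * (f x - ?m))) S"
        by (rule avg_cmult)
      also have "\<dots> \<le> exp (- \<theta> * c + k * (\<theta>\<^sup>2 * V)) * exp (\<theta>\<^sup>2 * V)"
        by (intro mult_left_mono avg_exp_le Suc.prems(1) ne)
          (use Suc.prems(5,6)[of S] True ne in auto)
      also have "\<dots> = exp (- \<theta> * c + (Suc k) * (\<theta>\<^sup>2 * V))"
        by (simp add: exp_add[symmetric] algebra_simps)
      finally show ?thesis .
    qed
  qed
qed

lemma avg_square_dev_le:
  assumes "pos_weights w S" "S \<noteq> {}"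
  shows "avg w (\<lambda>x. (f x - avg w f S)\<^sup>2) S \<le> avg w (\<lambda>x. (f x)\<^sup>2) S"
proof -
  let ?m = "avg w f S"
  have "avg w (\<lambda>x. (f x - ?m)\<^sup>2) S = avg w (\<lambda>x. (f x)\<^sup>2 + (-2 * ?m) * f x + ?m\<^sup>2) S"
    by (rule avg_cong) (simp add: power2_eq_square algebra_simps)
  also have "\<dots> = avg w (\<lambda>x. (f x)\<^sup>2) S - ?m\<^sup>2"
    by (simp only: avg_add avg_cmult avg_const[OF assms]) (simp add: power2_eq_square)
  finally show ?thesis by simp
qed

subsection \<open>Independent thinning\<close>

text \<open>The expectation of \<open>g\<close> at a random subset of \<open>I\<close> that keeps
  each \<open>i\<close> independently with probability \<open>p i\<close>. As a finite sum it needs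
  no product space, and it can be treated by induction on \<open>I\<close>.\<close>

definition thin :: "('a \<Rightarrow> real) \<Rightarrow> 'a set \<Rightarrow> ('a set \<Rightarrow> real) \<Rightarrow> real" where
  "thin p I g = (\<Sum>S\<in>Pow I. (\<Prod>i\<in>S. p i) * (\<Prod>i\<in>I-S. 1 - p i) * g S)"

lemma thin_empty [simp]: "thin p {} g = g {}"
  by (simp add: thin_def)

lemma thin_insert:
  assumes "finite I" "x \<notin> I"
  shows "thin p (insert x I) g = p x * thin p I (\<lambda>S. g (insert x S)) + (1 - p x) * thin p I g"
proof -
  let ?T = "\<lambda>S. (\<Prod>i\<in>S. p i) * (\<Prod>i\<in>insert x I-S. 1 - p i) * g S"
  have "thin p (insert x I) g = (\<Sum>S\<in>Pow I. ?T S) + (\<Sum>S\<in>insert x ` Pow I. ?T S)"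
    unfolding thin_def Pow_insert by (rule sum.union_disjoint) (use assms in auto)
  also have "(\<Sum>S\<in>Pow I. ?T S) = (1 - p x) * thin p I g"
    unfolding thin_def sum_distrib_left
  proof (rule sum.cong)
    fix S assume "S \<in> Pow I"
    hence *: "insert x I - S = insert x (I - S)" using assms by auto
    show "?T S = (1 - p x) * ((\<Prod>i\<in>S. p i) * (\<Prod>i\<in>I-S. 1 - p i) * g S)"
      unfolding * using assms by (subst prod.insert) auto
  qed simp
  also have "(\<Sum>S\<in>insert x ` Pow I. ?T S) = (\<Sum>S\<in>Pow I. ?T (insert x S))"
    by (rule sum.reindex_cong[of "insert x"]) (use assms in \<open>auto simp: inj_on_def\<close>)
  also have "\<dots> = p x * thin p I (\<lambda>S. g (insert x S))"
    unfolding thin_def sum_distrib_left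
  proof (rule sum.cong)
    fix S assume S: "S \<in> Pow I"
    hence *: "insert x I - insert x S = I - S" using assms by auto
    have "finite S" "x \<notin> S" using S assms by (auto intro: finite_subset)
    thus "?T (insert x S) = p x * ((\<Prod>i\<in>S. p i) * (\<Prod>i\<in>I-S. 1 - p i) * g (insert x S))"
      unfolding * by (subst prod.insert) auto
  qed simp
  finally show ?thesis by simp
qed

lemma thin_mono:
  assumes "\<And>i. i \<in> I \<Longrightarrow> 0 \<le> p i \<and> p i \<le> 1" "\<And>S. S \<subseteq> I \<Longrightarrow> g S \<le> h S"
  shows "thin p I g \<le> thin p I h"
  unfolding thin_def
  by (intro sum_mono mult_left_mono mult_nonneg_nonneg prod_nonneg) (use assms in auto)

lemma thin_cong: "(\<And>S. S \<subseteq> I \<Longrightarrow> g S = h S) \<Longrightarrow> thin p I g = thin p I h"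
  unfolding thin_def by (rule sum.cong) auto

lemma thin_add: "thin p I (\<lambda>S. g S + h S) = thin p I g + thin p I h"
  by (simp add: thin_def algebra_simps sum.distrib)

lemma thin_cmult: "thin p I (\<lambda>S. c * g S) = c * thin p I g"
  by (simp add: thin_def sum_distrib_left mult_ac)

lemma thin_zero [simp]: "thin p I (\<lambda>S. 0) = 0"
  by (simp add: thin_def)

lemma thin_one: "finite I \<Longrightarrow> thin (\<lambda>_. 1) I g = g I"
  by (induction I arbitrary: g rule: finite_induct) (simp_all add: thin_insert)

lemma thin_exp_sum:
  assumes "finite I"
  shows "thin p I (\<lambda>S. exp (sum a S)) = (\<Prod>i\<in>I. 1 + p i * (exp (a i) - 1))"
proof -
  have "(\<Prod>i\<in>I. 1 + p i * (exp (a i) - 1)) = (\<Prod>i\<in>I. p i * exp (a i) + (1 - p i))"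
    by (simp add: algebra_simps)
  also have "\<dots> = (\<Sum>S\<in>Pow I. (\<Prod>i\<in>S. p i * exp (a i)) * (\<Prod>i\<in>I-S. 1 - p i))"
    by (rule prod_add[OF assms])
  also have "\<dots> = thin p I (\<lambda>S. exp (sum a S))"
    unfolding thin_def
    by (rule sum.cong) (use assms in \<open>auto simp: prod.distrib exp_sum finite_subset mult_ac\<close>)
  finally show ?thesis by simp
qed

lemma thin_markov:
  assumes "finite I" "\<And>i. i \<in> I \<Longrightarrow> 0 \<le> p i \<and> p i \<le> 1" "0 \<le> \<theta>"
  shows "thin p I (\<lambda>S. of_bool (c \<le> sum f S))
    \<le> exp (- \<theta> * c) * (\<Prod>i\<in>I. 1 + p i * (exp (\<theta> * f i) - 1))"
proof -
  have "thin p I (\<lambda>S. of_bool (c \<le> sum f S))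
      \<le> thin p I (\<lambda>S. exp (- \<theta> * c) * exp (sum (\<lambda>i. \<theta> * f i) S))"
  proof (rule thin_mono[OF assms(2)])
    fix S
    have "0 \<le> - \<theta> * c + \<theta> * sum f S" if "c \<le> sum f S"
      using mult_left_mono[OF that assms(3)] by simp
    thus "of_bool (c \<le> sum f S) \<le> exp (- \<theta> * c) * exp (sum (\<lambda>i. \<theta> * f i) S)"
      by (simp add: exp_add[symmetric] sum_distrib_left[symmetric])
  qed
  also have "\<dots> = exp (- \<theta> * c) * (\<Prod>i\<in>I. 1 + p i * (exp (\<theta> * f i) - 1))"
    by (simp only: thin_cmult thin_exp_sum[OF assms(1)])
  finally show ?thesis .
qed

text \<open>Poisson-type bound without centring. It does not limit the size of \<theta> f and serves
  upper bounds that may lose a constant factor.\<close>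

lemma thin_chernoff:
  assumes "finite I" "\<And>i. i \<in> I \<Longrightarrow> 0 \<le> p i \<and> p i \<le> 1" "0 \<le> \<theta>"
  shows "thin p I (\<lambda>S. of_bool (c \<le> sum f S))
    \<le> exp (- \<theta> * c + (\<Sum>i\<in>I. p i * (exp (\<theta> * f i) - 1)))"
proof -
  have "(\<Prod>i\<in>I. 1 + p i * (exp (\<theta> * f i) - 1)) \<le> (\<Prod>i\<in>I. exp (p i * (exp (\<theta> * f i) - 1)))"
  proof (rule prod_mono)
    fix i assume i: "i \<in> I"
    have "0 \<le> (1 - p i) + p i * exp (\<theta> * f i)"
      using assms(2)[OF i] by (intro add_nonneg_nonneg mult_nonneg_nonneg) auto
    thus "0 \<le> 1 + p i * (exp (\<theta> * f i) - 1) \<and>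
        1 + p i * (exp (\<theta> * f i) - 1) \<le> exp (p i * (exp (\<theta> * f i) - 1))"
      using exp_ge_add_one_self[of "p i * (exp (\<theta> * f i) - 1)"] by (simp add: algebra_simps)
  qed
  also have "\<dots> = exp (\<Sum>i\<in>I. p i * (exp (\<theta> * f i) - 1))"
    using assms(1) by (simp add: exp_sum)
  finally have "exp (- \<theta> * c) * (\<Prod>i\<in>I. 1 + p i * (exp (\<theta> * f i) - 1))
      \<le> exp (- \<theta> * c + (\<Sum>i\<in>I. p i * (exp (\<theta> * f i) - 1)))"
    unfolding exp_add by (rule mult_left_mono) simp
  moreover have "thin p I (\<lambda>S. of_bool (c \<le> sum f S))
      \<le> exp (- \<theta> * c) * (\<Prod>i\<in>I. 1 + p i * (exp (\<theta> * f i) - 1))"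
    by (rule thin_markov) (use assms in auto)
  ultimately show ?thesis by linarith
qed

text \<open>After centring, the two atoms a (1 - p) and - a p lie in [-1, 1], their linear terms
  cancel and their squares average to a^2 p (1 - p). Keeping the factor 1 - p makes the bound sharp
  also at early times, when almost every element is alive.\<close>

lemma bernoulli_mgf_le:
  fixes p a :: real
  assumes p: "0 \<le> p" "p \<le> 1" and a: "\<bar>a\<bar> \<le> 1"
  shows "1 + p * (exp a - 1) \<le> exp (p * a + a\<^sup>2 * (p * (1 - p)))"
proof -
  have "\<bar>a * (1 - p)\<bar> \<le> 1 * 1" unfolding abs_mult using p a by (intro mult_mono) auto
  hence 1: "exp (a * (1 - p)) \<le> 1 + a * (1 - p) + (a * (1 - p))\<^sup>2"
    by (intro exp_le_one_plus_square) auto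
  have "\<bar>- (a * p)\<bar> \<le> 1 * 1" unfolding abs_minus_cancel abs_mult using p a by (intro mult_mono) auto
  hence 2: "exp (- (a * p)) \<le> 1 + - (a * p) + (- (a * p))\<^sup>2"
    by (intro exp_le_one_plus_square) auto
  have "(1 + p * (exp a - 1)) * exp (- (a * p)) = p * exp (a * (1 - p)) + (1 - p) * exp (- (a * p))"
    by (simp add: algebra_simps exp_add[symmetric])
  also have "\<dots> \<le> p * (1 + a * (1 - p) + (a * (1 - p))\<^sup>2) + (1 - p) * (1 + - (a * p) + (- (a * p))\<^sup>2)"
    using 1 2 p by (intro add_mono mult_left_mono) auto
  also have "\<dots> = 1 + a\<^sup>2 * (p * (1 - p))"
    by (simp add: power2_eq_square algebra_simps)
  also have "\<dots> \<le> exp (a\<^sup>2 * (p * (1 - p)))" by simp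
  finally have "(1 + p * (exp a - 1)) * exp (- (a * p)) * exp (a * p)
      \<le> exp (a\<^sup>2 * (p * (1 - p))) * exp (a * p)" by (rule mult_right_mono) simp
  thus ?thesis by (simp add: mult.assoc exp_add[symmetric]) (simp add: add.commute mult.commute)
qed

lemma thin_bernstein:
  assumes I: "finite I" and p: "\<And>i. i \<in> I \<Longrightarrow> 0 \<le> p i \<and> p i \<le> 1"
    and \<theta>: "0 \<le> \<theta>" "\<And>i. i \<in> I \<Longrightarrow> \<theta> * \<bar>f i\<bar> \<le> 1"
  shows "thin p I (\<lambda>S. of_bool ((\<Sum>i\<in>I. p i * f i) + c \<le> sum f S))
    \<le> exp (- \<theta> * c + \<theta>\<^sup>2 * (\<Sum>i\<in>I. (f i)\<^sup>2 * (p i * (1 - p i))))"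
proof -
  let ?c = "(\<Sum>i\<in>I. p i * f i) + c"
  have "thin p I (\<lambda>S. of_bool (?c \<le> sum f S))
      \<le> exp (- \<theta> * ?c) * (\<Prod>i\<in>I. 1 + p i * (exp (\<theta> * f i) - 1))"
    by (rule thin_markov) (use assms in auto)
  also have "\<dots> \<le> exp (- \<theta> * ?c) * (\<Prod>i\<in>I. exp (p i * (\<theta> * f i) + (\<theta> * f i)\<^sup>2 * (p i * (1 - p i))))"
  proof (intro mult_left_mono prod_mono conjI)
    fix i assume i: "i \<in> I"
    have "0 \<le> (1 - p i) + p i * exp (\<theta> * f i)"
      using p[OF i] by (intro add_nonneg_nonneg mult_nonneg_nonneg) auto
    thus "0 \<le> 1 + p i * (exp (\<theta> * f i) - 1)" by (simp add: algebra_simps)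
    show "1 + p i * (exp (\<theta> * f i) - 1) \<le> exp (p i * (\<theta> * f i) + (\<theta> * f i)\<^sup>2 * (p i * (1 - p i)))"
      using p[OF i] \<theta>(2)[OF i] \<theta>(1) by (intro bernoulli_mgf_le) (auto simp: abs_mult)
  qed simp
  also have "(\<Prod>i\<in>I. exp (p i * (\<theta> * f i) + (\<theta> * f i)\<^sup>2 * (p i * (1 - p i))))
      = exp (\<Sum>i\<in>I. p i * (\<theta> * f i) + (\<theta> * f i)\<^sup>2 * (p i * (1 - p i)))"
    using I by (simp add: exp_sum)
  also have "(\<Sum>i\<in>I. p i * (\<theta> * f i) + (\<theta> * f i)\<^sup>2 * (p i * (1 - p i)))
      = \<theta> * (\<Sum>i\<in>I. p i * f i) + \<theta>\<^sup>2 * (\<Sum>i\<in>I. (f i)\<^sup>2 * (p i * (1 - p i)))"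
    by (simp add: sum.distrib sum_distrib_left power_mult_distrib mult_ac)
  finally show ?thesis by (simp add: exp_add[symmetric] algebra_simps)
qed

subsection \<open>Comparison of sampling with thinning\<close>

definition survive :: "('a \<Rightarrow> real) \<Rightarrow> real \<Rightarrow> 'a \<Rightarrow> real" where
  "survive w t i = exp (- (w i * t))"

text \<open>The generator of the pure death process in which each element \<open>x\<close> dies at
  rate \<open>w x\<close>. Its jump chain is the size-biased sample.\<close>

definition gen :: "('a \<Rightarrow> real) \<Rightarrow> ('a set \<Rightarrow> real) \<Rightarrow> 'a set \<Rightarrow> real" where
  "gen w g S = (\<Sum>x\<in>S. w x * (g (S - {x}) - g S))"

lemma gen_insert:
  assumes "finite S" "x \<notin> S"
  shows "gen w g (insert x S) = w x * (g S - g (insert x S)) + gen w (\<lambda>S. g (insert x S)) S"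
proof -
  have "gen w g (insert x S) = w x * (g (insert x S - {x}) - g (insert x S))
      + (\<Sum>y\<in>S. w y * (g (insert x S - {y}) - g (insert x S)))"
    unfolding gen_def by (rule sum.insert) (use assms in auto)
  also have "insert x S - {x} = S" using assms by auto
  also have "(\<Sum>y\<in>S. w y * (g (insert x S - {y}) - g (insert x S))) = gen w (\<lambda>S. g (insert x S)) S"
    unfolding gen_def
  proof (rule sum.cong)
    fix y assume "y \<in> S"
    hence "insert x S - {y} = insert x (S - {y})" using assms by auto
    thus "w y * (g (insert x S - {y}) - g (insert x S))
        = w y * (g (insert x (S - {y})) - g (insert x S))" by simp
  qed simp
  finally show ?thesis .
qed

text \<open>Kolmogorov's equation for the death process. In the induction \<open>thin_insert\<close>
  splits according to the fate of the new element, and \<open>gen_insert\<close> splits the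
  generator accordingly.\<close>

lemma thin_survive_derivative:
  assumes "finite I"
  shows "((\<lambda>t. thin (survive w t) I g) has_real_derivative thin (survive w t) I (gen w g)) (at t)"
  using assms
proof (induction I arbitrary: g rule: finite_induct)
  case empty
  show ?case by (simp add: gen_def)
next
  case (insert x I)
  let ?A = "\<lambda>t. thin (survive w t) I"
  let ?g = "\<lambda>S. g (insert x S)"
  have p: "((\<lambda>t. survive w t x) has_real_derivative - w x * survive w t x) (at t)"
    unfolding survive_def by (auto intro!: derivative_eq_intros)
  have deriv: "((\<lambda>t. survive w t x * ?A t ?g + (1 - survive w t x) * ?A t g) has_real_derivative
      (- w x * survive w t x * ?A t ?g + ?A t (gen w ?g) * survive w t x)
      + ((0 - (- w x * survive w t x)) * ?A t g + ?A t (gen w g) * (1 - survive w t x))) (at t)"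
    by (intro DERIV_add DERIV_mult DERIV_diff DERIV_const p insert.IH)
  have "?A t (\<lambda>S. gen w g (insert x S))
      = ?A t (\<lambda>S. w x * g S + ((- w x) * ?g S + gen w ?g S))"
  proof (rule thin_cong)
    fix S assume "S \<subseteq> I"
    hence "finite S" "x \<notin> S" using insert.hyps by (auto intro: finite_subset)
    from gen_insert[OF this, of w g] show "gen w g (insert x S) = w x * g S + ((- w x) * ?g S + gen w ?g S)"
      by (simp add: algebra_simps)
  qed
  hence eq: "?A t (\<lambda>S. gen w g (insert x S)) = w x * ?A t g + ((- w x) * ?A t ?g + ?A t (gen w ?g))"
    by (simp only: thin_add thin_cmult)
  show ?case
    unfolding thin_insert[OF insert.hyps(1,2)] eq
    by (rule DERIV_cong[OF deriv]) (simp add: algebra_simps)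
qed

lemma survive_bounds:
  assumes "pos_weights w I" "0 \<le> t" "i \<in> I"
  shows "0 \<le> survive w t i \<and> survive w t i \<le> 1"
  using assms pos_weightsD[of w I i] by (simp add: survive_def)

text \<open>Interpolating function: run the sampling chain for the remaining number of draws. It is harmonic
  for the thinning process up to the \<open>k\<close>-th death, so its thinned expectation can only grow.\<close>

lemma draws_le_thin_aux:
  assumes w: "pos_weights w I" and k: "k \<le> card I" and t: "0 \<le> t"
    and g: "\<And>S x. S \<subseteq> I \<Longrightarrow> card S + k \<le> card I \<Longrightarrow> x \<in> S \<Longrightarrow> g S \<le> g (S - {x})"
  shows "draws w k I (\<lambda>xs. g (I - set xs))
    \<le> thin (survive w t) I (\<lambda>S. draws w (card S + k - card I) S (\<lambda>xs. g (S - set xs)))"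
proof -
  note fin = pos_weights_finite[OF w]
  \<comment> \<open>\<open>card S + k - card I\<close> is the number of draws still to be made when
    \<open>S\<close> is alive. Truncated subtraction makes it 0 once \<open>k\<close> elements are
    dead, and there \<open>h\<close> is \<open>g\<close> itself.\<close>
  define h where "h S = draws w (card S + k - card I) S (\<lambda>xs. g (S - set xs))" for S
  have gen_nonneg: "0 \<le> gen w h S" if S: "S \<subseteq> I" for S
  proof (cases "card S + k \<le> card I")
    case True
    have "h S \<le> h (S - {x})" if "x \<in> S" for x
    proof -
      have "card (S - {x}) \<le> card S" using S fin by (intro card_mono) (auto intro: finite_subset)
      thus ?thesis using True g[OF S True that] by (simp add: h_def)
    qed
    thus ?thesis unfolding gen_def using pos_weightsD[OF w] S
      by (intro sum_nonneg mult_nonneg_nonneg) (auto intro: less_imp_le)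
  next
    case False
    then obtain j where j: "card S + k = card I + Suc j"
      by (metis add_Suc_right less_imp_Suc_add not_le)
    have finS: "finite S" using S fin finite_subset by blast
    have ne: "S \<noteq> {}" using j k by auto
    have "h S = avg w (\<lambda>x. draws w j (S - {x}) (\<lambda>xs. g (S - set (x # xs)))) S"
      unfolding h_def j by simp
    also have "\<dots> = avg w (\<lambda>x. h (S - {x})) S"
    proof (rule avg_cong)
      fix x assume x: "x \<in> S"
      have *: "S - set (x # xs) = S - {x} - set xs" for xs by auto
      have "Suc (card (S - {x})) = card S" using x finS by (simp only: card_Suc_Diff1)
      hence "card (S - {x}) + k - card I = j" using j by linarith
      thus "draws w j (S - {x}) (\<lambda>xs. g (S - set (x # xs))) = h (S - {x})"
        unfolding h_def * by simp
    qed
    finally have "(\<Sum>x\<in>S. w x * h (S - {x})) = sum w S * h S"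
      using pos_weights_sum_pos[OF pos_weights_subset[OF w S] ne] by (simp add: avg_def)
    hence "gen w h S = 0"
      unfolding gen_def by (simp add: algebra_simps sum_subtractf sum_distrib_left)
    thus ?thesis by simp
  qed
  have "thin (survive w 0) I h \<le> thin (survive w t) I h"
  proof (rule DERIV_nonneg_imp_nondecreasing[OF t])
    fix s :: real assume s: "0 \<le> s"
    have "thin (survive w s) I (\<lambda>_. 0) \<le> thin (survive w s) I (gen w h)"
      by (rule thin_mono) (use survive_bounds[OF w s] gen_nonneg in auto)
    thus "\<exists>y. ((\<lambda>t. thin (survive w t) I h) has_real_derivative y) (at s) \<and> 0 \<le> y"
      using thin_survive_derivative[OF fin] by auto
  qed
  moreover have "survive w 0 = (\<lambda>_. 1)" by (simp add: survive_def fun_eq_iff)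
  ultimately have "h I \<le> thin (survive w t) I h" by (simp add: thin_one[OF fin])
  thus ?thesis by (simp add: h_def[abs_def])
qed

text \<open>The event of more than \<open>k\<close> deaths is added to \<open>G\<close>: any removal
  after the \<open>k\<close>-th death produces it, which gives the monotonicity that the
  interpolation asks for. With fewer than \<open>k\<close> deaths the missing draws only shrink
  \<open>S\<close>, and \<open>G\<close> passes from the smaller set up to \<open>S\<close>.\<close>

lemma draws_le_thin_up:
  assumes w: "pos_weights w I" and k: "k \<le> card I" and t: "0 \<le> t"
    and G: "\<And>S S'. S \<subseteq> S' \<Longrightarrow> S' \<subseteq> I \<Longrightarrow> G S \<Longrightarrow> G S'"
  shows "draws w k I (\<lambda>xs. of_bool (G (I - set xs)))
    \<le> thin (survive w t) I (\<lambda>S. of_bool (card S + k < card I)) + thin (survive w t) I (\<lambda>S. of_bool (G S))"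
proof -
  note fin = pos_weights_finite[OF w]
  define g :: "'a set \<Rightarrow> real" where "g S = of_bool (card S + k < card I \<or> G S)" for S
  have "draws w k I (\<lambda>xs. of_bool (G (I - set xs))) \<le> draws w k I (\<lambda>xs. g (I - set xs))"
    by (rule draws_mono[OF w]) (auto simp: g_def)
  also have "\<dots> \<le> thin (survive w t) I (\<lambda>S. draws w (card S + k - card I) S (\<lambda>xs. g (S - set xs)))"
  proof (rule draws_le_thin_aux[OF w k t])
    fix S x assume S: "S \<subseteq> I" "card S + k \<le> card I" "x \<in> S"
    have "card (S - {x}) < card S"
      using S fin by (intro psubset_card_mono) (auto intro: finite_subset)
    thus "g S \<le> g (S - {x})" using S by (simp add: g_def)
  qed
  also have "\<dots> \<le> thin (survive w t) I (\<lambda>S. of_bool (card S + k < card I) + of_bool (G S))"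
  proof (rule thin_mono[OF survive_bounds[OF w t]])
    fix S assume S: "S \<subseteq> I"
    show "draws w (card S + k - card I) S (\<lambda>xs. g (S - set xs))
        \<le> of_bool (card S + k < card I) + of_bool (G S)"
    proof (cases "card S + k \<le> card I")
      case True
      thus ?thesis by (auto simp: g_def)
    next
      case False
      have wS: "pos_weights w S" using w S by (rule pos_weights_subset)
      have "draws w (card S + k - card I) S (\<lambda>xs. g (S - set xs))
          \<le> draws w (card S + k - card I) S (\<lambda>_. of_bool (G S))"
      proof (rule draws_mono[OF wS])
        fix xs assume xs: "length xs = card S + k - card I" "distinct xs" "set xs \<subseteq> S"
        have "card (S - set xs) = card S - length xs"
          using xs S fin by (intro card_Diff_draws) (auto intro: finite_subset)
        hence "\<not> card (S - set xs) + k < card I" using xs(1) False k by linarith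
        moreover have "G S" if "G (S - set xs)" using G[OF _ S that] by auto
        ultimately show "g (S - set xs) \<le> of_bool (G S)" by (simp add: g_def)
      qed
      also have "\<dots> = of_bool (G S)" by (rule draws_const[OF wS]) (use k in auto)
      finally show ?thesis by (rule order_trans) simp
    qed
  qed
  finally show ?thesis by (simp only: thin_add)
qed

text \<open>A decreasing \<open>G\<close> is already monotone under deaths. When fewer than
  \<open>k\<close> elements have died, the interpolating function is bounded by 1, which is the
  first term; otherwise no draw is missing and it equals \<open>G S\<close>.\<close>

lemma draws_le_thin_down:
  assumes w: "pos_weights w I" and k: "k \<le> card I" and t: "0 \<le> t"
    and G: "\<And>S S'. S \<subseteq> S' \<Longrightarrow> S' \<subseteq> I \<Longrightarrow> G S' \<Longrightarrow> G S"
  shows "draws w k I (\<lambda>xs. of_bool (G (I - set xs)))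
    \<le> thin (survive w t) I (\<lambda>S. of_bool (card I < card S + k)) + thin (survive w t) I (\<lambda>S. of_bool (G S))"
proof -
  note fin = pos_weights_finite[OF w]
  define g :: "'a set \<Rightarrow> real" where "g S = of_bool (G S)" for S
  have "draws w k I (\<lambda>xs. g (I - set xs))
      \<le> thin (survive w t) I (\<lambda>S. draws w (card S + k - card I) S (\<lambda>xs. g (S - set xs)))"
  proof (rule draws_le_thin_aux[OF w k t])
    fix S x assume S: "S \<subseteq> I" "card S + k \<le> card I" "x \<in> S"
    have "G (S - {x})" if "G S" using G[OF _ _ that, of "S - {x}"] S by auto
    thus "g S \<le> g (S - {x})" by (simp add: g_def)
  qed
  also have "\<dots> \<le> thin (survive w t) I (\<lambda>S. of_bool (card I < card S + k) + of_bool (G S))"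
  proof (rule thin_mono[OF survive_bounds[OF w t]])
    fix S assume S: "S \<subseteq> I"
    show "draws w (card S + k - card I) S (\<lambda>xs. g (S - set xs))
        \<le> of_bool (card I < card S + k) + of_bool (G S)"
    proof (cases "card S + k \<le> card I")
      case True
      thus ?thesis by (auto simp: g_def)
    next
      case False
      have wS: "pos_weights w S" using w S by (rule pos_weights_subset)
      have "draws w (card S + k - card I) S (\<lambda>xs. g (S - set xs))
          \<le> draws w (card S + k - card I) S (\<lambda>_. 1)"
        by (rule draws_mono[OF wS]) (auto simp: g_def)
      also have "\<dots> = 1" by (rule draws_const[OF wS]) (use k in auto)
      finally show ?thesis using False by (auto simp: not_le)
    qed
  qed
  finally show ?thesis by (simp only: thin_add g_def)
qed

subsection \<open>Concentration of the set of remaining elements\<close>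

text \<open>The expected sum of \<open>b\<close> over the elements of \<open>I\<close> alive at time
  \<open>t\<close>.\<close>

definition mass :: "('a \<Rightarrow> real) \<Rightarrow> ('a \<Rightarrow> real) \<Rightarrow> 'a set \<Rightarrow> real \<Rightarrow> real" where
  "mass w b I t = (\<Sum>i\<in>I. survive w t i * b i)"

text \<open>The variance of the number of elements alive at time \<open>t\<close>.\<close>

definition mvar :: "('a \<Rightarrow> real) \<Rightarrow> 'a set \<Rightarrow> real \<Rightarrow> real" where
  "mvar w I t = (\<Sum>i\<in>I. survive w t i * (1 - survive w t i))"

lemma survive_mono: "0 \<le> w i \<Longrightarrow> s \<le> t \<Longrightarrow> survive w t i \<le> survive w s i"
  by (simp add: survive_def mult_left_mono)

lemma survive_diff_ge:
  assumes "0 \<le> w i" "s \<le> t"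
  shows "(t - s) * (w i * survive w t i) \<le> survive w s i - survive w t i"
proof -
  have "survive w s i = survive w t i * exp (w i * (t - s))"
    by (simp add: survive_def exp_add[symmetric] algebra_simps)
  moreover have "survive w t i * (1 + w i * (t - s)) \<le> survive w t i * exp (w i * (t - s))"
    by (intro mult_left_mono exp_ge_add_one_self) (simp add: survive_def)
  ultimately show ?thesis by (simp add: algebra_simps)
qed

lemma one_minus_survive_le: "1 - survive w t i \<le> w i * t"
  using exp_ge_add_one_self[of "- (w i * t)"] by (simp add: survive_def)

lemma mass_mono_weight:
  "(\<And>i. i \<in> I \<Longrightarrow> b i \<le> c i) \<Longrightarrow> mass w b I t \<le> mass w c I t"
  unfolding mass_def by (intro sum_mono mult_left_mono) (auto simp: survive_def)

lemma mass_nonneg: "(\<And>i. i \<in> I \<Longrightarrow> 0 \<le> b i) \<Longrightarrow> 0 \<le> mass w b I t"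
  unfolding mass_def by (intro sum_nonneg mult_nonneg_nonneg) (auto simp: survive_def)

lemma mass_antimono:
  assumes "pos_weights w I" "\<And>i. i \<in> I \<Longrightarrow> 0 \<le> b i" "s \<le> t"
  shows "mass w b I t \<le> mass w b I s"
  unfolding mass_def
  by (intro sum_mono mult_right_mono survive_mono) (use assms pos_weightsD[OF assms(1)] in \<open>auto intro: less_imp_le\<close>)

lemma mass_zero: "mass w b I 0 = sum b I"
  by (simp add: mass_def survive_def)

lemma mass_one_zero: "mass w (\<lambda>_. 1) I 0 = card I"
  by (simp add: mass_zero)

lemma continuous_mass: "continuous_on A (mass w b I)"
  unfolding mass_def survive_def by (intro continuous_intros)

lemma mass_tendsto_0:
  assumes "pos_weights w I"
  shows "(mass w b I \<longlongrightarrow> 0) at_top"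
proof -
  have "((\<lambda>t. \<Sum>i\<in>I. survive w t i * b i) \<longlongrightarrow> (\<Sum>i\<in>I. 0 * b i)) at_top"
  proof (intro tendsto_sum tendsto_mult tendsto_const)
    fix i assume "i \<in> I"
    hence "0 < w i" by (rule pos_weightsD[OF assms])
    hence "filterlim (\<lambda>t. - (w i * t)) at_bot at_top"
      by (simp add: filterlim_uminus_at_bot filterlim_tendsto_pos_mult_at_top[OF tendsto_const] filterlim_ident)
    thus "((\<lambda>t. survive w t i) \<longlongrightarrow> 0) at_top"
      unfolding survive_def by (rule filterlim_compose[OF exp_at_bot])
  qed
  thus ?thesis by (simp add: mass_def[abs_def])
qed

lemma mass_attains_above:
  assumes "pos_weights w I" "0 < c" "c \<le> mass w b I s"
  shows "\<exists>t\<ge>s. mass w b I t = c"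
proof -
  have "eventually (\<lambda>t. mass w b I t < c) at_top"
    using order_tendstoD(2)[OF mass_tendsto_0[OF assms(1)] assms(2)] .
  moreover have "eventually (\<lambda>t. s \<le> t) at_top" by (rule eventually_ge_at_top)
  ultimately obtain u where u: "s \<le> u" "mass w b I u < c"
    using eventually_conj[of "\<lambda>t. mass w b I t < c" at_top] eventually_happens'[of "at_top :: real filter"]
    by (metis (mono_tags, lifting) trivial_limit_at_top_linorder eventually_conj)
  show ?thesis
    using IVT2'[of "mass w b I" u c s] u assms(3) continuous_mass by (metis less_imp_le)
qed

lemma mass_attains_below:
  assumes "0 \<le> t" "mass w b I t \<le> c" "c \<le> mass w b I 0"
  shows "\<exists>s. 0 \<le> s \<and> s \<le> t \<and> mass w b I s = c"
  using IVT2'[of "mass w b I" t c 0, OF assms(2,3,1) continuous_mass] by blast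

text \<open>The expected number of deaths per unit of time is \<open>mass w w I\<close>, which
  decreases in time, so its value at the end \<open>t\<close> is a lower bound for the rate on the
  whole interval.\<close>

lemma mass_one_diff_ge:
  assumes "pos_weights w I" "s \<le> t"
  shows "(t - s) * mass w w I t \<le> mass w (\<lambda>_. 1) I s - mass w (\<lambda>_. 1) I t"
  unfolding mass_def sum_distrib_left sum_subtractf[symmetric]
  by (rule sum_mono)
    (use survive_diff_ge[of w _ s t] assms pos_weightsD[OF assms(1)] in \<open>auto simp: mult_ac less_imp_le\<close>)

lemma mvar_le_dead:
  assumes "pos_weights w I" "0 \<le> t"
  shows "mvar w I t \<le> card I - mass w (\<lambda>_. 1) I t"
proof -
  have "mvar w I t \<le> (\<Sum>i\<in>I. 1 - survive w t i)"
    unfolding mvar_def using survive_bounds[OF assms]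
    by (intro sum_mono mult_left_le_one_le) auto
  thus ?thesis by (simp add: mass_def sum_subtractf)
qed

text \<open>For late times, when few elements are alive and the number of dead ones is too weak a
  bound: the variance is compared with the surviving mass at the price of a factor
  \<open>t\<close>.\<close>

lemma mvar_le_mass:
  assumes "pos_weights w I"
  shows "mvar w I t \<le> t * mass w w I t"
proof -
  have "mvar w I t \<le> (\<Sum>i\<in>I. survive w t i * (w i * t))"
    unfolding mvar_def
    by (intro sum_mono mult_left_mono one_minus_survive_le) (simp add: survive_def)
  thus ?thesis by (simp add: mass_def sum_distrib_left mult_ac)
qed

text \<open>The map p (1 - p) is 1-Lipschitz on [0, 1], and survival probabilities are monotone in
  time, so their differences sum to the change of the expected count.\<close>

lemma mvar_shift:
  assumes "pos_weights w I" "0 \<le> s" "s \<le> t"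
  shows "mvar w I s \<le> mvar w I t + (mass w (\<lambda>_. 1) I s - mass w (\<lambda>_. 1) I t)"
    and "mvar w I t \<le> mvar w I s + (mass w (\<lambda>_. 1) I s - mass w (\<lambda>_. 1) I t)"
proof -
  have aux: "p' * (1 - p') \<le> p * (1 - p) + (p' - p)" "p * (1 - p) \<le> p' * (1 - p') + (p' - p)"
    if "0 \<le> p" "p \<le> p'" "p' \<le> 1" for p p' :: real
  proof -
    have "0 \<le> (p' - p) * (p' + p)" using that by (intro mult_nonneg_nonneg) auto
    thus "p' * (1 - p') \<le> p * (1 - p) + (p' - p)" by (simp add: algebra_simps)
    have "0 \<le> (p' - p) * (2 - p' - p)" using that by (intro mult_nonneg_nonneg) auto
    thus "p * (1 - p) \<le> p' * (1 - p') + (p' - p)" by (simp add: algebra_simps)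
  qed
  have b: "0 \<le> survive w t i \<and> survive w t i \<le> survive w s i \<and> survive w s i \<le> 1" if "i \<in> I" for i
    using survive_bounds[OF assms(1,2) that] survive_mono[of w i s t] pos_weightsD[OF assms(1) that] assms(3)
    by (auto simp: survive_def)
  show "mvar w I s \<le> mvar w I t + (mass w (\<lambda>_. 1) I s - mass w (\<lambda>_. 1) I t)"
    "mvar w I t \<le> mvar w I s + (mass w (\<lambda>_. 1) I s - mass w (\<lambda>_. 1) I t)"
    unfolding mvar_def mass_def sum_subtractf[symmetric] sum.distrib[symmetric]
    using b aux by (auto intro!: sum_mono)
qed

text \<open>The survival probability at t/2 squares to the one at t, so p (1 - p) at t/2 is their
  difference.\<close>

lemma mvar_half: "mvar w I (t / 2) = mass w (\<lambda>_. 1) I (t / 2) - mass w (\<lambda>_. 1) I t"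
proof -
  have "survive w (t / 2) i * survive w (t / 2) i = survive w t i" for i
    by (simp add: survive_def exp_add[symmetric])
  thus ?thesis by (simp add: mvar_def mass_def sum_subtractf algebra_simps)
qed

lemma thin_card_lower:
  assumes "pos_weights w I" "0 \<le> t" "0 \<le> \<theta>" "\<theta> \<le> 1" "k \<le> card I"
  shows "thin (survive w t) I (\<lambda>S. of_bool (card S + k < card I))
    \<le> exp (- \<theta> * (mass w (\<lambda>_. 1) I t - (card I - k)) + \<theta>\<^sup>2 * mvar w I t)"
proof -
  let ?c = "mass w (\<lambda>_. 1) I t - (real (card I) - k)"
  have "thin (survive w t) I (\<lambda>S. of_bool (card S + k < card I))
      \<le> thin (survive w t) I (\<lambda>S. of_bool ((\<Sum>i\<in>I. survive w t i * (-1)) + ?c \<le> sum (\<lambda>_. -1) S))"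
    by (rule thin_mono[OF survive_bounds[OF assms(1,2)]])
      (auto simp: mass_def sum_negf)
  also have "\<dots> \<le> exp (- \<theta> * ?c + \<theta>\<^sup>2 * (\<Sum>i\<in>I. (-1)\<^sup>2 * (survive w t i * (1 - survive w t i))))"
    by (rule thin_bernstein) (use assms survive_bounds[OF assms(1,2)] pos_weights_finite in auto)
  finally show ?thesis using assms by (simp add: mvar_def of_nat_diff)
qed

lemma thin_card_upper:
  assumes "pos_weights w I" "0 \<le> t" "0 \<le> \<theta>" "\<theta> \<le> 1" "k \<le> card I"
  shows "thin (survive w t) I (\<lambda>S. of_bool (card I < card S + k))
    \<le> exp (- \<theta> * (card I - k - mass w (\<lambda>_. 1) I t) + \<theta>\<^sup>2 * mvar w I t)"
proof -
  let ?c = "real (card I) - k - mass w (\<lambda>_. 1) I t"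
  have "thin (survive w t) I (\<lambda>S. of_bool (card I < card S + k))
      \<le> thin (survive w t) I (\<lambda>S. of_bool ((\<Sum>i\<in>I. survive w t i * 1) + ?c \<le> sum (\<lambda>_. 1) S))"
    by (rule thin_mono[OF survive_bounds[OF assms(1,2)]]) (auto simp: mass_def)
  also have "\<dots> \<le> exp (- \<theta> * ?c + \<theta>\<^sup>2 * (\<Sum>i\<in>I. 1\<^sup>2 * (survive w t i * (1 - survive w t i))))"
    by (rule thin_bernstein) (use assms survive_bounds[OF assms(1,2)] pos_weights_finite in auto)
  finally show ?thesis using assms by (simp add: mvar_def of_nat_diff)
qed

lemma draws_sum_ge_le:
  fixes f :: "'a \<Rightarrow> real"
  assumes w: "pos_weights w I" and t: "0 \<le> t" and \<theta>: "0 \<le> \<theta>" "\<theta> \<le> 1" and k: "k \<le> card I"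
    and f: "\<And>i. i \<in> I \<Longrightarrow> 0 \<le> f i"
  shows "draws w k I (\<lambda>xs. of_bool (c \<le> sum f (I - set xs)))
    \<le> exp (- \<theta> * (mass w (\<lambda>_. 1) I t - (card I - k)) + \<theta>\<^sup>2 * mvar w I t)
      + thin (survive w t) I (\<lambda>S. of_bool (c \<le> sum f S))"
proof -
  have "draws w k I (\<lambda>xs. of_bool (c \<le> sum f (I - set xs)))
    \<le> thin (survive w t) I (\<lambda>S. of_bool (card S + k < card I))
      + thin (survive w t) I (\<lambda>S. of_bool (c \<le> sum f S))"
  proof (rule draws_le_thin_up[OF w k t])
    fix S S' assume "S \<subseteq> S'" "S' \<subseteq> I" "c \<le> sum f S"
    moreover from this have "sum f S \<le> sum f S'"
      using f pos_weights_finite[OF w] by (intro sum_mono2) (auto intro: finite_subset)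
    ultimately show "c \<le> sum f S'" by simp
  qed
  with thin_card_lower[OF w t \<theta> k] show ?thesis by linarith
qed

lemma draws_sum_le_le:
  fixes f :: "'a \<Rightarrow> real"
  assumes w: "pos_weights w I" and t: "0 \<le> t" and \<theta>: "0 \<le> \<theta>" "\<theta> \<le> 1" and k: "k \<le> card I"
    and f: "\<And>i. i \<in> I \<Longrightarrow> 0 \<le> f i"
  shows "draws w k I (\<lambda>xs. of_bool (sum f (I - set xs) \<le> c))
    \<le> exp (- \<theta> * (card I - k - mass w (\<lambda>_. 1) I t) + \<theta>\<^sup>2 * mvar w I t)
      + thin (survive w t) I (\<lambda>S. of_bool (sum f S \<le> c))"
proof -
  have "draws w k I (\<lambda>xs. of_bool (sum f (I - set xs) \<le> c))
    \<le> thin (survive w t) I (\<lambda>S. of_bool (card I < card S + k))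
      + thin (survive w t) I (\<lambda>S. of_bool (sum f S \<le> c))"
  proof (rule draws_le_thin_down[OF w k t])
    fix S S' assume "S \<subseteq> S'" "S' \<subseteq> I" "sum f S' \<le> c"
    moreover from this have "sum f S \<le> sum f S'"
      using f pos_weights_finite[OF w] by (intro sum_mono2) (auto intro: finite_subset)
    ultimately show "sum f S \<le> c" by simp
  qed
  with thin_card_upper[OF w t \<theta> k] show ?thesis by linarith
qed

text \<open>The number of survivors is shifted by \<open>z\<close> in the thinning, which makes the event that it
  is on the wrong side of \<open>card I - k\<close> unlikely and moves the mean by at most \<open>F * z\<close>.\<close>

lemma draws_concentration:
  assumes w: "pos_weights w I" and t: "0 \<le> t" and k: "k \<le> card I"
    and cnt: "mass w (\<lambda>_. 1) I t = card I - k"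
    and f: "\<And>i. i \<in> I \<Longrightarrow> 0 \<le> f i \<and> f i \<le> F" and F: "0 < F" and z: "0 < z"
    and L: "1 \<le> L" "mvar w I t \<le> L * z"
  shows "draws w k I (\<lambda>xs. of_bool (2 * F * z \<le> \<bar>sum f (I - set xs) - mass w f I t\<bar>))
    \<le> 4 * exp (- z / (8 * L))"
proof -
  note fin = pos_weights_finite[OF w]
  let ?N = "mass w (\<lambda>_. 1) I"
  \<comment> \<open>The variance at the shifted time is at most L z + z <= 2 L z, so this choice
    makes the quadratic term z / (8 L), half of the linear term z / (4 L).\<close>
  define \<theta> where "\<theta> = 1 / (4 * L)"
  have \<theta>: "0 \<le> \<theta>" "\<theta> \<le> 1" using L by (auto simp: \<theta>_def)
  have expo: "- \<theta> * z + \<theta>\<^sup>2 * v \<le> - z / (8 * L)" if "v \<le> L * z + z" for v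
  proof -
    have "1 * z \<le> L * z" using L(1) z by (intro mult_right_mono) auto
    hence "v \<le> 2 * L * z" using that by linarith
    hence "\<theta>\<^sup>2 * v \<le> \<theta>\<^sup>2 * (2 * L * z)" by (intro mult_left_mono) auto
    also have "\<dots> = z / (8 * L)" using L by (simp add: \<theta>_def power2_eq_square)
    finally show ?thesis using L by (simp add: \<theta>_def)
  qed
  have dev: "\<bar>mass w f I s - mass w f I t\<bar> \<le> F * \<bar>?N s - ?N t\<bar>" if "s \<le> t \<or> t \<le> s" for s
  proof -
    have *: "\<bar>mass w f I a - mass w f I b\<bar> \<le> F * \<bar>?N a - ?N b\<bar>" if "a \<le> b" for a b
    proof -
      have ge: "0 \<le> survive w a i - survive w b i" if "i \<in> I" for i
        using survive_mono[of w i a b] \<open>a \<le> b\<close> pos_weightsD[OF w that] by simp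
      have "\<bar>mass w f I a - mass w f I b\<bar> = \<bar>\<Sum>i\<in>I. (survive w a i - survive w b i) * f i\<bar>"
        by (simp add: mass_def sum_subtractf left_diff_distrib)
      also have "\<dots> = (\<Sum>i\<in>I. (survive w a i - survive w b i) * f i)"
        using ge f by (intro abs_of_nonneg sum_nonneg mult_nonneg_nonneg) auto
      also have "\<dots> \<le> (\<Sum>i\<in>I. (survive w a i - survive w b i) * F)"
        using ge f by (intro sum_mono mult_left_mono) auto
      also have "\<dots> = F * (?N a - ?N b)"
        by (simp add: mass_def sum_subtractf[symmetric] sum_distrib_left mult.commute)
      also have "\<dots> \<le> F * \<bar>?N a - ?N b\<bar>" using F by (intro mult_left_mono) auto
      finally show ?thesis .
    qed
    from that *[of s t] *[of t s] show ?thesis by (auto simp: abs_minus_commute)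
  qed
  have bern: "thin (survive w s) I (\<lambda>S. of_bool (mass w g I s + F * z \<le> sum g S)) \<le> exp (- z / (8 * L))"
    if s: "0 \<le> s" and v: "mvar w I s \<le> L * z + z" and g: "\<And>i. i \<in> I \<Longrightarrow> \<bar>g i\<bar> \<le> F" for s g
  proof -
    have "thin (survive w s) I (\<lambda>S. of_bool ((\<Sum>i\<in>I. survive w s i * g i) + F * z \<le> sum g S))
        \<le> exp (- (\<theta> / F) * (F * z) + (\<theta> / F)\<^sup>2 * (\<Sum>i\<in>I. (g i)\<^sup>2 * (survive w s i * (1 - survive w s i))))"
    proof (rule thin_bernstein[OF fin survive_bounds[OF w s]])
      fix i assume "i \<in> I"
      have "\<theta> * \<bar>g i\<bar> \<le> 1 * F" using g[OF \<open>i \<in> I\<close>] \<theta> by (intro mult_mono) auto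
      thus "\<theta> / F * \<bar>g i\<bar> \<le> 1" using F by (simp add: field_simps)
    qed (use \<theta> F in auto)
    also have "(\<Sum>i\<in>I. (g i)\<^sup>2 * (survive w s i * (1 - survive w s i))) \<le> F\<^sup>2 * mvar w I s"
      unfolding mvar_def sum_distrib_left
    proof (intro sum_mono mult_right_mono)
      fix i assume i: "i \<in> I"
      show "(g i)\<^sup>2 \<le> F\<^sup>2" using g[OF i] F by (intro abs_le_square_iff[THEN iffD1]) auto
      show "0 \<le> survive w s i * (1 - survive w s i)" using survive_bounds[OF w s i] by simp
    qed
    hence "- (\<theta> / F) * (F * z) + (\<theta> / F)\<^sup>2 * (\<Sum>i\<in>I. (g i)\<^sup>2 * (survive w s i * (1 - survive w s i)))
        \<le> - (\<theta> / F) * (F * z) + (\<theta> / F)\<^sup>2 * (F\<^sup>2 * mvar w I s)"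
      by (intro add_left_mono mult_left_mono) auto
    also have "\<dots> = - \<theta> * z + \<theta>\<^sup>2 * mvar w I s" using F by (simp add: power_divide)
    also have "\<dots> \<le> - z / (8 * L)" by (rule expo[OF v])
    finally show ?thesis by (simp add: mass_def)
  qed
  have Sfin: "finite S" if "S \<subseteq> I" for S using that fin finite_subset by blast
  have up: "draws w k I (\<lambda>xs. of_bool (mass w f I t + 2 * F * z \<le> sum f (I - set xs)))
      \<le> 2 * exp (- z / (8 * L))"
  proof (cases "real (card I) - k + z \<le> card I")
    case True
    obtain s where s: "0 \<le> s" "s \<le> t" "?N s = real (card I) - k + z"
      using mass_attains_below[OF t, of w "\<lambda>_. 1" I "real (card I) - k + z"] True cnt z k
      by (auto simp: mass_one_zero of_nat_diff)
    have v: "mvar w I s \<le> L * z + z"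
      using mvar_shift(1)[OF w s(1,2)] L(2) s(3) cnt k by (simp add: of_nat_diff)
    have "draws w k I (\<lambda>xs. of_bool (mass w f I t + 2 * F * z \<le> sum f (I - set xs)))
        \<le> exp (- \<theta> * (?N s - (card I - k)) + \<theta>\<^sup>2 * mvar w I s)
          + thin (survive w s) I (\<lambda>S. of_bool (mass w f I t + 2 * F * z \<le> sum f S))"
      by (rule draws_sum_ge_le[OF w s(1) \<theta> k]) (use f in auto)
    also have "?N s - (card I - k) = z" using s(3) k by (simp add: of_nat_diff)
    also have "exp (- \<theta> * z + \<theta>\<^sup>2 * mvar w I s) \<le> exp (- z / (8 * L))" using expo[OF v] by simp
    also have "thin (survive w s) I (\<lambda>S. of_bool (mass w f I t + 2 * F * z \<le> sum f S))
        \<le> thin (survive w s) I (\<lambda>S. of_bool (mass w f I s + F * z \<le> sum f S))"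
    proof (rule thin_mono[OF survive_bounds[OF w s(1)]])
      have "\<bar>?N s - ?N t\<bar> = z" using s cnt z k by (simp add: of_nat_diff)
      hence "mass w f I s \<le> mass w f I t + F * z" using dev[of s] s by auto
      thus "of_bool (mass w f I t + 2 * F * z \<le> sum f S) \<le> (of_bool (mass w f I s + F * z \<le> sum f S) :: real)" for S
        by auto
    qed
    also have "\<dots> \<le> exp (- z / (8 * L))" by (rule bern[OF s(1) v]) (use f in auto)
    finally show ?thesis by simp
  next
    \<comment> \<open>Fewer than \<open>z\<close> elements have been drawn, so even the sum over all
      of \<open>I\<close> exceeds the mean by less than \<open>F * z\<close>.\<close>
    case False
    have "draws w k I (\<lambda>xs. of_bool (mass w f I t + 2 * F * z \<le> sum f (I - set xs))) = draws w k I (\<lambda>_. 0)"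
    proof (rule draws_cong)
      fix xs
      have "sum f (I - set xs) \<le> sum f I" by (rule sum_mono2) (use f fin in auto)
      also have "\<dots> \<le> mass w f I t + F * (card I - ?N t)"
        using dev[of 0] t mass_antimono[OF w, of "\<lambda>_. 1" 0 t] by (auto simp: mass_zero)
      also have "\<dots> < mass w f I t + 2 * F * z"
      proof -
        have "card I - ?N t = k" using cnt k by (simp add: of_nat_diff)
        moreover have "F * k < F * z" using False F by simp
        moreover have "0 < F * z" using F z by simp
        ultimately show ?thesis by simp
      qed
      finally show "(of_bool (mass w f I t + 2 * F * z \<le> sum f (I - set xs)) :: real) = 0" by simp
    qed
    thus ?thesis by simp
  qed
  have down: "draws w k I (\<lambda>xs. of_bool (sum f (I - set xs) \<le> mass w f I t - 2 * F * z))
      \<le> 2 * exp (- z / (8 * L))"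
  proof (cases "0 < real (card I) - k - z")
    case True
    obtain s where s: "t \<le> s" "?N s = real (card I) - k - z"
      using mass_attains_above[OF w True, of "\<lambda>_. 1" t] cnt z k by (auto simp: of_nat_diff)
    have s0: "0 \<le> s" using s t by simp
    have v: "mvar w I s \<le> L * z + z"
      using mvar_shift(2)[OF w t s(1)] L(2) s(2) cnt k by (simp add: of_nat_diff)
    have "draws w k I (\<lambda>xs. of_bool (sum f (I - set xs) \<le> mass w f I t - 2 * F * z))
        \<le> exp (- \<theta> * (card I - k - ?N s) + \<theta>\<^sup>2 * mvar w I s)
          + thin (survive w s) I (\<lambda>S. of_bool (sum f S \<le> mass w f I t - 2 * F * z))"
      by (rule draws_sum_le_le[OF w s0 \<theta> k]) (use f in auto)
    also have "card I - k - ?N s = z" using s(2) k by (simp add: of_nat_diff)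
    also have "exp (- \<theta> * z + \<theta>\<^sup>2 * mvar w I s) \<le> exp (- z / (8 * L))" using expo[OF v] by simp
    also have "thin (survive w s) I (\<lambda>S. of_bool (sum f S \<le> mass w f I t - 2 * F * z))
        \<le> thin (survive w s) I (\<lambda>S. of_bool (mass w (\<lambda>i. - f i) I s + F * z \<le> sum (\<lambda>i. - f i) S))"
    proof (rule thin_mono[OF survive_bounds[OF w s0]])
      have "\<bar>?N s - ?N t\<bar> = z" using s cnt z k by (simp add: of_nat_diff)
      hence "mass w f I t - F * z \<le> mass w f I s" using dev[of s] s by auto
      moreover have "mass w (\<lambda>i. - f i) I s = - mass w f I s" by (simp add: mass_def sum_negf)
      ultimately show "of_bool (sum f S \<le> mass w f I t - 2 * F * z)
          \<le> (of_bool (mass w (\<lambda>i. - f i) I s + F * z \<le> sum (\<lambda>i. - f i) S) :: real)" for S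
        by (auto simp: sum_negf)
    qed
    also have "\<dots> \<le> exp (- z / (8 * L))" by (rule bern[OF s0 v]) (use f in auto)
    finally show ?thesis by simp
  next
    \<comment> \<open>At most \<open>z\<close> elements remain, so the mean is at most
      \<open>F * z\<close> and the level \<open>2 * F * z\<close> below it is negative.\<close>
    case False
    have "draws w k I (\<lambda>xs. of_bool (sum f (I - set xs) \<le> mass w f I t - 2 * F * z)) = draws w k I (\<lambda>_. 0)"
    proof (rule draws_cong)
      fix xs
      have "mass w f I t \<le> mass w (\<lambda>_. F) I t" using f by (intro mass_mono_weight) auto
      also have "\<dots> = F * ?N t" by (simp add: mass_def sum_distrib_left mult.commute)
      also have "\<dots> \<le> F * z" using False F cnt k by (intro mult_left_mono) (auto simp: of_nat_diff)
      also have "\<dots> < 2 * F * z" using F z by simp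
      finally have "mass w f I t - 2 * F * z < 0" by simp
      also have "0 \<le> sum f (I - set xs)" using f by (intro sum_nonneg) auto
      finally show "(of_bool (sum f (I - set xs) \<le> mass w f I t - 2 * F * z) :: real) = 0" by simp
    qed
    thus ?thesis by simp
  qed
  have "draws w k I (\<lambda>xs. of_bool (2 * F * z \<le> \<bar>sum f (I - set xs) - mass w f I t\<bar>))
      \<le> draws w k I (\<lambda>xs. of_bool (mass w f I t + 2 * F * z \<le> sum f (I - set xs))
        + of_bool (sum f (I - set xs) \<le> mass w f I t - 2 * F * z))"
    by (rule draws_mono[OF w]) (auto simp: abs_if split: if_splits)
  also have "\<dots> \<le> 4 * exp (- z / (8 * L))" unfolding draws_add using up down by simp
  finally show ?thesis .
qed

text \<open>Thinning at half the time: the expected excess of survivors equals the variance of their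
  number, and every weight keeps a factor \<open>exp (- w i * t / 4)\<close> to pay for the exponential moment.\<close>

lemma draws_squares_ge_le:
  assumes w: "pos_weights w I" and t: "0 \<le> t" and k: "k \<le> card I"
    and cnt: "card I - k \<le> mass w (\<lambda>_. 1) I t"
    and \<theta>: "0 \<le> \<theta>" "\<And>i. i \<in> I \<Longrightarrow> i \<in> J \<Longrightarrow> \<theta> * w i \<le> t / 4"
  shows "draws w k I (\<lambda>xs. of_bool (c \<le> (\<Sum>i\<in>(I - set xs) \<inter> J. (w i)\<^sup>2)))
    \<le> exp (- (t * mass w w I t / 8)) + exp (- \<theta> * c + \<theta> * (\<Sum>i\<in>I \<inter> J. (w i)\<^sup>2 * exp (- (w i * t / 4))))"
proof -
  note fin = pos_weights_finite[OF w]
  let ?N = "mass w (\<lambda>_. 1) I"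
  define f where "f i = (if i \<in> J then (w i)\<^sup>2 else 0)" for i
  have f: "sum f (I - set xs) = (\<Sum>i\<in>(I - set xs) \<inter> J. (w i)\<^sup>2)" for xs
    unfolding f_def using fin by (simp add: sum.inter_restrict)
  have "draws w k I (\<lambda>xs. of_bool (c \<le> sum f (I - set xs)))
      \<le> exp (- (1/2) * (?N (t/2) - (card I - k)) + (1/2)\<^sup>2 * mvar w I (t/2))
        + thin (survive w (t/2)) I (\<lambda>S. of_bool (c \<le> sum f S))"
    by (rule draws_sum_ge_le[OF w]) (use t k in \<open>auto simp: f_def\<close>)
  also have "exp (- (1/2) * (?N (t/2) - (card I - k)) + (1/2)\<^sup>2 * mvar w I (t/2))
      \<le> exp (- (t * mass w w I t / 8))"
  proof -
    have "t * mass w w I t / 2 \<le> mvar w I (t/2)"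
      using mass_one_diff_ge[OF w, of "t/2" t] t unfolding mvar_half by (simp add: field_simps)
    moreover have "mvar w I (t/2) \<le> ?N (t/2) - (card I - k)"
      unfolding mvar_half using cnt by simp
    moreover have "- (1/2) * c + (1/2)\<^sup>2 * b \<le> - (a / 8)" if "a / 2 \<le> b" "b \<le> c" for a b c :: real
      using that by (simp add: power2_eq_square)
    ultimately show ?thesis unfolding exp_le_cancel_iff by blast
  qed
  also have "thin (survive w (t/2)) I (\<lambda>S. of_bool (c \<le> sum f S))
      \<le> exp (- \<theta> * c + (\<Sum>i\<in>I. survive w (t/2) i * (exp (\<theta> * f i) - 1)))"
    by (rule thin_chernoff[OF fin survive_bounds[OF w]]) (use t \<theta> in auto)
  also have "(\<Sum>i\<in>I. survive w (t/2) i * (exp (\<theta> * f i) - 1))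
      \<le> (\<Sum>i\<in>I. if i \<in> J then \<theta> * ((w i)\<^sup>2 * exp (- (w i * t / 4))) else 0)"
  proof (rule sum_mono)
    fix i assume i: "i \<in> I"
    show "survive w (t/2) i * (exp (\<theta> * f i) - 1)
        \<le> (if i \<in> J then \<theta> * ((w i)\<^sup>2 * exp (- (w i * t / 4))) else 0)"
    proof (cases "i \<in> J")
      case True
      let ?x = "\<theta> * (w i)\<^sup>2"
      have "?x \<le> w i * t / 4"
        using mult_right_mono[OF \<theta>(2)[OF i True], of "w i"] pos_weightsD[OF w i]
        by (simp add: power2_eq_square mult_ac)
      have "1 - ?x \<le> exp (- ?x)" using exp_ge_add_one_self[of "- ?x"] by simp
      hence "(1 - ?x) * exp ?x \<le> exp (- ?x) * exp ?x" by (intro mult_right_mono) auto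
      hence "exp ?x - 1 \<le> ?x * exp ?x" by (simp add: exp_minus algebra_simps)
      also have "\<dots> \<le> ?x * exp (w i * t / 4)"
        using \<open>?x \<le> w i * t / 4\<close> \<theta>(1) by (intro mult_left_mono) auto
      finally have "survive w (t/2) i * (exp ?x - 1) \<le> survive w (t/2) i * (?x * exp (w i * t / 4))"
        by (intro mult_left_mono) (simp_all add: survive_def)
      also have "\<dots> = ?x * exp (- (w i * t / 4))"
        by (simp add: survive_def exp_add[symmetric])
      finally show ?thesis using True by (simp add: f_def mult.assoc)
    qed (simp add: f_def)
  qed
  hence "exp (- \<theta> * c + (\<Sum>i\<in>I. survive w (t/2) i * (exp (\<theta> * f i) - 1)))
      \<le> exp (- \<theta> * c + \<theta> * (\<Sum>i\<in>I \<inter> J. (w i)\<^sup>2 * exp (- (w i * t / 4))))"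
    using fin by (simp add: sum.inter_restrict sum_distrib_left if_distrib cong: if_cong)
  finally show ?thesis by (simp add: f)
qed

text \<open>Here the time is moved back only by \<delta>, so that the mean at time \<open>t\<close>
  survives up to a constant. On \<open>J\<close>, where \<delta> w <= 1, survival probabilities grow
  by at most a factor 3 and exp (\<delta> w) - 1 is at most 2 \<delta> w; hence the 6. The factor t
  / \<delta> + 1 bounds the variance of the count by its expected excess over
  \<open>card I - k\<close>.\<close>

lemma draws_weights_ge_le:
  assumes w: "pos_weights w I" and k: "k \<le> card I"
    and cnt: "card I - k \<le> mass w (\<lambda>_. 1) I t"
    and \<delta>: "0 < \<delta>" "\<delta> \<le> t" "\<And>i. i \<in> I \<Longrightarrow> i \<in> J \<Longrightarrow> \<delta> * w i \<le> 1"
  shows "draws w k I (\<lambda>xs. of_bool (c \<le> (\<Sum>i\<in>(I - set xs) \<inter> J. w i)))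
    \<le> exp (- (\<delta> * mass w w I t / (4 * (t / \<delta> + 1)))) + exp (- \<delta> * c + 6 * \<delta> * mass w w (I \<inter> J) t)"
proof -
  note fin = pos_weights_finite[OF w]
  let ?N = "mass w (\<lambda>_. 1) I"
  define f where "f i = (if i \<in> J then w i else 0)" for i
  have f: "sum f (I - set xs) = (\<Sum>i\<in>(I - set xs) \<inter> J. w i)" for xs
    unfolding f_def using fin by (simp add: sum.inter_restrict)
  define s where "s = t - \<delta>"
  define L where "L = t / \<delta> + 1"
  define z where "z = ?N s - ?N t"
  have L: "1 \<le> L" using \<delta> by (simp add: L_def)
  have s: "0 \<le> s" "s \<le> t" using \<delta> by (auto simp: s_def)
  have z: "\<delta> * mass w w I t \<le> z"
    using mass_one_diff_ge[OF w s(2)] by (simp add: s_def z_def)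
  have lam: "0 \<le> mass w w I t" by (rule mass_nonneg) (use pos_weightsD[OF w] in \<open>auto intro: less_imp_le\<close>)
  have "draws w k I (\<lambda>xs. of_bool (c \<le> sum f (I - set xs)))
      \<le> exp (- (1/(2*L)) * (?N s - (card I - k)) + (1/(2*L))\<^sup>2 * mvar w I s)
        + thin (survive w s) I (\<lambda>S. of_bool (c \<le> sum f S))"
    by (rule draws_sum_ge_le[OF w]) (use s k L pos_weightsD[OF w] in \<open>auto simp: f_def intro: less_imp_le\<close>)
  also have "exp (- (1/(2*L)) * (?N s - (card I - k)) + (1/(2*L))\<^sup>2 * mvar w I s)
      \<le> exp (- (\<delta> * mass w w I t / (4 * L)))"
  proof -
    have "mvar w I s \<le> t * mass w w I t + z"
      using mvar_shift(1)[OF w s] mvar_le_mass[OF w, of t] by (simp add: z_def)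
    also have "t * mass w w I t = t / \<delta> * (\<delta> * mass w w I t)" using \<delta> by simp
    also have "\<dots> \<le> t / \<delta> * z" using z \<delta> by (intro mult_left_mono) auto
    finally have "mvar w I s \<le> L * z" by (simp add: L_def algebra_simps)
    hence "(1/(2*L))\<^sup>2 * mvar w I s \<le> (1/(2*L))\<^sup>2 * (L * z)" by (intro mult_left_mono) auto
    also have "\<dots> = z / (4 * L)" using L by (simp add: power2_eq_square)
    finally have 1: "(1/(2*L))\<^sup>2 * mvar w I s \<le> z / (4 * L)" .
    have "1/(2*L) * z \<le> 1/(2*L) * (?N s - (card I - k))"
      using cnt L by (intro mult_left_mono) (auto simp: z_def)
    moreover have "1/(2*L) * z = 2 * (z / (4 * L))" by simp
    moreover have "\<delta> * mass w w I t / (4 * L) \<le> z / (4 * L)"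
      using z L by (intro divide_right_mono) auto
    ultimately show ?thesis using 1 by simp
  qed
  also have "thin (survive w s) I (\<lambda>S. of_bool (c \<le> sum f S))
      \<le> exp (- \<delta> * c + (\<Sum>i\<in>I. survive w s i * (exp (\<delta> * f i) - 1)))"
    by (rule thin_chernoff[OF fin survive_bounds[OF w s(1)]]) (use \<delta> in auto)
  also have "(\<Sum>i\<in>I. survive w s i * (exp (\<delta> * f i) - 1))
      \<le> (\<Sum>i\<in>I. if i \<in> J then 6 * \<delta> * (survive w t i * w i) else 0)"
  proof (rule sum_mono)
    fix i assume i: "i \<in> I"
    show "survive w s i * (exp (\<delta> * f i) - 1) \<le> (if i \<in> J then 6 * \<delta> * (survive w t i * w i) else 0)"
    proof (cases "i \<in> J")
      case True
      let ?x = "\<delta> * w i"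
      have x: "0 \<le> ?x" "?x \<le> 1" using \<delta>(1) \<delta>(3)[OF i True] pos_weightsD[OF w i] by auto
      have "exp ?x \<le> 1 + ?x + ?x\<^sup>2" by (rule exp_le_one_plus_square[OF x(2)])
      moreover have "?x\<^sup>2 \<le> ?x" using x by (simp add: power2_eq_square mult_left_le_one_le)
      ultimately have 1: "exp ?x - 1 \<le> 2 * ?x" by simp
      have "exp ?x \<le> 3" using x \<open>exp ?x \<le> 1 + ?x + ?x\<^sup>2\<close> \<open>?x\<^sup>2 \<le> ?x\<close> by linarith
      moreover have "survive w s i = survive w t i * exp ?x"
        by (simp add: survive_def s_def exp_add[symmetric] algebra_simps)
      ultimately have 2: "survive w s i \<le> survive w t i * 3"
        by (simp add: survive_def)
      have "survive w s i * (exp ?x - 1) \<le> (survive w t i * 3) * (2 * ?x)"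
        using 1 2 x by (intro mult_mono) (auto simp: survive_def)
      thus ?thesis using True by (simp add: f_def mult_ac)
    qed (simp add: f_def)
  qed
  hence "exp (- \<delta> * c + (\<Sum>i\<in>I. survive w s i * (exp (\<delta> * f i) - 1)))
      \<le> exp (- \<delta> * c + 6 * \<delta> * mass w w (I \<inter> J) t)"
    using fin by (simp add: sum.inter_restrict mass_def sum_distrib_left if_distrib cong: if_cong)
  finally show ?thesis by (simp add: f L_def)
qed

subsection \<open>Size-biased permutations\<close>

text \<open>The law is given only through conditional probabilities on atoms. The integral is
  therefore expanded over the finitely many lists that the first \<open>k\<close> values can form,
  one draw is split off, and the sum is folded back into an integral to which the induction
  hypothesis applies.\<close>

lemma integral_prefix_eq_draws:
  assumes sb: "size_biased_permutation P n w v" and w: "pos_weights w {1..n}" and "k \<le> n"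
  shows "(\<integral>\<omega>. F (map (v \<omega>) [1..<Suc k]) \<partial>P) = draws w k {1..n} F"
  using \<open>k \<le> n\<close>
proof (induction k arbitrary: F)
  case 0
  interpret prob_space P using sb by (simp add: size_biased_permutation_def)
  show ?case by (simp add: prob_space)
next
  case (Suc k)
  interpret prob_space P using sb by (simp add: size_biased_permutation_def)
  let ?I = "{1..n}"
  define X where "X \<omega> = map (v \<omega>) [1..<Suc k]" for \<omega>
  have v: "v \<in> measurable P (count_space {\<pi>. \<pi> permutes ?I})"
    using sb by (simp add: size_biased_permutation_def)
  have perm: "v \<omega> permutes ?I" if "\<omega> \<in> space P" for \<omega>
    using measurable_space[OF v that] by simp
  have ev: "{\<omega> \<in> space P. Q (v \<omega>)} \<in> events" for Q
    by (rule measurable_sets_Collect[OF v]) auto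
  have meas: "(\<lambda>\<omega>. g (v \<omega>)) \<in> borel_measurable P" for g :: "(nat \<Rightarrow> nat) \<Rightarrow> real"
    using measurable_compose[OF v, of g borel] by simp
  have Xprop: "length (X \<omega>) = k \<and> distinct (X \<omega>) \<and> set (X \<omega>) \<subseteq> ?I" if "\<omega> \<in> space P" for \<omega>
  proof -
    have "inj (v \<omega>)" using perm[OF that] permutes_inj by blast
    moreover have "v \<omega> j \<in> ?I" if "j \<in> ?I" for j
      using permutes_in_image[OF perm[OF \<open>\<omega> \<in> space P\<close>]] that by simp
    ultimately show ?thesis
      using Suc.prems by (auto simp: X_def distinct_map intro: inj_on_subset)
  qed
  define L where "L = {xs :: nat list. set xs \<subseteq> ?I \<and> length xs = k \<and> distinct xs}"
  have finL: "finite L"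
    by (rule finite_subset[OF _ finite_lists_length_eq[of ?I k]]) (auto simp: L_def)
  have prob_step: "prob {\<omega> \<in> space P. X \<omega> = xs \<and> v \<omega> (Suc k) = x}
      = prob {\<omega> \<in> space P. X \<omega> = xs} * (if x \<in> ?I - set xs then w x / sum w (?I - set xs) else 0)"
    if xs: "xs \<in> L" and x: "x \<in> ?I" for xs x
  proof (cases "k = 0")
    case True
    hence "xs = []" using xs by (simp add: L_def)
    moreover have "\<P>(\<omega> in P. v \<omega> 1 = x) = w x / sum w ?I"
      using sb x by (simp add: size_biased_permutation_def)
    ultimately show ?thesis using x True by (simp add: X_def prob_space)
  next
    case False
    \<comment> \<open>Positions in the list start at 0, those of the permutation at 1.\<close>
    define u where "u j = xs ! (j - 1)" for j
    have X_eq: "X \<omega> = xs \<longleftrightarrow> (\<forall>j\<in>{1..k}. v \<omega> j = u j)" for \<omega>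
    proof -
      have "X \<omega> = xs \<longleftrightarrow> (\<forall>i<k. v \<omega> (Suc i) = xs ! i)"
        using xs by (auto simp: X_def L_def list_eq_iff_nth_eq simp del: upt_Suc)
      also have "\<dots> \<longleftrightarrow> (\<forall>j\<in>{1..k}. v \<omega> j = u j)"
        unfolding image_Suc_lessThan[symmetric] by (auto simp: u_def simp del: image_Suc_lessThan)
      finally show ?thesis .
    qed
    have uset: "u ` {1..k} = set xs"
    proof -
      have "u ` {1..k} = (\<lambda>i. xs ! i) ` {..<k}"
        unfolding image_Suc_lessThan[symmetric] image_image by (simp add: u_def del: image_Suc_lessThan)
      thus ?thesis using xs by (auto simp: L_def set_conv_nth)
    qed
    have usum: "(\<Sum>j=1..k. w (u j)) = sum w (set xs)"
    proof -
      have "(\<Sum>j=1..k. w (u j)) = (\<Sum>i<k. w (xs ! i))"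
        by (rule sum.reindex_bij_witness[of _ Suc "\<lambda>j. j - 1"]) (auto simp: u_def)
      also have "\<dots> = sum_list (map w xs)" using xs by (simp add: L_def sum_list_sum_nth atLeast0LessThan)
      also have "\<dots> = sum w (set xs)" using xs by (simp add: L_def sum_list_distinct_conv_sum_set)
      finally show ?thesis .
    qed
    have denom: "(\<Sum>j=1..n. w j) - (\<Sum>j=1..k. w (u j)) = sum w (?I - set xs)"
      using xs unfolding usum by (subst sum_diff) (auto simp: L_def)
    show ?thesis
    proof (cases "prob {\<omega> \<in> space P. X \<omega> = xs} = 0")
      \<comment> \<open>The hypothesis says nothing about atoms of probability 0, but there both
        sides vanish.\<close>
      case True
      have "prob {\<omega> \<in> space P. X \<omega> = xs \<and> v \<omega> (Suc k) = x} \<le> prob {\<omega> \<in> space P. X \<omega> = xs}"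
        unfolding X_def by (rule finite_measure_mono) (use ev[of "\<lambda>f. map f [1..<Suc k] = xs"] in auto)
      thus ?thesis using True by (simp add: measure_le_0_iff)
    next
      case nz: False
      hence pos: "0 < \<P>(\<omega> in P. \<forall>j\<in>{1..k}. v \<omega> j = u j)"
        unfolding X_eq by (simp add: zero_less_measure_iff)
      have kn: "k \<in> {1..<n}" using False Suc.prems by auto
      have "\<P>(\<omega> in P. v \<omega> (k + 1) = x \<bar> \<forall>j\<in>{1..k}. v \<omega> j = u j) =
          w x * (if x \<notin> u ` {1..k} then 1 else 0) / ((\<Sum>j=1..n. w j) - (\<Sum>j=1..k. w (u j)))"
        using sb kn x pos unfolding size_biased_permutation_def by blast
      hence "\<P>(\<omega> in P. v \<omega> (Suc k) = x \<and> X \<omega> = xs) / prob {\<omega> \<in> space P. X \<omega> = xs}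
          = w x * (if x \<notin> set xs then 1 else 0) / sum w (?I - set xs)"
        unfolding cond_prob_def denom uset X_eq by simp
      moreover have "{\<omega> \<in> space P. v \<omega> (Suc k) = x \<and> X \<omega> = xs} = {\<omega> \<in> space P. X \<omega> = xs \<and> v \<omega> (Suc k) = x}"
        by auto
      ultimately show ?thesis using nz x by (auto simp: divide_eq_eq mult.commute)
    qed
  qed
  define T where "T xs x = (if x \<in> ?I - set xs then w x / sum w (?I - set xs) else 0)" for xs x
  have ind: "(\<integral>\<omega>. of_bool (Q (v \<omega>)) \<partial>P) = prob {\<omega> \<in> space P. Q (v \<omega>)}" for Q
  proof -
    have "(\<integral>\<omega>. of_bool (Q (v \<omega>)) \<partial>P) = (\<integral>\<omega>. indicator {\<omega> \<in> space P. Q (v \<omega>)} \<omega> \<partial>P :: real)"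
      by (rule Bochner_Integration.integral_cong) (auto simp: indicator_def)
    thus ?thesis using ev[of Q] by simp
  qed
  have intg: "integrable P (\<lambda>\<omega>. of_bool (Q (v \<omega>)) :: real)" for Q
    by (rule integrable_const_bound[of _ 1]) (use meas[of "\<lambda>f. of_bool (Q f)"] in auto)
  have "(\<integral>\<omega>. F (map (v \<omega>) [1..<Suc (Suc k)]) \<partial>P)
      = (\<integral>\<omega>. (\<Sum>xs\<in>L. \<Sum>x\<in>?I. F (xs @ [x]) * of_bool (X \<omega> = xs \<and> v \<omega> (Suc k) = x)) \<partial>P)"
  proof (rule Bochner_Integration.integral_cong[OF refl])
    fix \<omega> assume \<omega>: "\<omega> \<in> space P"
    have X: "X \<omega> \<in> L" using Xprop[OF \<omega>] by (simp add: L_def)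
    have vx: "v \<omega> (Suc k) \<in> ?I" using permutes_in_image[OF perm[OF \<omega>]] Suc.prems by simp
    have "(\<Sum>xs\<in>L. \<Sum>x\<in>?I. F (xs @ [x]) * of_bool (X \<omega> = xs \<and> v \<omega> (Suc k) = x))
        = (\<Sum>xs\<in>L. if X \<omega> = xs then (\<Sum>x\<in>?I. if v \<omega> (Suc k) = x then F (xs @ [x]) else 0) else 0)"
      by (intro sum.cong refl) (auto intro!: sum.cong)
    also have "\<dots> = F (X \<omega> @ [v \<omega> (Suc k)])" using X vx finL by (simp add: sum.delta)
    finally show "F (map (v \<omega>) [1..<Suc (Suc k)])
        = (\<Sum>xs\<in>L. \<Sum>x\<in>?I. F (xs @ [x]) * of_bool (X \<omega> = xs \<and> v \<omega> (Suc k) = x))"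
      by (simp add: X_def)
  qed
  also have "\<dots> = (\<Sum>xs\<in>L. \<Sum>x\<in>?I. F (xs @ [x]) * prob {\<omega> \<in> space P. X \<omega> = xs \<and> v \<omega> (Suc k) = x})"
  proof -
    have i2: "integrable P (\<lambda>\<omega>. F (xs @ [x]) * of_bool (X \<omega> = xs \<and> v \<omega> (Suc k) = x))" for xs x
      unfolding X_def by (intro integrable_mult_right intg)
    have e2: "(\<integral>\<omega>. of_bool (X \<omega> = xs \<and> v \<omega> (Suc k) = x) \<partial>P)
        = prob {\<omega> \<in> space P. X \<omega> = xs \<and> v \<omega> (Suc k) = x}" for xs x
      unfolding X_def by (rule ind)
    have "(\<integral>\<omega>. (\<Sum>xs\<in>L. \<Sum>x\<in>?I. F (xs @ [x]) * of_bool (X \<omega> = xs \<and> v \<omega> (Suc k) = x)) \<partial>P)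
        = (\<Sum>xs\<in>L. \<integral>\<omega>. (\<Sum>x\<in>?I. F (xs @ [x]) * of_bool (X \<omega> = xs \<and> v \<omega> (Suc k) = x)) \<partial>P)"
      by (rule Bochner_Integration.integral_sum) (intro Bochner_Integration.integrable_sum i2)
    also have "\<dots> = (\<Sum>xs\<in>L. \<Sum>x\<in>?I. \<integral>\<omega>. F (xs @ [x]) * of_bool (X \<omega> = xs \<and> v \<omega> (Suc k) = x) \<partial>P)"
      by (intro sum.cong refl Bochner_Integration.integral_sum i2)
    finally show ?thesis by (simp only: integral_mult_right_zero e2)
  qed
  also have "\<dots> = (\<Sum>xs\<in>L. prob {\<omega> \<in> space P. X \<omega> = xs} * (\<Sum>x\<in>?I. F (xs @ [x]) * T xs x))"
    unfolding sum_distrib_left T_def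
    by (intro sum.cong refl) (simp add: prob_step)
  also have "\<dots> = (\<Sum>xs\<in>L. prob {\<omega> \<in> space P. X \<omega> = xs} * avg w (\<lambda>x. F (xs @ [x])) (?I - set xs))"
  proof (intro sum.cong refl)
    fix xs
    have "(\<Sum>x\<in>?I. F (xs @ [x]) * T xs x) = (\<Sum>x\<in>?I - set xs. F (xs @ [x]) * T xs x)"
      by (rule sum.mono_neutral_right) (auto simp: T_def)
    also have "\<dots> = avg w (\<lambda>x. F (xs @ [x])) (?I - set xs)"
      unfolding avg_def sum_divide_distrib by (intro sum.cong refl) (simp add: T_def)
    finally show "prob {\<omega> \<in> space P. X \<omega> = xs} * (\<Sum>x\<in>?I. F (xs @ [x]) * T xs x)
        = prob {\<omega> \<in> space P. X \<omega> = xs} * avg w (\<lambda>x. F (xs @ [x])) (?I - set xs)" by simp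
  qed
  also have "\<dots> = (\<Sum>xs\<in>L. \<integral>\<omega>. avg w (\<lambda>x. F (xs @ [x])) (?I - set xs) * of_bool (X \<omega> = xs) \<partial>P)"
  proof (intro sum.cong refl)
    fix xs
    have "(\<integral>\<omega>. of_bool (X \<omega> = xs) \<partial>P) = prob {\<omega> \<in> space P. X \<omega> = xs}"
      unfolding X_def by (rule ind)
    thus "prob {\<omega> \<in> space P. X \<omega> = xs} * avg w (\<lambda>x. F (xs @ [x])) (?I - set xs)
        = (\<integral>\<omega>. avg w (\<lambda>x. F (xs @ [x])) (?I - set xs) * of_bool (X \<omega> = xs) \<partial>P)"
      by (simp add: mult.commute)
  qed
  also have "\<dots> = (\<integral>\<omega>. (\<Sum>xs\<in>L. avg w (\<lambda>x. F (xs @ [x])) (?I - set xs) * of_bool (X \<omega> = xs)) \<partial>P)"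
    by (rule Bochner_Integration.integral_sum[symmetric]) (unfold X_def, intro integrable_mult_right intg)
  also have "\<dots> = (\<integral>\<omega>. avg w (\<lambda>x. F (X \<omega> @ [x])) (?I - set (X \<omega>)) \<partial>P)"
  proof (rule Bochner_Integration.integral_cong[OF refl])
    fix \<omega> assume \<omega>: "\<omega> \<in> space P"
    have X: "X \<omega> \<in> L" using Xprop[OF \<omega>] by (simp add: L_def)
    have "(\<Sum>xs\<in>L. avg w (\<lambda>x. F (xs @ [x])) (?I - set xs) * of_bool (X \<omega> = xs))
        = (\<Sum>xs\<in>L. if X \<omega> = xs then avg w (\<lambda>x. F (xs @ [x])) (?I - set xs) else 0)"
      by (intro sum.cong refl) auto
    thus "(\<Sum>xs\<in>L. avg w (\<lambda>x. F (xs @ [x])) (?I - set xs) * of_bool (X \<omega> = xs))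
        = avg w (\<lambda>x. F (X \<omega> @ [x])) (?I - set (X \<omega>))" using X finL by (simp add: sum.delta)
  qed
  also have "\<dots> = draws w k ?I (\<lambda>xs. avg w (\<lambda>x. F (xs @ [x])) (?I - set xs))"
    unfolding X_def by (rule Suc.IH) (use Suc.prems in simp)
  also have "\<dots> = draws w (k + 1) ?I F" unfolding draws_append by simp
  finally show ?case by simp
qed

subsection \<open>Second moment of a draw\<close>

text \<open>The summands \<open>x\<^sup>2 (S3 - S1 x\<^sup>2)\<close> change sign once, at \<open>x\<^sup>2 = S3 / S1\<close>, and
  \<open>x / (S1 - x)\<close> is increasing: this is Chebyshev's sum inequality.\<close>

lemma avg_square_supermartingale:
  assumes S: "pos_weights w S"
  shows "avg w (\<lambda>x. avg w (\<lambda>y. (w y)\<^sup>2) (S - {x})) S \<le> avg w (\<lambda>y. (w y)\<^sup>2) S"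
proof (cases "\<exists>x. S \<subseteq> {x}")
  \<comment> \<open>The general argument divides by the weight left after one draw, which is 0 for a
    singleton.\<close>
  case True
  then obtain x where "S = {} \<or> S = {x}" by blast
  thus ?thesis using S by (auto simp: avg_def pos_weights_def)
next
  case False
  hence ne: "S \<noteq> {}" by auto
  note fin = pos_weights_finite[OF S]
  define s1 where "s1 = sum w S"
  define s3 where "s3 = (\<Sum>y\<in>S. w y * (w y)\<^sup>2)"
  have s1: "0 < s1" unfolding s1_def by (rule pos_weights_sum_pos[OF S ne])
  have s3: "0 \<le> s3" unfolding s3_def using pos_weightsD[OF S]
    by (intro sum_nonneg mult_nonneg_nonneg) (auto intro: less_imp_le)
  have rest: "0 < s1 - w x" if "x \<in> S" for x
  proof -
    have "S - {x} \<noteq> {}" using False by auto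
    hence "0 < sum w (S - {x})"
      using pos_weights_sum_pos[OF pos_weights_subset[OF S]] by auto
    thus ?thesis using that fin by (simp add: s1_def sum_diff1)
  qed
  define x0 where "x0 = sqrt (s3 / s1)"
  have x0: "0 \<le> x0" "x0\<^sup>2 = s3 / s1" using s1 s3 by (auto simp: x0_def)
  have x0_le: "x0 < s1"
  proof -
    have "s3 < s1 * s1\<^sup>2"
    proof -
      have "s3 \<le> (\<Sum>y\<in>S. w y * (w y * s1))"
        unfolding s3_def power2_eq_square using pos_weightsD[OF S] rest
        by (intro sum_mono mult_left_mono) (auto intro: less_imp_le)
      also have "\<dots> < (\<Sum>y\<in>S. w y * (s1 * s1))"
        using pos_weightsD[OF S] rest s1 fin ne
        by (intro sum_strict_mono mult_strict_left_mono mult_strict_right_mono) auto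
      also have "\<dots> = s1 * s1\<^sup>2" by (simp add: s1_def sum_distrib_right power2_eq_square)
      finally show ?thesis .
    qed
    hence "x0\<^sup>2 < s1\<^sup>2" unfolding x0(2) using s1 by (simp add: divide_less_eq mult.commute)
    thus ?thesis using s1 by (simp add: power_less_imp_less_base)
  qed
  have avg_rest: "avg w (\<lambda>y. (w y)\<^sup>2) (S - {x}) = (s3 - w x * (w x)\<^sup>2) / (s1 - w x)" if "x \<in> S" for x
    using that fin by (simp add: avg_def s1_def s3_def sum_diff1)
  have "(\<Sum>x\<in>S. w x * (avg w (\<lambda>y. (w y)\<^sup>2) (S - {x}) - s3 / s1))
      \<le> (\<Sum>x\<in>S. (w x * (s3 - s1 * (w x)\<^sup>2)) * (x0 / ((s1 - x0) * s1)))"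
  proof (rule sum_mono)
    fix x assume x: "x \<in> S"
    have wx: "0 < w x" by (rule pos_weightsD[OF S x])
    have r: "0 < s1 - w x" by (rule rest[OF x])
    have "w x * (avg w (\<lambda>y. (w y)\<^sup>2) (S - {x}) - s3 / s1)
        = (w x * (s3 - s1 * (w x)\<^sup>2)) * (w x / ((s1 - w x) * s1))"
      unfolding avg_rest[OF x] using r s1 by (simp add: field_simps power2_eq_square)
    also have "\<dots> \<le> (w x * (s3 - s1 * (w x)\<^sup>2)) * (x0 / ((s1 - x0) * s1))"
    proof (cases "w x \<le> x0")
      case True
      have "(w x)\<^sup>2 \<le> s3 / s1" using True wx x0 by (metis less_imp_le power_mono)
      hence "0 \<le> s3 - s1 * (w x)\<^sup>2" using s1 by (simp add: field_simps)
      moreover have "w x / ((s1 - w x) * s1) \<le> x0 / ((s1 - x0) * s1)"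
        using True r s1 x0_le x0 by (intro frac_le mult_right_mono mult_pos_pos) auto
      ultimately show ?thesis using wx by (intro mult_left_mono mult_nonneg_nonneg) auto
    next
      case gt: False
      have "s3 / s1 \<le> (w x)\<^sup>2" using gt x0 by (metis less_imp_le not_le power_mono)
      hence "s3 - s1 * (w x)\<^sup>2 \<le> 0" using s1 by (simp add: field_simps)
      moreover have "x0 / ((s1 - x0) * s1) \<le> w x / ((s1 - w x) * s1)"
        using gt r s1 x0_le x0 wx by (intro frac_le mult_right_mono mult_pos_pos) auto
      ultimately show ?thesis using wx by (intro mult_left_mono_neg mult_nonneg_nonpos) auto
    qed
    finally show "w x * (avg w (\<lambda>y. (w y)\<^sup>2) (S - {x}) - s3 / s1)
        \<le> (w x * (s3 - s1 * (w x)\<^sup>2)) * (x0 / ((s1 - x0) * s1))" .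
  qed
  also have "\<dots> = 0"
  proof -
    have "(\<Sum>x\<in>S. w x * (s3 - s1 * (w x)\<^sup>2)) = (\<Sum>x\<in>S. s3 * w x) - (\<Sum>x\<in>S. s1 * (w x * (w x)\<^sup>2))"
      by (simp add: sum_subtractf[symmetric] algebra_simps)
    also have "\<dots> = 0" by (simp add: sum_distrib_left[symmetric] s1_def[symmetric] s3_def[symmetric])
    finally have "(\<Sum>x\<in>S. w x * (s3 - s1 * (w x)\<^sup>2)) = 0" .
    thus ?thesis unfolding sum_distrib_right[symmetric] by simp
  qed
  finally have "(\<Sum>x\<in>S. w x * avg w (\<lambda>y. (w y)\<^sup>2) (S - {x})) \<le> s3"
    unfolding right_diff_distrib sum_subtractf sum_distrib_right[symmetric] s1_def[symmetric]
    using s1 by simp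
  moreover have "avg w (\<lambda>y. (w y)\<^sup>2) S = s3 / s1" by (simp add: avg_def s1_def s3_def)
  ultimately show ?thesis
    unfolding avg_def[of w "\<lambda>x. avg w (\<lambda>y. (w y)\<^sup>2) (S - {x})"] s1_def[symmetric]
    using s1 by (simp add: divide_right_mono)
qed

lemma draws_avg_square_le:
  assumes "pos_weights w S"
  shows "draws w i S (\<lambda>xs. avg w (\<lambda>y. (w y)\<^sup>2) (S - set xs)) \<le> avg w (\<lambda>y. (w y)\<^sup>2) S"
  using assms
proof (induction i arbitrary: S)
  case (Suc i)
  have "draws w (Suc i) S (\<lambda>xs. avg w (\<lambda>y. (w y)\<^sup>2) (S - set xs))
      = avg w (\<lambda>x. draws w i (S - {x}) (\<lambda>xs. avg w (\<lambda>y. (w y)\<^sup>2) (S - {x} - set xs))) S"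
  proof -
    have "S - set (x # xs) = S - {x} - set xs" for x xs by auto
    thus ?thesis by (simp del: set_simps)
  qed
  also have "\<dots> \<le> avg w (\<lambda>x. avg w (\<lambda>y. (w y)\<^sup>2) (S - {x})) S"
    using Suc.prems by (intro avg_mono Suc.IH) (auto intro: pos_weights_subset)
  also have "\<dots> \<le> avg w (\<lambda>y. (w y)\<^sup>2) S" by (rule avg_square_supermartingale[OF Suc.prems])
  finally show ?case .
qed simp

text \<open>The conditional second moment is a supermartingale along the draws, so no later draw has
  a larger second moment than the first. This controls window sums on events of small
  probability.\<close>

lemma draws_nth_square_le:
  assumes "pos_weights w S" "i < k" "k \<le> card S"
  shows "draws w k S (\<lambda>xs. (w (xs ! i))\<^sup>2) \<le> avg w (\<lambda>y. (w y)\<^sup>2) S"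
  using draws_nth[OF assms, of "\<lambda>y. (w y)\<^sup>2"] draws_avg_square_le[OF assms(1), of i] by simp

subsection \<open>Fluctuations over a window\<close>

text \<open>Condition on the first \<open>p\<close> draws and apply the one-sided inequality to
  \<open>w\<close> and to \<open>- w\<close>. Since \<open>G\<close> is required only before the
  time \<open>s\<close>, an estimate of R(S) that merely holds with high probability can serve as
  the variance bound.\<close>

lemma draws_window_martingale:
  assumes w: "pos_weights w I" and pq: "p \<le> q" "q \<le> card I" and \<theta>: "0 \<le> \<theta>" and V: "0 \<le> V"
    and G: "\<And>S x. S \<subseteq> I \<Longrightarrow> G S \<Longrightarrow> x \<in> S \<Longrightarrow> \<theta> * w x \<le> 1"
      "\<And>S. S \<subseteq> I \<Longrightarrow> G S \<Longrightarrow> S \<noteq> {} \<Longrightarrow> avg w (\<lambda>y. (w y)\<^sup>2) S \<le> V"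
  shows "draws w q I (\<lambda>xs. of_bool (\<exists>s\<in>{p..q}. (\<forall>k\<in>{p..<s}. G (I - set (take k xs))) \<and>
      c \<le> \<bar>\<Sum>k=p..<s. w (xs ! k) - avg w w (I - set (take k xs))\<bar>))
    \<le> 2 * exp (- \<theta> * c + real (q - p) * (\<theta>\<^sup>2 * V))"
proof -
  let ?bd = "exp (- \<theta> * c + real (q - p) * (\<theta>\<^sup>2 * V))"
  let ?Q = "\<lambda>xs. \<exists>s\<in>{p..q}. (\<forall>k\<in>{p..<s}. G (I - set (take k xs))) \<and>
      c \<le> \<bar>\<Sum>k=p..<s. w (xs ! k) - avg w w (I - set (take k xs))\<bar>"
  have "draws w (p + (q - p)) I (\<lambda>xs. of_bool (?Q xs)) \<le> draws w p I (\<lambda>_. 2 * ?bd)"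
    unfolding draws_append
  proof (rule draws_mono[OF w])
    fix xs assume xs: "length xs = p" "distinct xs" "set xs \<subseteq> I"
    define S where "S = I - set xs"
    have S: "S \<subseteq> I" by (auto simp: S_def)
    have wS: "pos_weights w S" using w S by (rule pos_weights_subset)
    have cS: "q - p \<le> card S"
      using pq xs card_Diff_draws[OF pos_weights_finite[OF w] xs(2,3)] by (simp add: S_def)
    let ?E = "\<lambda>f ys. exceeds w f G S c ys"
    have avg0: "0 \<le> avg w w S'" if "S' \<subseteq> I" for S'
      using pos_weights_subset[OF w that] by (intro avg_nonneg) (auto simp: pos_weights_def intro: less_imp_le)
    have 1: "draws w (q - p) S (\<lambda>ys. of_bool (?E w ys)) \<le> ?bd"
    proof (rule maximal_inequality[OF wS cS \<theta> V])
      fix S' x assume *: "S' \<subseteq> S" "G S'" "x \<in> S'"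
      have "0 \<le> \<theta> * avg w w S'" using * S \<theta> avg0 by (intro mult_nonneg_nonneg) auto
      moreover have "\<theta> * w x \<le> 1" using G(1)[of S' x] * S by blast
      ultimately show "\<theta> * (w x - avg w w S') \<le> 1" by (simp add: right_diff_distrib)
    next
      fix S' assume *: "S' \<subseteq> S" "G S'" "S' \<noteq> {}"
      thus "avg w (\<lambda>x. (w x - avg w w S')\<^sup>2) S' \<le> V"
        using avg_square_dev_le[OF pos_weights_subset[OF wS *(1)] *(3), of w] G(2)[of S'] S by force
    qed
    have neg: "avg w (\<lambda>x. - w x) S' = - avg w w S'" for S'
      using avg_cmult[of w "-1" w S'] by simp
    have 2: "draws w (q - p) S (\<lambda>ys. of_bool (?E (\<lambda>x. - w x) ys)) \<le> ?bd"
    proof (rule maximal_inequality[OF wS cS \<theta> V])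
      fix S' x assume *: "S' \<subseteq> S" "G S'" "x \<in> S'"
      have wS': "pos_weights w S'" using wS *(1) by (rule pos_weights_subset)
      have "\<theta> * avg w w S' = avg w (\<lambda>x. \<theta> * w x) S'" by (simp add: avg_cmult)
      also have "\<dots> \<le> avg w (\<lambda>_. 1) S'" using G(1)[of S'] * S by (intro avg_mono[OF wS']) auto
      also have "\<dots> = 1" using * by (intro avg_const[OF wS']) auto
      finally have "\<theta> * avg w w S' \<le> 1" .
      moreover have "0 \<le> \<theta> * w x" using \<theta> pos_weightsD[OF wS' *(3)] by simp
      ultimately show "\<theta> * (- w x - avg w (\<lambda>x. - w x) S') \<le> 1" unfolding neg by (simp add: algebra_simps)
    next
      fix S' assume *: "S' \<subseteq> S" "G S'" "S' \<noteq> {}"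
      thus "avg w (\<lambda>x. (- w x - avg w (\<lambda>x. - w x) S')\<^sup>2) S' \<le> V"
        using avg_square_dev_le[OF pos_weights_subset[OF wS *(1)] *(3), of "\<lambda>x. - w x"] G(2)[of S'] S by force
    qed
    have "draws w (q - p) S (\<lambda>ys. of_bool (?Q (xs @ ys)))
        \<le> draws w (q - p) S (\<lambda>ys. of_bool (?E w ys) + of_bool (?E (\<lambda>x. - w x) ys))"
    proof (rule draws_mono[OF wS])
      fix ys :: "'a list" assume ys: "length ys = q - p"
      have "?E w ys \<or> ?E (\<lambda>x. - w x) ys" if Q: "?Q (xs @ ys)"
      proof -
        obtain s where s: "s \<in> {p..q}" "\<And>k. k \<in> {p..<s} \<Longrightarrow> G (I - set (take k (xs @ ys)))"
          "c \<le> \<bar>\<Sum>k=p..<s. w ((xs @ ys) ! k) - avg w w (I - set (take k (xs @ ys)))\<bar>"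
          using Q by blast
        have tk: "I - set (take (p + j) (xs @ ys)) = S - set (take j ys)" for j
          using xs by (auto simp: S_def)
        have g: "G (S - set (take j ys))" if "j < s - p" for j
          using s(2)[of "p + j"] that tk[of j] by auto
        have "(\<Sum>k=p..<s. w ((xs @ ys) ! k) - avg w w (I - set (take k (xs @ ys))))
            = (\<Sum>j<s - p. w (ys ! j) - avg w w (S - set (take j ys)))"
          by (rule sum.reindex_bij_witness[of _ "\<lambda>j. p + j" "\<lambda>k. k - p"])
            (use xs s(1) tk in \<open>auto simp: nth_append\<close>)
        hence "c \<le> (\<Sum>j<s - p. w (ys ! j) - avg w w (S - set (take j ys)))
            \<or> c \<le> (\<Sum>j<s - p. - w (ys ! j) - avg w (\<lambda>x. - w x) (S - set (take j ys)))"
          using s(3) unfolding neg by (auto simp: sum_subtractf sum_negf abs_if split: if_splits)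
        moreover have "s - p \<le> length ys" using s(1) ys by auto
        ultimately show ?thesis
          using exceedsI[of "s - p" ys G S c w w, OF _ g] exceedsI[of "s - p" ys G S c "\<lambda>x. - w x" w, OF _ g]
          by blast
      qed
      thus "of_bool (?Q (xs @ ys)) \<le> (of_bool (?E w ys) + of_bool (?E (\<lambda>x. - w x) ys) :: real)"
        by (cases "?Q (xs @ ys)") auto
    qed
    also have "\<dots> \<le> 2 * ?bd" unfolding draws_add using 1 2 by simp
    finally show "draws w (q - p) (I - set xs) (\<lambda>ys. of_bool (?Q (xs @ ys))) \<le> 2 * ?bd"
      by (simp add: S_def)
  qed
  also have "\<dots> = 2 * ?bd" by (rule draws_const[OF w]) (use pq in simp)
  finally show ?thesis using pq by simp
qed

text \<open>No probability is involved: a window is the difference of two partial sums from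
  \<open>p\<close>, hence twice \<open>c\<close>; the drift costs at most \<open>e\<close> per draw;
  draws from \<open>q\<close> on are compared with 0 and cost \<open>d\<close>.\<close>

lemma window_deviation:
  fixes x R r :: "nat \<Rightarrow> real"
  assumes pq: "p \<le> q" and ij: "p \<le> i" "i \<le> j" "j \<le> m"
    and mart: "\<And>s. s \<in> {p..q} \<Longrightarrow> \<bar>\<Sum>k=p..<s. x k - R k\<bar> \<le> c"
    and drift: "\<And>k. k \<in> {p..<q} \<Longrightarrow> \<bar>R k - r k\<bar> \<le> e"
    and tail: "(\<Sum>k=q..<m. x k) \<le> d" "\<And>k. 0 \<le> x k" and e: "0 \<le> e"
  shows "\<bar>(\<Sum>k=i..<j. x k) - (\<Sum>k\<in>{i..<j} \<inter> {..<q}. r k)\<bar> \<le> 2 * c + real (q - p) * e + d"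
proof -
  define a where "a = min i q"
  define b where "b = min j q"
  have ab: "p \<le> a" "a \<le> b" "b \<le> q" using pq ij by (auto simp: a_def b_def)
  have set1: "{i..<j} \<inter> {..<q} = {a..<b}" by (auto simp: a_def b_def)
  have "(\<Sum>k=i..<j. x k) = (\<Sum>k\<in>{a..<b}. x k) + (\<Sum>k\<in>{i..<j} - {..<q}. x k)"
    using sum.Int_Diff[of "{i..<j}" x "{..<q}"] set1 by simp
  moreover have "0 \<le> (\<Sum>k\<in>{i..<j} - {..<q}. x k)" using tail(2) by (intro sum_nonneg)
  moreover have "(\<Sum>k\<in>{i..<j} - {..<q}. x k) \<le> (\<Sum>k=q..<m. x k)"
    using tail(2) ij by (intro sum_mono2) auto
  moreover have "\<bar>(\<Sum>k=a..<b. x k) - (\<Sum>k=a..<b. r k)\<bar> \<le> 2 * c + real (q - p) * e"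
  proof -
    have split: "(\<Sum>k=p..<b. x k - R k) = (\<Sum>k=p..<a. x k - R k) + (\<Sum>k=a..<b. x k - R k)"
      using ab by (simp add: sum.atLeastLessThan_concat)
    have "\<bar>\<Sum>k=p..<b. x k - R k\<bar> \<le> c" "\<bar>\<Sum>k=p..<a. x k - R k\<bar> \<le> c" using ab by (auto intro!: mart)
    hence 1: "\<bar>\<Sum>k=a..<b. x k - R k\<bar> \<le> 2 * c" using split by linarith
    have "\<bar>\<Sum>k=a..<b. R k - r k\<bar> \<le> (\<Sum>k=a..<b. \<bar>R k - r k\<bar>)" by (rule sum_abs)
    also have "\<dots> \<le> (\<Sum>k=a..<b. e)" using ab by (intro sum_mono drift) auto
    also have "\<dots> \<le> real (q - p) * e" using ab e by (simp add: mult_right_mono)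
    finally have 2: "\<bar>\<Sum>k=a..<b. R k - r k\<bar> \<le> real (q - p) * e" .
    have "(\<Sum>k=a..<b. x k) - (\<Sum>k=a..<b. r k) = (\<Sum>k=a..<b. x k - R k) + (\<Sum>k=a..<b. R k - r k)"
      by (simp add: sum_subtractf)
    thus ?thesis using 1 2 by linarith
  qed
  ultimately show ?thesis unfolding set1 using tail(1) by linarith
qed

subsection \<open>Weights with bounded moments\<close>

text \<open>What the estimates take from Conditions 1 at a fixed \<open>n\<close>, with constants
  uniform in \<open>n\<close>: bounded first three moments, and at least half of the weights between
  \<open>a\<close> and \<open>b\<close>.\<close>

locale weight_profile =
  fixes w :: "nat \<Rightarrow> real" and n :: nat and a b C :: real
  assumes pos: "pos_weights w {1..n}" and n: "1 \<le> n"
    and ab: "0 < a" "a \<le> b" and C: "1 \<le> C"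
    and few_small: "real (card {i\<in>{1..n}. w i < a}) \<le> n / 4"
    and few_large: "real (card {i\<in>{1..n}. b < w i}) \<le> n / 4"
    and moments: "(\<Sum>i=1..n. w i) \<le> C * n" "(\<Sum>i=1..n. (w i)\<^sup>2) \<le> C * n" "(\<Sum>i=1..n. (w i)^3) \<le> C * n"
begin

abbreviation "I \<equiv> {1..n}"

lemma wpos: "i \<in> I \<Longrightarrow> 0 < w i"
  using pos by (rule pos_weightsD)

lemma wnonneg: "i \<in> I \<Longrightarrow> 0 \<le> w i"
  using wpos by (simp add: less_imp_le)

lemma sum_weights_ge:
  assumes S: "S \<subseteq> I" "n \<le> 2 * card S"
  shows "a * n / 4 \<le> sum w S"
proof -
  have finS: "finite S" using S(1) finite_subset by blast
  let ?B = "{i\<in>I. w i < a}"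
  have "card S \<le> card (S - ?B) + card ?B"
    using card_Un_le[of "S - ?B" ?B] card_mono[of "(S - ?B) \<union> ?B" S] finS by auto
  hence "real n / 4 \<le> card (S - ?B)" using few_small S(2) by linarith
  hence "a * n / 4 \<le> (\<Sum>i\<in>S - ?B. a)" using ab mult_left_mono[of "real n / 4" _ a] by (simp add: mult.commute)
  also have "\<dots> \<le> sum w (S - ?B)" using S by (intro sum_mono) auto
  also have "\<dots> \<le> sum w S" using finS S wnonneg by (intro sum_mono2) auto
  finally show ?thesis .
qed

lemma sum_middle_ge:
  assumes t: "0 \<le> t" and M: "M \<subseteq> I" "\<And>i. i \<in> I \<Longrightarrow> a \<le> w i \<Longrightarrow> w i \<le> b \<Longrightarrow> i \<in> M"
  shows "a * n / 2 * exp (- (b * t)) \<le> mass w w M t"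
proof -
  let ?B = "{i\<in>I. w i < a}" and ?D = "{i\<in>I. b < w i}"
  let ?M = "I - (?B \<union> ?D)"
  have finM: "finite M" using M(1) finite_subset by blast
  have "card I \<le> card ?M + card (?B \<union> ?D)"
    using card_Un_le[of ?M "?B \<union> ?D"] card_mono[of "?M \<union> (?B \<union> ?D)" I] by auto
  moreover have "card (?B \<union> ?D) \<le> card ?B + card ?D" by (rule card_Un_le)
  ultimately have "real n / 2 \<le> card ?M" using few_small few_large by simp
  hence "a * exp (- (b * t)) * (real n / 2) \<le> a * exp (- (b * t)) * card ?M"
    using ab by (intro mult_left_mono) auto
  also have "\<dots> = (\<Sum>i\<in>?M. exp (- (b * t)) * a)" by simp
  also have "\<dots> \<le> (\<Sum>i\<in>?M. survive w t i * w i)"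
  proof (rule sum_mono, rule mult_mono)
    fix i assume i: "i \<in> ?M"
    show "exp (- (b * t)) \<le> survive w t i" using i t by (auto simp: survive_def mult_right_mono)
    show "a \<le> w i" using i by auto
  qed (use ab in \<open>auto simp: survive_def\<close>)
  also have "\<dots> \<le> mass w w M t"
    unfolding mass_def
  proof (rule sum_mono2[OF finM])
    show "?M \<subseteq> M" by (auto intro!: M(2) simp: not_less)
    show "0 \<le> survive w t i * w i" if "i \<in> M - ?M" for i
      using that wnonneg[of i] M(1) by (auto simp: survive_def)
  qed
  finally show ?thesis by (simp add: mult_ac)
qed

lemma avg_le_of_large:
  fixes B :: real
  assumes S: "S \<subseteq> I" "n \<le> 2 * card S" and f: "\<And>i. i \<in> I \<Longrightarrow> 0 \<le> f i"
    and B: "(\<Sum>i\<in>I. w i * f i) \<le> B * n" and "0 \<le> B"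
  shows "avg w f S \<le> 4 * B / a"
proof -
  have s: "a * n / 4 \<le> sum w S" by (rule sum_weights_ge[OF S])
  have "0 < a * n / 4" using ab n by simp
  have "(\<Sum>i\<in>S. w i * f i) \<le> (\<Sum>i\<in>I. w i * f i)"
    using S f wnonneg by (intro sum_mono2) auto
  hence "avg w f S \<le> (B * n) / (a * n / 4)"
    unfolding avg_def using B s \<open>0 < a * n / 4\<close> \<open>0 \<le> B\<close> by (intro frac_le) auto
  also have "\<dots> = 4 * B / a" using n by simp
  finally show ?thesis .
qed

lemma avg_square_le_of_large:
  assumes "S \<subseteq> I" "n \<le> 2 * card S"
  shows "avg w (\<lambda>i. (w i)\<^sup>2) S \<le> 4 * C / a"
  using moments(3) C by (intro avg_le_of_large[OF assms]) (auto simp: power2_eq_square power3_eq_cube mult.assoc)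

text \<open>Beyond time 2/a, the at most n/4 weights below \<open>a\<close> may all survive, but the
  others survive with probability below exp (- 2) <= 1/3. Fewer than n/4 + (3/4) (n/3) = n/2
  elements would be expected alive.\<close>

lemma time_le:
  assumes k: "2 * k \<le> n" and t: "0 \<le> t" "mass w (\<lambda>_. 1) I t = n - k"
  shows "t \<le> 2 / a"
proof (rule ccontr)
  assume "\<not> t \<le> 2 / a"
  hence at: "2 < a * t" using ab by (simp add: field_simps)
  have "exp (- (a * t)) < exp (- 2)" using at by simp
  also have "\<dots> \<le> 1 / 3"
    using exp_ge_add_one_self[of "2 :: real"] by (simp add: exp_minus field_simps)
  finally have e: "exp (- (a * t)) < 1 / 3" .
  let ?B = "{i\<in>I. w i < a}"
  have "mass w (\<lambda>_. 1) I t = (\<Sum>i\<in>?B. survive w t i) + (\<Sum>i\<in>I - ?B. survive w t i)"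
  proof -
    have "sum (survive w t) I = sum (survive w t) (I - ?B) + sum (survive w t) ?B"
      by (rule sum.subset_diff) auto
    thus ?thesis by (simp add: mass_def)
  qed
  also have "\<dots> \<le> (\<Sum>i\<in>?B. 1) + (\<Sum>i\<in>I - ?B. exp (- (a * t)))"
    using survive_bounds[OF pos t(1)] t(1)
    by (intro add_mono sum_mono) (auto simp: survive_def mult_right_mono)
  also have "\<dots> = card ?B * (1 - exp (- (a * t))) + n * exp (- (a * t))"
  proof -
    have "card ?B \<le> card I" by (rule card_mono) auto
    hence "card ?B \<le> n" by simp
    moreover have "card (I - ?B) = n - card ?B" by (subst card_Diff_subset) auto
    ultimately show ?thesis by (simp add: of_nat_diff algebra_simps)
  qed
  also have "\<dots> \<le> n / 4 * (1 - exp (- (a * t))) + n * exp (- (a * t))"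
    using few_small e at by (intro add_right_mono mult_right_mono) auto
  also have "\<dots> = n / 4 + 3 / 4 * (n * exp (- (a * t)))" by (simp add: field_simps)
  also have "\<dots> < n / 4 + 3 / 4 * (n * (1 / 3))"
    using e n by (intro add_strict_left_mono mult_strict_left_mono) auto
  finally show False using t(2) k by (simp add: of_nat_diff)
qed

end

section \<open>Deviations of ratios and sums over the drawn elements\<close>

text \<open>Numerator minus \<open>r\<close> times denominator is linear in the four deviations.
  \<open>A1\<close>, \<open>A2\<close> stand for bounded weights and \<open>B1\<close>,
  \<open>B2\<close> for heavy ones; the smaller tolerance \<open>D / T\<close> for \<open>B1\<close>
  compensates the factor \<open>r \<le> T\<close>.\<close>

lemma ratio_deviation:
  fixes A1 A2 B1 B2 :: real
  assumes d: "\<bar>A2 - p2\<bar> \<le> d2" "\<bar>A1 - p1\<bar> \<le> d1" "\<bar>B2 - q2\<bar> \<le> D" "\<bar>B1 - q1\<bar> \<le> D / T" and T: "0 < T"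
    and r: "r * (p1 + q1) = p2 + q2" "0 \<le> r" "r \<le> T" and N: "0 < A1 + B1"
  shows "\<bar>(A2 + B2) / (A1 + B1) - r\<bar> \<le> (d2 + T * d1 + 2 * D) / (A1 + B1)"
proof -
  have r1: "r * \<bar>A1 - p1\<bar> \<le> T * d1" using d(2) r T by (intro mult_mono) auto
  have "r * \<bar>B1 - q1\<bar> \<le> T * (D / T)" using d(4) r T by (intro mult_mono) auto
  hence r2: "r * \<bar>B1 - q1\<bar> \<le> D" using T by simp
  have "A2 + B2 - r * (A1 + B1) = (A2 - p2) + (B2 - q2) - r * (A1 - p1) - r * (B1 - q1)"
    using r(1) by (simp add: algebra_simps)
  moreover have "\<bar>r * (A1 - p1)\<bar> = r * \<bar>A1 - p1\<bar>" "\<bar>r * (B1 - q1)\<bar> = r * \<bar>B1 - q1\<bar>"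
    using r(2) by (simp_all add: abs_mult)
  ultimately have "\<bar>A2 + B2 - r * (A1 + B1)\<bar> \<le> d2 + T * d1 + 2 * D"
    using d r1 r2 by linarith
  moreover have "(A2 + B2) / (A1 + B1) - r = (A2 + B2 - r * (A1 + B1)) / (A1 + B1)"
    using N by (simp add: field_simps)
  ultimately show ?thesis using N by (simp add: divide_right_mono)
qed

text \<open>Each draw contributes at most \<open>exp v\<close> to the exponential moment, whatever
  has been drawn before.\<close>

lemma draws_exp_sum_le:
  assumes "pos_weights w S" "k \<le> card S"
    and "\<And>S'. S' \<subseteq> S \<Longrightarrow> card S < card S' + k \<Longrightarrow> avg w (\<lambda>x. exp (f x)) S' \<le> exp v"
  shows "draws w k S (\<lambda>xs. exp (sum f (set xs))) \<le> exp (k * v)"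
  using assms
proof (induction k arbitrary: S)
  case (Suc k)
  note fin = pos_weights_finite[OF Suc.prems(1)]
  have "draws w (Suc k) S (\<lambda>xs. exp (sum f (set xs)))
      = avg w (\<lambda>x. draws w k (S - {x}) (\<lambda>xs. exp (f x) * exp (sum f (set xs)))) S"
    unfolding draws.simps
  proof (rule avg_cong, rule draws_cong)
    fix x and xs :: "'a list" assume "set xs \<subseteq> S - {x}"
    hence "x \<notin> set xs" by auto
    thus "exp (sum f (set (x # xs))) = exp (f x) * exp (sum f (set xs))" by (simp add: exp_add)
  qed
  also have "\<dots> \<le> avg w (\<lambda>x. exp (k * v) * exp (f x)) S"
  proof (rule avg_mono[OF Suc.prems(1)])
    fix x assume x: "x \<in> S"
    have c: "Suc (card (S - {x})) = card S" using x fin by (simp only: card_Suc_Diff1)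
    have "draws w k (S - {x}) (\<lambda>xs. exp (sum f (set xs))) \<le> exp (k * v)"
    proof (rule Suc.IH)
      show "pos_weights w (S - {x})" using Suc.prems(1) pos_weights_subset by blast
      show "k \<le> card (S - {x})" using Suc.prems(2) c by simp
    next
      fix S' assume "S' \<subseteq> S - {x}" "card (S - {x}) < card S' + k"
      thus "avg w (\<lambda>x. exp (f x)) S' \<le> exp v" using c by (intro Suc.prems(3)) auto
    qed
    thus "draws w k (S - {x}) (\<lambda>xs. exp (f x) * exp (sum f (set xs))) \<le> exp (k * v) * exp (f x)"
      unfolding draws_cmult by (simp add: mult.commute)
  qed
  also have "\<dots> = exp (k * v) * avg w (\<lambda>x. exp (f x)) S" by (rule avg_cmult)
  also have "\<dots> \<le> exp (k * v) * exp v" using Suc.prems(3)[of S] by (intro mult_left_mono) auto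
  also have "\<dots> = exp (Suc k * v)" by (simp add: exp_add[symmetric] algebra_simps)
  finally show ?case .
qed simp

lemma draws_sum_set_le:
  assumes w: "pos_weights w S" and k: "k \<le> card S"
    and f: "\<And>S'. S' \<subseteq> S \<Longrightarrow> card S < card S' + k \<Longrightarrow> avg w f S' \<le> v"
  shows "draws w k S (\<lambda>xs. sum f (set xs)) \<le> k * v"
proof -
  have "draws w k S (\<lambda>xs. sum f (set xs)) = draws w k S (\<lambda>xs. \<Sum>i<k. f (xs ! i))"
  proof (rule draws_cong)
    fix xs :: "'a list" assume "length xs = k" "distinct xs"
    thus "sum f (set xs) = (\<Sum>i<k. f (xs ! i))"
      by (simp add: sum_list_distinct_conv_sum_set[symmetric] sum_list_sum_nth atLeast0LessThan)
  qed
  also have "\<dots> = (\<Sum>i<k. draws w i S (\<lambda>xs. avg w f (S - set xs)))"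
    unfolding draws_sum by (intro sum.cong refl draws_nth[OF w _ k]) auto
  also have "\<dots> \<le> (\<Sum>i<k. v)"
  proof (rule sum_mono)
    fix i assume i: "i \<in> {..<k}"
    have "draws w i S (\<lambda>xs. avg w f (S - set xs)) \<le> draws w i S (\<lambda>_. v)"
    proof (rule draws_mono[OF w], rule f)
      fix xs assume "length xs = i" "distinct xs" "set xs \<subseteq> S"
      thus "card S < card (S - set xs) + k"
        using card_Diff_draws[OF pos_weights_finite[OF w], of xs] i k by simp
    qed auto
    also have "\<dots> = v" by (rule draws_const[OF w]) (use i k in simp)
    finally show "draws w i S (\<lambda>xs. avg w f (S - set xs)) \<le> v" .
  qed
  finally show ?thesis by simp
qed

lemma mass_if:
  assumes "finite I"
  shows "mass w (\<lambda>i. if P i then f i else 0) I t = mass w f {i\<in>I. P i} t"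
  unfolding mass_def sum.inter_filter[OF assms] by (rule sum.cong) auto

definition window_sum :: "('a \<Rightarrow> real) \<Rightarrow> nat \<Rightarrow> nat \<Rightarrow> 'a list \<Rightarrow> real" where
  "window_sum w i j xs = (\<Sum>k=i..<j. w (xs ! k))"

subsection \<open>Windows in the first half of the sample\<close>

context weight_profile
begin

lemma card_minus_take:
  assumes "length xs = m" "distinct xs" "set xs \<subseteq> I" "k \<le> m"
  shows "card (I - set (take k xs)) = n - k"
  using assms card_Diff_draws[of I "take k xs"] set_take_subset[of k xs] by simp

lemma ex_time:
  assumes "k < n"
  obtains t where "0 \<le> t" "mass w (\<lambda>_. 1) I t = n - k"
proof -
  have "\<exists>t\<ge>0. mass w (\<lambda>_. 1) I t = real (n - k)"
    using assms by (intro mass_attains_above[OF pos]) (auto simp: mass_one_zero)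
  thus ?thesis using that by auto
qed

text \<open>Up to time \<open>n / 2\<close> the heavy weights (those above \<open>T\<close>) are frozen in the deterministic
  approximation \<open>r\<close> of the conditional mean of a draw; the error comes from those already drawn.\<close>

lemma ratio_bulk:
  fixes T r f1 f2 :: real
  defines "low \<equiv> (\<lambda>i. w i \<le> T)"
  assumes xs: "length xs = m" "distinct xs" "set xs \<subseteq> I" and km: "k \<le> m" "2 * m \<le> n"
    and T: "0 < T" and r: "0 \<le> r" "r \<le> T"
    and r_eq: "r * (f1 + (\<Sum>i\<in>I. if low i then 0 else w i)) = f2 + (\<Sum>i\<in>I. if low i then 0 else (w i)\<^sup>2)"
  shows "\<bar>avg w w (I - set (take k xs)) - r\<bar>
    \<le> 4 / (a * n) * (\<bar>(\<Sum>i\<in>I - set (take k xs). if low i then (w i)\<^sup>2 else 0) - f2\<bar>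
      + T * \<bar>(\<Sum>i\<in>I - set (take k xs). if low i then w i else 0) - f1\<bar>
      + 2 * (\<Sum>i\<in>set xs. if low i then 0 else (w i)\<^sup>2))"
proof -
  define S where "S = I - set (take k xs)"
  have S: "S \<subseteq> I" "n \<le> 2 * card S" using card_minus_take[OF xs km(1)] km by (auto simp: S_def)
  have finS: "finite S" using S(1) finite_subset by blast
  have an: "0 < a * n" using ab n by simp
  define A1 where "A1 = (\<Sum>i\<in>S. if low i then w i else 0)"
  define A2 where "A2 = (\<Sum>i\<in>S. if low i then (w i)\<^sup>2 else 0)"
  define B1 where "B1 = (\<Sum>i\<in>S. if low i then 0 else w i)"
  define B2 where "B2 = (\<Sum>i\<in>S. if low i then 0 else (w i)\<^sup>2)"
  define D where "D = (\<Sum>i\<in>set xs. if low i then 0 else (w i)\<^sup>2)"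
  have N1: "sum w S = A1 + B1" and N2: "(\<Sum>i\<in>S. (w i)\<^sup>2) = A2 + B2"
    by (simp_all add: A1_def B1_def A2_def B2_def sum.distrib[symmetric] if_distrib cong: if_cong)
  have N: "a * n / 4 \<le> A1 + B1" using sum_weights_ge[OF S] by (simp add: N1)
  have avg: "avg w w S = (A2 + B2) / (A1 + B1)"
    unfolding avg_def N1 N2[symmetric] by (simp add: power2_eq_square)
  have ISx: "I - S = set (take k xs)" using xs set_take_subset[of k xs] by (auto simp: S_def)
  have dead: "(\<Sum>i\<in>I. f i) - (\<Sum>i\<in>S. f i) = (\<Sum>i\<in>set (take k xs). f i)" for f :: "nat \<Rightarrow> real"
    using sum_diff[OF _ S(1), of f] ISx by simp
  have tk: "set (take k xs) \<subseteq> set xs" by (rule set_take_subset)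
  have b2: "\<bar>B2 - (\<Sum>i\<in>I. if low i then 0 else (w i)\<^sup>2)\<bar> \<le> D"
  proof -
    have "(\<Sum>i\<in>I. if low i then 0 else (w i)\<^sup>2) - B2 = (\<Sum>i\<in>set (take k xs). if low i then 0 else (w i)\<^sup>2)"
      unfolding B2_def by (rule dead)
    moreover have "0 \<le> (\<Sum>i\<in>set (take k xs). if low i then 0 else (w i)\<^sup>2)" by (intro sum_nonneg) auto
    moreover have "(\<Sum>i\<in>set (take k xs). if low i then 0 else (w i)\<^sup>2) \<le> D"
      unfolding D_def using tk by (intro sum_mono2) auto
    ultimately show ?thesis by linarith
  qed
  \<comment> \<open>A weight w above \<open>T\<close> satisfies w <= w^2 / T, so the loss in the
    denominator is at most the \<open>T\<close>-th part of the bound for the numerator.\<close>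
  have b1: "\<bar>B1 - (\<Sum>i\<in>I. if low i then 0 else w i)\<bar> \<le> D / T"
  proof -
    have "(\<Sum>i\<in>I. if low i then 0 else w i) - B1 = (\<Sum>i\<in>set (take k xs). if low i then 0 else w i)"
      unfolding B1_def by (rule dead)
    moreover have "0 \<le> (\<Sum>i\<in>set (take k xs). if low i then 0 else w i)"
      using tk xs wnonneg by (intro sum_nonneg) auto
    moreover have "(\<Sum>i\<in>set (take k xs). if low i then 0 else w i)
        \<le> (\<Sum>i\<in>set (take k xs). (if low i then 0 else (w i)\<^sup>2) / T)"
    proof (rule sum_mono)
      fix i assume "i \<in> set (take k xs)"
      hence "0 < w i" using tk xs wpos by auto
      thus "(if low i then 0 else w i) \<le> (if low i then 0 else (w i)\<^sup>2) / T"
        using T by (auto simp: low_def field_simps power2_eq_square)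
    qed
    moreover have "\<dots> \<le> D / T"
      unfolding D_def sum_divide_distrib[symmetric] using tk T
      by (intro divide_right_mono sum_mono2) auto
    ultimately show ?thesis by linarith
  qed
  have D: "0 \<le> D" unfolding D_def by (intro sum_nonneg) auto
  have "\<bar>avg w w S - r\<bar> \<le> (\<bar>A2 - f2\<bar> + T * \<bar>A1 - f1\<bar> + 2 * D) / (A1 + B1)"
    unfolding avg by (rule ratio_deviation[OF _ _ b2 b1 T r_eq r]) (use N an in auto)
  also have "\<dots> \<le> (\<bar>A2 - f2\<bar> + T * \<bar>A1 - f1\<bar> + 2 * D) / (a * n / 4)"
    using N an D T by (intro divide_left_mono add_nonneg_nonneg mult_nonneg_nonneg) auto
  also have "\<dots> = 4 / (a * n) * (\<bar>A2 - f2\<bar> + T * \<bar>A1 - f1\<bar> + 2 * D)" by simp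
  finally show ?thesis by (simp only: S_def A1_def A2_def D_def)
qed

text \<open>An exponential moment is available only for weights up to \<open>L\<close>, where
  \<theta> w^2 <= 1. The weights above \<open>L\<close> are bounded without randomness: w^2 <= w^3 /
  L, so together they contribute at most \<epsilon> n / L. While half of the elements remain, a draw
  has mean heavy square at most 4 \<epsilon> / a, and exp x <= 1 + 2 x on [0, 1] doubles
  this.\<close>

lemma heavy_dead_bulk:
  fixes T \<theta> L \<epsilon> c :: real
  assumes m: "2 * m \<le> n" and \<theta>: "0 \<le> \<theta>" "\<And>i. i \<in> I \<Longrightarrow> w i \<le> L \<Longrightarrow> \<theta> * (w i)\<^sup>2 \<le> 1" and L: "0 < L"
    and tail: "(\<Sum>i\<in>I. if w i \<le> T then 0 else (w i)^3) \<le> \<epsilon> * n"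
  shows "draws w m I (\<lambda>xs. \<Sum>i\<in>set xs. if w i \<le> T then 0 else (w i)\<^sup>2) \<le> m * (4 * \<epsilon> / a)" (is ?A)
    and "draws w m I (\<lambda>xs. of_bool (c + \<epsilon> * n / L \<le> (\<Sum>i\<in>set xs. if w i \<le> T then 0 else (w i)\<^sup>2)))
      \<le> exp (- \<theta> * c + m * (\<theta> * (8 * \<epsilon> / a)))" (is ?B)
proof -
  have mc: "m \<le> card I" using m by simp
  have big: "n \<le> 2 * card S'" if "card I < card S' + m" for S' :: "nat set" using that m by simp
  have \<epsilon>: "0 \<le> \<epsilon>"
  proof -
    have "0 \<le> (\<Sum>i\<in>I. if w i \<le> T then 0 else (w i)^3)" using wnonneg by (intro sum_nonneg) auto
    hence "0 \<le> \<epsilon> * n" using tail by linarith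
    thus ?thesis using n by (simp add: zero_le_mult_iff)
  qed
  have cube: "w i * (if w i \<le> T then 0 else (w i)\<^sup>2) = (if w i \<le> T then 0 else (w i)^3)" for i
    by (simp add: power2_eq_square power3_eq_cube)
  show ?A
    by (rule draws_sum_set_le[OF pos mc], rule avg_le_of_large)
      (use big tail \<epsilon> in \<open>auto simp: cube\<close>)
  define f where "f i = (if w i \<le> T \<or> L < w i then 0 else \<theta> * (w i)\<^sup>2)" for i
  have f: "0 \<le> f i \<and> f i \<le> 1" if "i \<in> I" for i using \<theta> that by (auto simp: f_def)
  have avgexp: "avg w (\<lambda>x. exp (f x)) S \<le> exp (\<theta> * (8 * \<epsilon> / a))" if S: "S \<subseteq> I" "card I < card S + m" for S
  proof -
    have wS: "pos_weights w S" using pos S(1) by (rule pos_weights_subset)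
    have ne: "S \<noteq> {}" using S(2) mc by auto
    have "avg w (\<lambda>x. exp (f x)) S \<le> avg w (\<lambda>x. 1 + 2 * f x) S"
    proof (rule avg_mono[OF wS])
      fix x assume "x \<in> S"
      hence fx: "0 \<le> f x" "f x \<le> 1" using f S by auto
      have "exp (f x) \<le> 1 + f x + (f x)\<^sup>2" by (rule exp_le_one_plus_square[OF fx(2)])
      moreover have "(f x)\<^sup>2 \<le> f x" using fx by (simp add: power2_eq_square mult_left_le_one_le)
      ultimately show "exp (f x) \<le> 1 + 2 * f x" by simp
    qed
    also have "\<dots> = 1 + 2 * avg w f S" by (simp only: avg_add avg_cmult avg_const[OF wS ne])
    also have "avg w f S \<le> 4 * (\<theta> * \<epsilon>) / a"
    proof (rule avg_le_of_large[OF S(1) big[OF S(2)]])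
      have "(\<Sum>i\<in>I. w i * f i) \<le> (\<Sum>i\<in>I. \<theta> * (if w i \<le> T then 0 else (w i)^3))"
        using wnonneg \<theta>(1) by (intro sum_mono) (auto simp: f_def power2_eq_square power3_eq_cube)
      also have "\<dots> \<le> \<theta> * (\<epsilon> * n)" unfolding sum_distrib_left[symmetric]
        using tail \<theta>(1) by (intro mult_left_mono) auto
      finally show "(\<Sum>i\<in>I. w i * f i) \<le> \<theta> * \<epsilon> * n" by (simp add: mult.assoc)
    qed (use f \<theta> \<epsilon> in auto)
    hence "1 + 2 * avg w f S \<le> 1 + 2 * (4 * (\<theta> * \<epsilon>) / a)" by simp
    also have "\<dots> = 1 + \<theta> * (8 * \<epsilon> / a)" by simp
    also have "\<dots> \<le> exp (\<theta> * (8 * \<epsilon> / a))" by (rule exp_ge_add_one_self)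
    finally show ?thesis by simp
  qed
  have rest: "(\<Sum>i\<in>set xs. if w i \<le> T then 0 else \<theta> * (w i)\<^sup>2) \<le> sum f (set xs) + \<theta> * (\<epsilon> * n / L)"
    if xs: "set xs \<subseteq> I" for xs
  proof -
    have "(\<Sum>i\<in>set xs. if w i \<le> T then 0 else \<theta> * (w i)\<^sup>2)
        \<le> (\<Sum>i\<in>set xs. f i + \<theta> * ((if w i \<le> T then 0 else (w i)^3) / L))"
    proof (rule sum_mono)
      fix i assume "i \<in> set xs"
      hence wi: "0 < w i" using xs wpos by auto
      show "(if w i \<le> T then 0 else \<theta> * (w i)\<^sup>2) \<le> f i + \<theta> * ((if w i \<le> T then 0 else (w i)^3) / L)"
      proof (cases "L < w i")
        case True
        have "(w i)\<^sup>2 * L \<le> (w i)\<^sup>2 * w i" using True by (intro mult_left_mono) auto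
        hence "(w i)\<^sup>2 \<le> (w i)^3 / L" using L by (simp add: field_simps power2_eq_square power3_eq_cube)
        hence "\<theta> * (w i)\<^sup>2 \<le> \<theta> * ((w i)^3 / L)" using \<theta>(1) by (rule mult_left_mono)
        thus ?thesis using True by (simp add: f_def)
      next
        case False
        have "0 \<le> \<theta> * ((w i)^3 / L)" using wi L \<theta> by simp
        thus ?thesis using False by (simp add: f_def)
      qed
    qed
    also have "\<dots> = sum f (set xs) + \<theta> * ((\<Sum>i\<in>set xs. if w i \<le> T then 0 else (w i)^3) / L)"
      by (simp add: sum.distrib sum_distrib_left sum_divide_distrib)
    also have "\<dots> \<le> sum f (set xs) + \<theta> * ((\<Sum>i\<in>I. if w i \<le> T then 0 else (w i)^3) / L)"
      using xs wnonneg \<theta> L by (intro add_left_mono mult_left_mono divide_right_mono sum_mono2) auto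
    also have "\<dots> \<le> sum f (set xs) + \<theta> * (\<epsilon> * n / L)"
      using tail \<theta> L by (intro add_left_mono mult_left_mono divide_right_mono) auto
    finally show ?thesis .
  qed
  have "draws w m I (\<lambda>xs. of_bool (c + \<epsilon> * n / L \<le> (\<Sum>i\<in>set xs. if w i \<le> T then 0 else (w i)\<^sup>2)))
      \<le> draws w m I (\<lambda>xs. exp (- \<theta> * c) * exp (sum f (set xs)))"
  proof (rule draws_mono[OF pos])
    fix xs assume xs: "set xs \<subseteq> I"
    have "1 \<le> exp (- \<theta> * c) * exp (sum f (set xs))"
      if "c + \<epsilon> * n / L \<le> (\<Sum>i\<in>set xs. if w i \<le> T then 0 else (w i)\<^sup>2)"
    proof -
      have "\<theta> * (c + \<epsilon> * n / L) \<le> \<theta> * (\<Sum>i\<in>set xs. if w i \<le> T then 0 else (w i)\<^sup>2)"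
        using that \<theta>(1) by (rule mult_left_mono)
      also have "\<dots> = (\<Sum>i\<in>set xs. if w i \<le> T then 0 else \<theta> * (w i)\<^sup>2)"
        by (simp add: sum_distrib_left if_distrib cong: if_cong)
      finally have "0 \<le> - \<theta> * c + sum f (set xs)" using rest[OF xs] by (simp add: algebra_simps)
      thus ?thesis by (simp add: exp_add[symmetric])
    qed
    thus "of_bool (c + \<epsilon> * n / L \<le> (\<Sum>i\<in>set xs. if w i \<le> T then 0 else (w i)\<^sup>2))
        \<le> exp (- \<theta> * c) * exp (sum f (set xs))" by auto
  qed
  also have "\<dots> = exp (- \<theta> * c) * draws w m I (\<lambda>xs. exp (sum f (set xs)))" by (rule draws_cmult)
  also have "\<dots> \<le> exp (- \<theta> * c) * exp (m * (\<theta> * (8 * \<epsilon> / a)))"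
    using avgexp by (intro mult_left_mono draws_exp_sum_le[OF pos mc]) auto
  also have "\<dots> = exp (- \<theta> * c + m * (\<theta> * (8 * \<epsilon> / a)))" by (simp only: exp_add)
  finally show ?B .
qed


lemma draws_take_concentration:
  fixes F z L :: real
  assumes "k \<le> m" "m \<le> n" "0 \<le> t" "mass w (\<lambda>_. 1) I t = n - k"
    "\<And>i. i \<in> I \<Longrightarrow> 0 \<le> f i \<and> f i \<le> F" "0 < F" "0 < z" "1 \<le> L" "mvar w I t \<le> L * z"
  shows "draws w m I (\<lambda>xs. of_bool (2 * F * z \<le> \<bar>sum f (I - set (take k xs)) - mass w f I t\<bar>))
    \<le> 4 * exp (- z / (8 * L))"
proof -
  have "draws w m I (\<lambda>xs. of_bool (2 * F * z \<le> \<bar>sum f (I - set (take k xs)) - mass w f I t\<bar>))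
      = draws w k I (\<lambda>xs. of_bool (2 * F * z \<le> \<bar>sum f (I - set xs) - mass w f I t\<bar>))"
    by (rule draws_take[OF pos]) (use assms in auto)
  also have "\<dots> \<le> 4 * exp (- z / (8 * L))"
    by (rule draws_concentration[OF pos]) (use assms in auto)
  finally show ?thesis .
qed

lemma draws_window_sum:
  assumes "j \<le> m" "m \<le> n"
  shows "draws w m I (window_sum w i j)
    = (\<Sum>k=i..<j. draws w m I (\<lambda>xs. avg w w (I - set (take k xs))))"
proof -
  have "draws w m I (window_sum w i j) = (\<Sum>k=i..<j. draws w m I (\<lambda>xs. w (xs ! k)))"
    unfolding window_sum_def[abs_def] by (rule draws_sum)
  also have "\<dots> = (\<Sum>k=i..<j. draws w m I (\<lambda>xs. avg w w (I - set (take k xs))))"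
  proof (rule sum.cong[OF refl])
    fix k assume "k \<in> {i..<j}"
    hence "k < m" using assms by simp
    thus "draws w m I (\<lambda>xs. w (xs ! k)) = draws w m I (\<lambda>xs. avg w w (I - set (take k xs)))"
      using draws_nth[OF pos, of k m w] draws_take[OF pos, of k m "\<lambda>xs. avg w w (I - set xs)"] assms by simp
  qed
  finally show ?thesis .
qed

text \<open>\<open>B\<close> depends on \<open>a\<close> and \<open>C\<close> only, so it can be
  fixed before \<open>K\<close>. The constant \<open>K\<close> enters through \<open>T\<close>,
  \<open>L\<close>, \<open>\<gamma>\<close> and \<open>\<epsilon>\<close>, whose effect is confined
  to terms below exp (- y / u). A window from l to m has m - l + 1 draws, whence the factor 2 in
  front of \<open>h\<close>.\<close>

lemma bulk_window:
  fixes y K T \<epsilon> \<zeta> u h :: real and p m :: nat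
  defines "L \<equiv> 1 + 512 * K * T\<^sup>2 / a"
  defines "\<gamma> \<equiv> a / (4096 * T\<^sup>2 * L)"
  defines "B \<equiv> 1 + 128 * C / a"
  assumes pm: "p \<le> m" "2 * m \<le> n" and h: "1 \<le> h" "real (m - p) \<le> 2 * h" "h \<le> m"
    and y: "0 < y" and K: "1 \<le> K" "m * h \<le> K * y * n"
    and T: "1 \<le> T" "b \<le> T" "2 * C * exp (2 * b / a) / a \<le> T"
    and tail: "(\<Sum>i\<in>I. if w i \<le> T then 0 else (w i)^3) \<le> \<epsilon> * n"
    and \<epsilon>: "0 \<le> \<epsilon>" "8192 * K * \<epsilon> \<le> a\<^sup>2" "512 * K * \<epsilon> \<le> a"
    and \<zeta>: "0 < \<zeta>" "\<zeta> \<le> 1" "1024 * \<zeta> \<le> a" and u: "0 < u" "\<And>i. i \<in> I \<Longrightarrow> w i \<le> \<zeta> * u"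
    and small: "8 * n * exp (- (\<gamma> * y)) \<le> exp (- (y / u))" "2048 * T * C * n * exp (- (\<gamma> * y)) \<le> a * y"
  shows "draws w m I (\<lambda>xs. of_bool (\<exists>i j. p \<le> i \<and> i \<le> j \<and> j \<le> m \<and>
      y \<le> \<bar>window_sum w i j xs - draws w m I (window_sum w i j)\<bar>))
    \<le> 2 * exp (- y\<^sup>2 / (16 * B * (y * u + h))) + 2 * exp (- (y / u))"
proof -
  have a0: "0 < a" and b0: "0 < b" using ab by auto
  have mn: "m \<le> n" using pm by simp
  have m0: "0 < real m" using h by linarith
  have n0: "0 < real n" using n by simp
  have an: "0 < a * n" using a0 n0 by simp
  have hn: "h \<le> n" using h mn by linarith
  have L1: "1 \<le> L" using K a0 by (simp add: L_def)
  \<comment> \<open>The accuracy needed per draw: an error \<rho> in each of \<open>h\<close>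
    conditional means adds up to \<open>y\<close>.\<close>
  define \<rho> where "\<rho> = y / h"
  have \<rho>: "0 < \<rho>" "\<rho> * h = y" using y h by (auto simp: \<rho>_def)
  have \<rho>n: "y \<le> \<rho> * n" using mult_left_mono[OF hn, of \<rho>] \<rho> by simp
  have \<rho>m: "y \<le> \<rho> * m" using mult_left_mono[OF h(3), of \<rho>] \<rho> by simp
  \<comment> \<open>The condition m (m - l) = O(y n) in the form in which it acts: the number of
    dead elements, hence the variance of the count, is of order \<rho> n.\<close>
  have mK: "m \<le> K * (\<rho> * n)"
  proof -
    have "m * h \<le> K * (\<rho> * n) * h" using K(2) \<rho>(2) by (metis mult.assoc mult.commute)
    thus ?thesis using h(1) by simp
  qed
  define \<epsilon>\<^sub>0 where "\<epsilon>\<^sub>0 = \<rho> * a * n / 256"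
  \<comment> \<open>The tolerance \<open>\<epsilon>\<^sub>0\<close> is such that four such errors,
    multiplied by 4 / (a n), amount to \<rho> / 16. In turn \<open>z\<close> makes the deviation 2 F
    z equal to \<open>\<epsilon>\<^sub>0\<close> for squares, where F = T^2, and to
    \<open>\<epsilon>\<^sub>0 / T\<close> for weights, where F = T.\<close>
  define z where "z = \<epsilon>\<^sub>0 / (2 * T\<^sup>2)"
  have e0: "0 < \<epsilon>\<^sub>0" using \<rho> an by (simp add: \<epsilon>\<^sub>0_def mult.assoc)
  have z0: "0 < z" using e0 T by (simp add: z_def)
  have Lz: "m \<le> L * z"
  proof -
    have "512 * K * T\<^sup>2 / a * z = K * (\<rho> * n)" using T a0 by (simp add: z_def \<epsilon>\<^sub>0_def field_simps)
    thus ?thesis using mK z0 by (simp add: L_def algebra_simps)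
  qed
  have expz: "exp (- z / (8 * L)) \<le> exp (- (\<gamma> * y))"
  proof -
    have "z / (8 * L) = \<gamma> * (\<rho> * n)" by (simp add: z_def \<epsilon>\<^sub>0_def \<gamma>_def field_simps)
    moreover have "\<gamma> * y \<le> \<gamma> * (\<rho> * n)" using \<rho>n a0 L1 by (intro mult_left_mono) (auto simp: \<gamma>_def)
    ultimately show ?thesis by simp
  qed
  define E where "E = exp (- (\<gamma> * y))"
  define low1 where "low1 i = (if w i \<le> T then w i else 0)" for i
  define low2 where "low2 i = (if w i \<le> T then (w i)\<^sup>2 else 0)" for i
  define dead where "dead xs = (\<Sum>i\<in>set xs. if w i \<le> T then 0 else (w i)\<^sup>2)" for xs
  have dead_nonneg: "0 \<le> dead xs" for xs unfolding dead_def by (intro sum_nonneg) auto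
  have low1: "0 \<le> low1 i \<and> low1 i \<le> T" if "i \<in> I" for i
    using wpos[OF that] T by (auto simp: low1_def)
  have low2: "0 \<le> low2 i \<and> low2 i \<le> T\<^sup>2" if "i \<in> I" for i
    using wpos[OF that] T by (auto simp: low2_def power_mono)
  have "\<forall>k\<in>{..<m}. \<exists>t. 0 \<le> t \<and> mass w (\<lambda>_. 1) I t = n - k"
  proof
    fix k assume "k \<in> {..<m}"
    hence "k < n" using mn by simp
    then obtain t where "0 \<le> t" "mass w (\<lambda>_. 1) I t = n - k" by (rule ex_time)
    thus "\<exists>t. 0 \<le> t \<and> mass w (\<lambda>_. 1) I t = n - k" by blast
  qed
  then obtain tm where tm: "\<And>k. k < m \<Longrightarrow> 0 \<le> tm k \<and> mass w (\<lambda>_. 1) I (tm k) = n - k"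
    using bchoice[of "{..<m}"] by (metis lessThan_iff)
  define f1 where "f1 k = mass w low1 I (tm k)" for k
  define f2 where "f2 k = mass w low2 I (tm k)" for k
  define q1 where "q1 = (\<Sum>i\<in>I. if w i \<le> T then 0 else w i)"
  define q2 where "q2 = (\<Sum>i\<in>I. if w i \<le> T then 0 else (w i)\<^sup>2)"
  define r where "r k = (f2 k + q2) / (f1 k + q1)" for k
  have q: "0 \<le> q1" "0 \<le> q2" unfolding q1_def q2_def using wnonneg by (auto intro!: sum_nonneg)
  have mass_low: "0 \<le> mass w f I t \<and> mass w f I t \<le> sum f I"
    if "0 \<le> t" "\<And>i. i \<in> I \<Longrightarrow> 0 \<le> f i" for f t
    using mass_nonneg[of I f w t] mass_antimono[OF pos, of f 0 t] that by (simp add: mass_zero)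
  \<comment> \<open>In the first half the clock time is at most 2/a, so the mass of the bounded
    weights stays of order n and the ratio stays bounded. The third lower bound on \<open>T\<close>
    is this bound.\<close>
  have r: "0 \<le> r k" "r k \<le> T" "r k * (f1 k + q1) = f2 k + q2" if k: "k < m" for k
  proof -
    have f20: "0 \<le> f2 k" "f2 k \<le> sum low2 I"
      using mass_low[of "tm k" low2] tm[OF k] low2 by (auto simp: f2_def)
    have "f1 k = mass w w {i\<in>I. w i \<le> T} (tm k)"
      unfolding f1_def low1_def[abs_def] by (rule mass_if) simp
    moreover have "a * n / 2 * exp (- (b * tm k)) \<le> mass w w {i\<in>I. w i \<le> T} (tm k)"
      using tm[OF k] T by (intro sum_middle_ge) auto
    moreover have "exp (- (2 * b / a)) \<le> exp (- (b * tm k))"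
    proof -
      have "tm k \<le> 2 / a" by (rule time_le[of k]) (use tm[OF k] k pm in auto)
      hence "b * tm k \<le> b * (2 / a)" using b0 by (intro mult_left_mono) auto
      thus ?thesis by (simp add: mult.commute)
    qed
    ultimately have f1: "a * n / 2 * exp (- (2 * b / a)) \<le> f1 k"
      using mult_left_mono[of "exp (- (2 * b / a))" "exp (- (b * tm k))" "a * n / 2"] an by linarith
    have pos1: "0 < a * n / 2 * exp (- (2 * b / a))" using an by simp
    show "0 \<le> r k" using f20 q f1 pos1 by (simp add: r_def)
    show "r k * (f1 k + q1) = f2 k + q2" using f1 pos1 q by (simp add: r_def)
    have "sum low2 I + q2 = (\<Sum>i\<in>I. (w i)\<^sup>2)"
      by (simp add: q2_def low2_def sum.distrib[symmetric] if_distrib cong: if_cong)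
    hence "f2 k + q2 \<le> C * n" using moments(2) f20 by simp
    hence "r k \<le> (C * n) / (a * n / 2 * exp (- (2 * b / a)))"
      unfolding r_def using f1 q pos1 C n by (intro frac_le) auto
    also have "\<dots> = 2 * C * exp (2 * b / a) / a" using n0 a0 by (simp add: exp_minus field_simps)
    finally show "r k \<le> T" using T(3) by linarith
  qed
  define d1 where "d1 k xs = \<bar>sum low1 (I - set (take k xs)) - f1 k\<bar>" for k xs
  define d2 where "d2 k xs = \<bar>sum low2 (I - set (take k xs)) - f2 k\<bar>" for k xs
  define R where "R k xs = avg w w (I - set (take k xs))" for k and xs :: "nat list"
  have dev: "\<bar>R k xs - r k\<bar> \<le> 4 / (a * n) * (d2 k xs + T * d1 k xs + 2 * dead xs)"
    if xs: "length xs = m" "distinct xs" "set xs \<subseteq> I" and k: "k < m" for k xs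
  proof -
    have k': "k \<le> m" and T0: "0 < T" using k T by auto
    show ?thesis
      using ratio_bulk[OF xs k' pm(2) T0 r(1,2)[OF k], of "f1 k" "f2 k"] r(3)[OF k]
      by (simp add: R_def d1_def d2_def dead_def low1_def[abs_def] low2_def[abs_def] q1_def q2_def)
  qed
  have P1: "draws w m I (\<lambda>xs. of_bool (\<epsilon>\<^sub>0 / T \<le> d1 k xs)) \<le> 4 * E" if k: "k < m" for k
  proof -
    have "mvar w I (tm k) \<le> L * z"
      using mvar_le_dead[OF pos, of "tm k"] tm[OF k] k Lz mn by (simp add: of_nat_diff)
    hence A: "draws w m I (\<lambda>xs. of_bool (2 * T * z \<le> \<bar>sum low1 (I - set (take k xs)) - mass w low1 I (tm k)\<bar>))
        \<le> 4 * exp (- z / (8 * L))"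
      using tm[OF k] low1 T z0 L1 k mn by (intro draws_take_concentration) auto
    have eq: "2 * T * z = \<epsilon>\<^sub>0 / T" using T by (simp add: z_def power2_eq_square)
    have "4 * exp (- z / (8 * L)) \<le> 4 * E" using expz unfolding E_def by linarith
    from order_trans[OF A this] show ?thesis unfolding eq d1_def f1_def .
  qed
  have P2: "draws w m I (\<lambda>xs. of_bool (\<epsilon>\<^sub>0 \<le> d2 k xs)) \<le> 4 * E" if k: "k < m" for k
  proof -
    have "mvar w I (tm k) \<le> L * z"
      using mvar_le_dead[OF pos, of "tm k"] tm[OF k] k Lz mn by (simp add: of_nat_diff)
    hence A: "draws w m I (\<lambda>xs. of_bool (2 * T\<^sup>2 * z \<le> \<bar>sum low2 (I - set (take k xs)) - mass w low2 I (tm k)\<bar>))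
        \<le> 4 * exp (- z / (8 * L))"
      using tm[OF k] low2 T z0 L1 k mn by (intro draws_take_concentration) auto
    have eq: "2 * T\<^sup>2 * z = \<epsilon>\<^sub>0" using T by (simp add: z_def)
    have "4 * exp (- z / (8 * L)) \<le> 4 * E" using expz unfolding E_def by linarith
    from order_trans[OF A this] show ?thesis unfolding eq d2_def f2_def .
  qed
  have em: "\<epsilon> * m \<le> \<epsilon>\<^sub>0 / 2" "8 * \<epsilon> * m / a \<le> \<epsilon>\<^sub>0 / 4"
  proof -
    have e1: "\<epsilon> * m \<le> \<epsilon> * (K * (\<rho> * n))" using mK \<epsilon> by (intro mult_left_mono) auto
    also have "\<dots> = (512 * K * \<epsilon>) * (\<rho> * n / 512)" by simp
    also have "\<dots> \<le> a * (\<rho> * n / 512)" using \<epsilon>(3) \<rho> by (intro mult_right_mono) auto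
    finally show "\<epsilon> * m \<le> \<epsilon>\<^sub>0 / 2" by (simp add: \<epsilon>\<^sub>0_def mult_ac)
    have "\<epsilon> * m \<le> (8192 * K * \<epsilon>) * (\<rho> * n / 8192)" using e1 by (simp add: mult_ac)
    also have "\<dots> \<le> a\<^sup>2 * (\<rho> * n / 8192)" using \<epsilon>(2) \<rho> by (intro mult_right_mono) auto
    finally show "8 * \<epsilon> * m / a \<le> \<epsilon>\<^sub>0 / 4" using a0 by (simp add: \<epsilon>\<^sub>0_def field_simps power2_eq_square)
  qed
  \<comment> \<open>With the cut-off L = n/m the deterministic part \<epsilon> n / L is \<epsilon>
    m. For w <= n/m and w <= \<zeta> u this is the largest \<theta> that guarantees \<theta> w^2 <=
    1; small \<zeta> makes it large.\<close>
  define \<theta> where "\<theta> = m / (\<zeta> * u * n)"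
  have \<theta>0: "0 < \<theta>" using m0 \<zeta> u n0 by (simp add: \<theta>_def)
  have Lm: "0 < real n / m" using m0 n0 by simp
  have \<theta>w: "\<theta> * (w i)\<^sup>2 \<le> 1" if i: "i \<in> I" "w i \<le> real n / m" for i
  proof -
    have "\<theta> * (w i * w i) \<le> \<theta> * ((\<zeta> * u) * (real n / m))"
      using i u(2) wpos[OF i(1)] \<theta>0 \<zeta> u(1) by (intro mult_left_mono mult_mono) auto
    also have "\<dots> = 1" using m0 \<zeta> u n0 by (simp add: \<theta>_def)
    finally show ?thesis by (simp add: power2_eq_square)
  qed
  have Edead: "draws w m I dead \<le> \<epsilon>\<^sub>0 / 8"
  proof -
    have "draws w m I dead \<le> m * (4 * \<epsilon> / a)"
      unfolding dead_def[abs_def]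
      by (rule heavy_dead_bulk(1)[OF pm(2) less_imp_le[OF \<theta>0] _ Lm tail]) (rule \<theta>w)
    also have "\<dots> = (8 * \<epsilon> * m / a) / 2" by simp
    also have "\<dots> \<le> (\<epsilon>\<^sub>0 / 4) / 2" by (rule divide_right_mono[OF em(2)]) simp
    finally show ?thesis by simp
  qed
  have PH: "draws w m I (\<lambda>xs. of_bool (\<epsilon>\<^sub>0 \<le> dead xs)) \<le> exp (- (y / u))"
  proof -
    have "draws w m I (\<lambda>xs. of_bool (\<epsilon>\<^sub>0 \<le> dead xs))
        \<le> draws w m I (\<lambda>xs. of_bool (\<epsilon>\<^sub>0 / 2 + \<epsilon> * n / (real n / m) \<le> dead xs))"
      using em(1) n0 by (intro draws_mono[OF pos]) auto
    also have "\<dots> \<le> exp (- \<theta> * (\<epsilon>\<^sub>0 / 2) + m * (\<theta> * (8 * \<epsilon> / a)))"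
      unfolding dead_def
      by (rule heavy_dead_bulk(2)[OF pm(2) less_imp_le[OF \<theta>0] _ Lm tail]) (rule \<theta>w)
    also have "\<dots> \<le> exp (- (y / u))"
    proof -
      have "m * (\<theta> * (8 * \<epsilon> / a)) = \<theta> * (8 * \<epsilon> * m / a)" by simp
      also have "\<dots> \<le> \<theta> * (\<epsilon>\<^sub>0 / 4)" using em(2) \<theta>0 by (intro mult_left_mono) auto
      finally have "- \<theta> * (\<epsilon>\<^sub>0 / 2) + m * (\<theta> * (8 * \<epsilon> / a)) \<le> - (\<theta> * \<epsilon>\<^sub>0 / 4)" by simp
      moreover have "y / u \<le> \<theta> * \<epsilon>\<^sub>0 / 4"
      proof -
        have "y / u \<le> (\<rho> * m) / u * 1" using \<rho>m u by (simp add: divide_right_mono)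
        also have "\<dots> \<le> (\<rho> * m) / u * (a / (1024 * \<zeta>))"
          using \<zeta> \<rho> u by (intro mult_left_mono) auto
        also have "\<dots> = \<theta> * \<epsilon>\<^sub>0 / 4" using n0 by (simp add: \<theta>_def \<epsilon>\<^sub>0_def mult_ac)
        finally show ?thesis .
      qed
      ultimately show ?thesis by simp
    qed
    finally show ?thesis .
  qed
  \<comment> \<open>Always true along the path, since at most n/2 elements are drawn. It gives the
    variance bound 4 C / a.\<close>
  define G where "G S \<longleftrightarrow> n \<le> 2 * card S" for S :: "nat set"
  \<comment> \<open>The usual Bernstein choice. \<open>w \<le> u\<close> gives \<theta>' w <= 1, and
    the factor 128 in \<open>B\<close> makes the quadratic term at most half of the linear term
    \<theta>' y / 8.\<close>
  define \<theta>' where "\<theta>' = y / (B * (y * u + h))"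
  have B0: "0 < B" "1 \<le> B" "128 * C / a \<le> B" using C a0 by (auto simp: B_def add_pos_nonneg)
  have yuh: "0 < y * u + h" "y * u \<le> y * u + h" "h \<le> y * u + h" using y u h by (auto simp: add_pos_nonneg)
  have \<theta>'0: "0 < \<theta>'" using y B0 yuh by (simp add: \<theta>'_def)
  define EM where "EM xs \<longleftrightarrow> (\<exists>s\<in>{p..m}. (\<forall>k\<in>{p..<s}. G (I - set (take k xs))) \<and>
      y / 8 \<le> \<bar>\<Sum>k=p..<s. w (xs ! k) - avg w w (I - set (take k xs))\<bar>)" for xs
  have PM: "draws w m I (\<lambda>xs. of_bool (EM xs)) \<le> 2 * exp (- y\<^sup>2 / (16 * B * (y * u + h)))"
  proof -
    have "draws w m I (\<lambda>xs. of_bool (EM xs))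
        \<le> 2 * exp (- \<theta>' * (y / 8) + real (m - p) * (\<theta>'\<^sup>2 * (4 * C / a)))"
      unfolding EM_def
    proof (rule draws_window_martingale[OF pos pm(1)])
      fix S x assume S: "S \<subseteq> I" "x \<in> S"
      have "\<theta>' * w x \<le> \<theta>' * (1 * u)"
      proof (rule mult_left_mono)
        have "w x \<le> \<zeta> * u" using S by (intro u(2)) auto
        also have "\<dots> \<le> 1 * u" using \<zeta> u(1) by (intro mult_right_mono) auto
        finally show "w x \<le> 1 * u" .
      qed (use \<theta>'0 in auto)
      also have "\<dots> = (y * u) / (B * (y * u + h))" by (simp add: \<theta>'_def)
      also have "\<dots> \<le> 1"
      proof -
        have "1 * (y * u + h) \<le> B * (y * u + h)" using B0 yuh by (intro mult_right_mono) auto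
        hence "y * u \<le> B * (y * u + h)" using order_trans[OF yuh(2)] by simp
        thus ?thesis using B0 yuh by (simp add: divide_le_eq_1)
      qed
      finally show "\<theta>' * w x \<le> 1" .
    next
      fix S assume "S \<subseteq> I" "G S"
      thus "avg w (\<lambda>y. (w y)\<^sup>2) S \<le> 4 * C / a" by (intro avg_square_le_of_large) (auto simp: G_def)
    qed (use mn \<theta>'0 C a0 in auto)
    also have "- \<theta>' * (y / 8) + real (m - p) * (\<theta>'\<^sup>2 * (4 * C / a)) \<le> - y\<^sup>2 / (16 * B * (y * u + h))"
    proof -
      have "real (m - p) * (\<theta>'\<^sup>2 * (4 * C / a)) \<le> (2 * (y * u + h)) * (\<theta>'\<^sup>2 * (B / 32))"
        using h(2) yuh B0 \<theta>'0 C a0 by (intro mult_mono) auto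
      also have "\<dots> = \<theta>' * ((\<theta>' * (B * (y * u + h))) / 16)" by (simp add: power2_eq_square)
      also have "\<theta>' * (B * (y * u + h)) = y" unfolding \<theta>'_def using B0(1) yuh(1) by simp
      finally have "- \<theta>' * (y / 8) + real (m - p) * (\<theta>'\<^sup>2 * (4 * C / a)) \<le> - (\<theta>' * y / 16)" by simp
      also have "\<dots> = - y\<^sup>2 / (16 * B * (y * u + h))" by (simp add: \<theta>'_def power2_eq_square)
      finally show ?thesis .
    qed
    hence "2 * exp (- \<theta>' * (y / 8) + real (m - p) * (\<theta>'\<^sup>2 * (4 * C / a))) \<le> 2 * exp (- y\<^sup>2 / (16 * B * (y * u + h)))"
      by simp
    finally show ?thesis .
  qed
  \<comment> \<open>The expectation of a draw is close to \<open>r k\<close> as well: the deviations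
    of the bounded sums never exceed C n and are rarely above tolerance, while the heavy part is
    small in the mean.\<close>
  have ER: "\<bar>draws w m I (R k) - r k\<bar> \<le> \<rho> / 16" if k: "k < m" for k
  proof -
    have split: "draws w m I D \<le> c + M * draws w m I (\<lambda>xs. of_bool (c \<le> D xs))"
      if "0 \<le> c" "0 \<le> M" "\<And>xs. set xs \<subseteq> I \<Longrightarrow> D xs \<le> M" for D c M
    proof -
      have "draws w m I D \<le> draws w m I (\<lambda>xs. c + M * of_bool (c \<le> D xs))"
        using that by (intro draws_mono[OF pos]) (auto simp: add_increasing)
      also have "\<dots> = c + M * draws w m I (\<lambda>xs. of_bool (c \<le> D xs))"
        using draws_const[OF pos, of m c] mn by (simp add: draws_add draws_cmult)
      finally show ?thesis .
    qed
    have dle: "\<bar>sum f (I - set (take k xs)) - mass w f I (tm k)\<bar> \<le> C * n"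
      if "\<And>i. i \<in> I \<Longrightarrow> 0 \<le> f i" "sum f I \<le> C * n" for f and xs :: "nat list"
    proof -
      have "0 \<le> sum f (I - set (take k xs))" using that by (intro sum_nonneg) auto
      moreover have "sum f (I - set (take k xs)) \<le> sum f I" using that by (intro sum_mono2) auto
      moreover have "0 \<le> mass w f I (tm k) \<and> mass w f I (tm k) \<le> sum f I"
        using that tm[OF k] by (intro mass_low) auto
      ultimately show ?thesis using that(2) by linarith
    qed
    have "sum low1 I \<le> (\<Sum>i\<in>I. w i)" using wnonneg by (intro sum_mono) (auto simp: low1_def)
    hence l1: "sum low1 I \<le> C * n" using moments(1) by simp
    have "sum low2 I \<le> (\<Sum>i\<in>I. (w i)\<^sup>2)" by (intro sum_mono) (auto simp: low2_def)
    hence l2: "sum low2 I \<le> C * n" using moments(2) by simp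
    have Cn: "0 \<le> C * n" using C by simp
    have "draws w m I (d1 k) \<le> \<epsilon>\<^sub>0 / T + C * n * draws w m I (\<lambda>xs. of_bool (\<epsilon>\<^sub>0 / T \<le> d1 k xs))"
      using e0 T Cn dle[of low1] low1 l1 by (intro split) (auto simp: d1_def f1_def)
    also have "\<dots> \<le> \<epsilon>\<^sub>0 / T + C * n * (4 * E)"
      using P1[OF k] Cn by (intro add_left_mono mult_left_mono) auto
    finally have "T * draws w m I (d1 k) \<le> T * (\<epsilon>\<^sub>0 / T + C * n * (4 * E))"
      using T by (intro mult_left_mono) auto
    hence D1: "T * draws w m I (d1 k) \<le> \<epsilon>\<^sub>0 + 4 * (T * C * n * E)" using T by (simp add: algebra_simps)
    have "draws w m I (d2 k) \<le> \<epsilon>\<^sub>0 + C * n * draws w m I (\<lambda>xs. of_bool (\<epsilon>\<^sub>0 \<le> d2 k xs))"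
      using e0 Cn dle[of low2] low2 l2 by (intro split) (auto simp: d2_def f2_def)
    also have "\<dots> \<le> \<epsilon>\<^sub>0 + C * n * (4 * E)"
      using P2[OF k] Cn by (intro add_left_mono mult_left_mono) auto
    also have "\<dots> \<le> \<epsilon>\<^sub>0 + T * (C * n * (4 * E))"
      using T mult_right_mono[of 1 T "C * n * (4 * E)"] Cn by (simp add: E_def)
    finally have D2: "draws w m I (d2 k) \<le> \<epsilon>\<^sub>0 + 4 * (T * C * n * E)" by (simp add: mult_ac)
    have "\<bar>draws w m I (R k) - r k\<bar> \<le> draws w m I (\<lambda>xs. \<bar>R k xs - r k\<bar>)"
    proof -
      have "draws w m I (R k) - r k = draws w m I (\<lambda>xs. R k xs - r k)"
        using draws_const[OF pos, of m "r k"] mn by (simp add: draws_diff)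
      moreover have "draws w m I (\<lambda>xs. R k xs - r k) \<le> draws w m I (\<lambda>xs. \<bar>R k xs - r k\<bar>)"
        by (rule draws_mono[OF pos]) auto
      moreover have "draws w m I (\<lambda>xs. (-1) * (R k xs - r k)) \<le> draws w m I (\<lambda>xs. \<bar>R k xs - r k\<bar>)"
        by (rule draws_mono[OF pos]) auto
      ultimately show ?thesis unfolding draws_cmult by linarith
    qed
    also have "\<dots> \<le> draws w m I (\<lambda>xs. 4 / (a * n) * (d2 k xs + T * d1 k xs + 2 * dead xs))"
      by (rule draws_mono[OF pos dev[OF _ _ _ k]])
    also have "\<dots> = 4 / (a * n) * (draws w m I (d2 k) + T * draws w m I (d1 k) + 2 * draws w m I dead)"
      by (simp only: draws_cmult draws_add)
    also have "\<dots> \<le> 4 / (a * n) * (9 / 4 * \<epsilon>\<^sub>0 + 8 * (T * C * n * E))"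
      using D1 D2 Edead an by (intro mult_left_mono) auto
    also have "\<dots> \<le> 4 / (a * n) * (9 / 4 * \<epsilon>\<^sub>0 + \<epsilon>\<^sub>0)"
    proof (intro mult_left_mono add_left_mono)
      have "2048 * (T * C * n * E) \<le> a * y" using small(2) by (simp add: E_def)
      also have "\<dots> \<le> a * (\<rho> * n)" using \<rho>n a0 by (intro mult_left_mono) auto
      finally show "8 * (T * C * n * E) \<le> \<epsilon>\<^sub>0" by (simp add: \<epsilon>\<^sub>0_def mult_ac)
    qed (use an in auto)
    also have "\<dots> = 13 / 256 * \<rho>" using a0 n0 by (simp add: \<epsilon>\<^sub>0_def)
    also have "\<dots> \<le> \<rho> / 16" using \<rho> by simp
    finally show ?thesis .
  qed
  \<comment> \<open>This cost occurs twice, once for the path and once for the expectation. With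
    twice y/8 from the martingale the total is y/2, below the level \<open>y\<close>.\<close>
  have mp: "real (m - p) * (\<rho> / 16) \<le> y / 8"
    using mult_right_mono[OF h(2), of "\<rho> / 16"] \<rho> by (simp add: mult.commute)
  define bad where "bad xs \<longleftrightarrow> EM xs \<or> \<epsilon>\<^sub>0 \<le> dead xs \<or> (\<exists>k\<in>{p..<m}. \<epsilon>\<^sub>0 / T \<le> d1 k xs \<or> \<epsilon>\<^sub>0 \<le> d2 k xs)" for xs
  have good: "\<bar>window_sum w i j xs - draws w m I (window_sum w i j)\<bar> < y"
    if xs: "length xs = m" "distinct xs" "set xs \<subseteq> I" and nb: "\<not> bad xs" and ij: "p \<le> i" "i \<le> j" "j \<le> m"
    for xs i j
  proof -
    define x where "x k = (if k < m then w (xs ! k) else 0)" for k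
    have x_eq: "(\<Sum>k=s..<t. x k) = (\<Sum>k=s..<t. w (xs ! k))" if "t \<le> m" for s t
      using that by (intro sum.cong) (auto simp: x_def)
    have dvn: "\<bar>(\<Sum>k=i..<j. x k) - (\<Sum>k\<in>{i..<j} \<inter> {..<m}. r k)\<bar> \<le> 2 * (y / 8) + real (m - p) * (\<rho> / 16) + 0"
    proof (rule window_deviation[OF pm(1) ij, where R = "\<lambda>k. R k xs"])
      fix s assume s: "s \<in> {p..m}"
      have "G (I - set (take k xs))" if "k \<in> {p..<s}" for k
        using card_minus_take[OF xs, of k] that s pm(2) by (auto simp: G_def)
      hence "\<not> y / 8 \<le> \<bar>\<Sum>k=p..<s. w (xs ! k) - avg w w (I - set (take k xs))\<bar>"
        using nb s unfolding bad_def EM_def by blast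
      moreover have "(\<Sum>k=p..<s. x k - R k xs) = (\<Sum>k=p..<s. w (xs ! k) - avg w w (I - set (take k xs)))"
        using s by (intro sum.cong) (auto simp: x_def R_def)
      ultimately show "\<bar>\<Sum>k=p..<s. x k - R k xs\<bar> \<le> y / 8" by simp
    next
      fix k assume k: "k \<in> {p..<m}"
      have "d1 k xs \<le> \<epsilon>\<^sub>0 / T" "d2 k xs \<le> \<epsilon>\<^sub>0" "dead xs \<le> \<epsilon>\<^sub>0"
        using nb k unfolding bad_def by force+
      moreover have "T * d1 k xs \<le> T * (\<epsilon>\<^sub>0 / T)" using T calculation(1) by (intro mult_left_mono) auto
      ultimately have "d2 k xs + T * d1 k xs + 2 * dead xs \<le> 4 * \<epsilon>\<^sub>0" using T by simp
      hence "4 / (a * n) * (d2 k xs + T * d1 k xs + 2 * dead xs) \<le> 4 / (a * n) * (4 * \<epsilon>\<^sub>0)"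
        using an by (intro mult_left_mono) auto
      also have "\<dots> = \<rho> / 16" using a0 n0 by (simp add: \<epsilon>\<^sub>0_def)
      finally have "4 / (a * n) * (d2 k xs + T * d1 k xs + 2 * dead xs) \<le> \<rho> / 16" .
      moreover have "k < m" using k by simp
      ultimately show "\<bar>R k xs - r k\<bar> \<le> \<rho> / 16" using order_trans[OF dev[OF xs]] by blast
    next
      show "0 \<le> x k" for k
        using xs wnonneg by (auto simp: x_def dest: nth_mem)
    qed (use \<rho> in auto)
    have set_eq: "{i..<j} \<inter> {..<m} = {i..<j}" using ij by auto
    have 1: "\<bar>window_sum w i j xs - (\<Sum>k=i..<j. r k)\<bar> \<le> y / 4 + y / 8"
      using dvn mp unfolding set_eq x_eq[OF ij(3)] window_sum_def by linarith
    have "\<bar>draws w m I (window_sum w i j) - (\<Sum>k=i..<j. r k)\<bar> \<le> (\<Sum>k=i..<j. \<bar>draws w m I (R k) - r k\<bar>)"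
      unfolding draws_window_sum[OF ij(3) mn] R_def[abs_def] sum_subtractf[symmetric] by (rule sum_abs)
    also have "\<dots> \<le> (\<Sum>k=i..<j. \<rho> / 16)" using ij by (intro sum_mono ER) auto
    also have "\<dots> \<le> real (m - p) * (\<rho> / 16)"
      using ij \<rho> by (simp add: mult_right_mono divide_right_mono)
    finally have "\<bar>draws w m I (window_sum w i j) - (\<Sum>k=i..<j. r k)\<bar> \<le> y / 8" using mp by linarith
    thus ?thesis using 1 y by linarith
  qed
  have "draws w m I (\<lambda>xs. of_bool (\<exists>i j. p \<le> i \<and> i \<le> j \<and> j \<le> m \<and>
      y \<le> \<bar>window_sum w i j xs - draws w m I (window_sum w i j)\<bar>))
      \<le> draws w m I (\<lambda>xs. of_bool (EM xs) + of_bool (\<epsilon>\<^sub>0 \<le> dead xs)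
        + (\<Sum>k=p..<m. of_bool (\<epsilon>\<^sub>0 / T \<le> d1 k xs) + of_bool (\<epsilon>\<^sub>0 \<le> d2 k xs)))"
  proof (rule draws_mono[OF pos])
    fix xs assume xs: "length xs = m" "distinct xs" "set xs \<subseteq> I"
    let ?s = "\<lambda>k. of_bool (\<epsilon>\<^sub>0 / T \<le> d1 k xs) + of_bool (\<epsilon>\<^sub>0 \<le> d2 k xs) :: real"
    have s0: "0 \<le> (\<Sum>k=p..<m. ?s k)" by (intro sum_nonneg) auto
    show "of_bool (\<exists>i j. p \<le> i \<and> i \<le> j \<and> j \<le> m \<and>
        y \<le> \<bar>window_sum w i j xs - draws w m I (window_sum w i j)\<bar>)
        \<le> of_bool (EM xs) + of_bool (\<epsilon>\<^sub>0 \<le> dead xs) + (\<Sum>k=p..<m. ?s k)"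
    proof (cases "bad xs")
      case False
      thus ?thesis using good[OF xs False] s0 by (auto simp: not_le[symmetric] simp del: not_le)
    next
      case True
      have "1 \<le> of_bool (EM xs) + of_bool (\<epsilon>\<^sub>0 \<le> dead xs) + (\<Sum>k=p..<m. ?s k)"
      proof (cases "EM xs \<or> \<epsilon>\<^sub>0 \<le> dead xs")
        case False
        then obtain k where k: "k \<in> {p..<m}" "\<epsilon>\<^sub>0 / T \<le> d1 k xs \<or> \<epsilon>\<^sub>0 \<le> d2 k xs"
          using True unfolding bad_def by blast
        have "?s k \<le> (\<Sum>k=p..<m. ?s k)" by (rule member_le_sum) (use k in auto)
        moreover have "1 \<le> ?s k" using k by auto
        ultimately show ?thesis by (simp add: add_increasing)
      qed (use s0 in auto)
      moreover have "of_bool Q \<le> (1 :: real)" for Q by simp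
      ultimately show ?thesis using order_trans by blast
    qed
  qed
  also have "\<dots> = draws w m I (\<lambda>xs. of_bool (EM xs)) + draws w m I (\<lambda>xs. of_bool (\<epsilon>\<^sub>0 \<le> dead xs))
        + (\<Sum>k=p..<m. draws w m I (\<lambda>xs. of_bool (\<epsilon>\<^sub>0 / T \<le> d1 k xs)) + draws w m I (\<lambda>xs. of_bool (\<epsilon>\<^sub>0 \<le> d2 k xs)))"
    by (simp only: draws_add draws_sum)
  also have "\<dots> \<le> 2 * exp (- y\<^sup>2 / (16 * B * (y * u + h))) + exp (- (y / u)) + (\<Sum>k=p..<m. 4 * E + 4 * E)"
    using P1 P2 by (intro add_mono sum_mono PM PH) auto
  also have "(\<Sum>k=p..<m. 4 * E + 4 * E) \<le> exp (- (y / u))"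
  proof -
    have "(\<Sum>k=p..<m. 4 * E + 4 * E) = 8 * real (m - p) * E" by simp
    also have "\<dots> \<le> 8 * n * E" using mn by (intro mult_right_mono) (auto simp: E_def)
    finally show ?thesis using small(1) unfolding E_def by (rule order_trans)
  qed
  finally show ?thesis by simp
qed

subsection \<open>Windows in the second half of the sample\<close>


lemma time_ge:
  assumes p: "n \<le> 4 * p" "p \<le> n" and t: "mass w (\<lambda>_. 1) I t = n - p"
  shows "1 / (4 * C) \<le> t"
proof -
  have "real p = (\<Sum>i\<in>I. 1 - survive w t i)"
    using t p(2) by (simp add: mass_def sum_subtractf of_nat_diff)
  also have "\<dots> \<le> (\<Sum>i\<in>I. w i * t)" by (intro sum_mono one_minus_survive_le)
  also have "\<dots> = t * (\<Sum>i\<in>I. w i)" by (simp add: sum_distrib_left mult.commute)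
  finally have *: "real p \<le> t * (\<Sum>i\<in>I. w i)" .
  have "0 \<le> t"
  proof (rule ccontr)
    assume "\<not> 0 \<le> t"
    hence "t * (\<Sum>i\<in>I. w i) \<le> 0" using wnonneg by (intro mult_nonpos_nonneg sum_nonneg) auto
    thus False using * p n by linarith
  qed
  hence "t * (\<Sum>i\<in>I. w i) \<le> t * (C * n)" using moments(1) by (intro mult_left_mono)
  moreover have "real n / 4 \<le> p" using p by simp
  ultimately have "n * (1 / 4) \<le> n * (t * C)" using * by (simp add: mult_ac)
  hence "1 / 4 \<le> t * C" using n by simp
  thus ?thesis using C by (simp add: field_simps)
qed

text \<open>A weight above T >= 4 b decays at rate at least b even with its exponent divided by 4,
  whereas \<open>M\<close> contains the weights between \<open>a\<close> and \<open>b\<close>, whose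
  mass decays no faster than exp (- b t). So the heavy part remains a small fraction of the mass of
  \<open>M\<close> at all times.\<close>

lemma heavy_mass_le:
  fixes T t \<epsilon> :: real
  assumes T: "1 \<le> T" "4 * b \<le> T" and t: "0 \<le> t"
    and M: "M \<subseteq> I" "\<And>i. i \<in> I \<Longrightarrow> a \<le> w i \<Longrightarrow> w i \<le> b \<Longrightarrow> i \<in> M"
    and tail: "(\<Sum>i\<in>I. if w i \<le> T then 0 else (w i)^3) \<le> \<epsilon> * n" and \<epsilon>: "0 \<le> \<epsilon>"
  shows "(\<Sum>i\<in>I \<inter> {i. T < w i}. (w i)\<^sup>2 * exp (- (w i * t / 4))) \<le> 2 * \<epsilon> / (a * T) * mass w w M t"
proof -
  have "(\<Sum>i\<in>I \<inter> {i. T < w i}. (w i)\<^sup>2 * exp (- (w i * t / 4)))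
      = (\<Sum>i\<in>I. if T < w i then (w i)\<^sup>2 * exp (- (w i * t / 4)) else 0)"
    by (subst sum.inter_restrict) auto
  also have "\<dots> \<le> (\<Sum>i\<in>I. (if w i \<le> T then 0 else (w i)^3) * (exp (- (b * t)) / T))"
  proof (rule sum_mono)
    fix i assume i: "i \<in> I"
    show "(if T < w i then (w i)\<^sup>2 * exp (- (w i * t / 4)) else 0)
        \<le> (if w i \<le> T then 0 else (w i)^3) * (exp (- (b * t)) / T)"
    proof (cases "T < w i")
      case True
      have "(w i)\<^sup>2 * T \<le> (w i)\<^sup>2 * w i" using True by (intro mult_left_mono) auto
      hence 1: "(w i)\<^sup>2 \<le> (w i)^3 / T" using T by (simp add: field_simps power2_eq_square power3_eq_cube)
      have "b \<le> w i / 4" using True T by simp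
      hence "b * t \<le> w i / 4 * t" using t by (rule mult_right_mono)
      hence "(w i)\<^sup>2 * exp (- (w i * t / 4)) \<le> (w i)^3 / T * exp (- (b * t))"
        using 1 by (intro mult_mono) (auto intro: order_trans[OF zero_le_power2])
      thus ?thesis using True by simp
    qed simp
  qed
  also have "\<dots> = (\<Sum>i\<in>I. if w i \<le> T then 0 else (w i)^3) * (exp (- (b * t)) / T)"
    by (rule sum_distrib_right[symmetric])
  also have "\<dots> \<le> \<epsilon> * n * (exp (- (b * t)) / T)" using tail T by (intro mult_right_mono) auto
  also have "\<dots> = 2 * \<epsilon> / (a * T) * (a * n / 2 * exp (- (b * t)))" using ab by simp
  also have "\<dots> \<le> 2 * \<epsilon> / (a * T) * mass w w M t"
    using \<epsilon> ab T by (intro mult_left_mono sum_middle_ge t M) auto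
  finally show ?thesis .
qed

text \<open>Elements of \<open>M\<close> die at rate above \<kappa>, so their mass falls from at
  most C n to \<kappa> within a time of order ln n. This bounds the clock times up to the cut and is
  the source of the logarithms.\<close>

lemma time_le_of_mass_ge:
  assumes \<kappa>: "0 < \<kappa>" and M: "M \<subseteq> I" "\<And>i. i \<in> M \<Longrightarrow> \<kappa> < w i" and t: "0 \<le> t" and g: "\<kappa> \<le> mass w w M t"
  shows "t \<le> ln (C * n / \<kappa>) / \<kappa>"
proof -
  have "mass w w M t \<le> (\<Sum>i\<in>M. exp (- (\<kappa> * t)) * w i)"
    unfolding mass_def
  proof (intro sum_mono mult_right_mono)
    fix i assume i: "i \<in> M"
    show "survive w t i \<le> exp (- (\<kappa> * t))"
      using M(2)[OF i] t by (auto simp: survive_def mult_right_mono)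
    show "0 \<le> w i" using M i wnonneg by auto
  qed
  also have "\<dots> = exp (- (\<kappa> * t)) * sum w M" by (simp add: sum_distrib_left)
  also have "\<dots> \<le> exp (- (\<kappa> * t)) * (C * n)"
  proof (intro mult_left_mono)
    have "sum w M \<le> sum w I" using M wnonneg by (intro sum_mono2) auto
    thus "sum w M \<le> C * n" using moments(1) by simp
  qed simp
  finally have "exp (\<kappa> * t) * mass w w M t \<le> C * n" by (simp add: exp_minus field_simps)
  moreover have "exp (\<kappa> * t) * \<kappa> \<le> exp (\<kappa> * t) * mass w w M t" using g by simp
  ultimately have "\<kappa> * exp (\<kappa> * t) \<le> C * n" by (metis order_trans mult.commute)
  hence "exp (\<kappa> * t) \<le> C * n / \<kappa>" using \<kappa> by (simp add: field_simps)
  moreover have "0 < C * n / \<kappa>" using C n \<kappa> by simp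
  ultimately have "\<kappa> * t \<le> ln (C * n / \<kappa>)" by (simp add: ln_ge_iff)
  thus ?thesis using \<kappa> by (simp add: field_simps)
qed

text \<open>In contrast to the first half, the heavy weights are not part of the approximation: few
  of them are left, and all that remains of them counts as error.\<close>

lemma ratio_end:
  fixes T e r f1 f2 :: real
  assumes S: "S \<subseteq> I" and T: "1 \<le> T" and r: "r * f1 = f2" "0 \<le> r" "r \<le> T" and f1: "0 < f1" "2 * e \<le> f1"
    and d: "\<bar>(\<Sum>i\<in>S. if w i \<le> T then (w i)\<^sup>2 else 0) - f2\<bar> \<le> e"
      "\<bar>(\<Sum>i\<in>S. if w i \<le> T then w i else 0) - f1\<bar> \<le> e / T"
      "(\<Sum>i\<in>S \<inter> {i. T < w i}. (w i)\<^sup>2) \<le> e"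
  shows "\<bar>avg w w S - r\<bar> \<le> 8 * e / f1"
proof -
  have finS: "finite S" using S finite_subset by blast
  define A1 where "A1 = (\<Sum>i\<in>S. if w i \<le> T then w i else 0)"
  define A2 where "A2 = (\<Sum>i\<in>S. if w i \<le> T then (w i)\<^sup>2 else 0)"
  define B1 where "B1 = (\<Sum>i\<in>S \<inter> {i. T < w i}. w i)"
  define B2 where "B2 = (\<Sum>i\<in>S \<inter> {i. T < w i}. (w i)\<^sup>2)"
  have split: "sum f S = (\<Sum>i\<in>S. if w i \<le> T then f i else 0) + (\<Sum>i\<in>S \<inter> {i. T < w i}. f i)"
    for f :: "nat \<Rightarrow> real"
    using finS by (simp add: sum.inter_restrict sum.distrib[symmetric]) (auto intro!: sum.cong)
  have avg: "avg w w S = (A2 + B2) / (A1 + B1)"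
    unfolding avg_def A1_def A2_def B1_def B2_def split[of w, symmetric] split[of "\<lambda>i. (w i)\<^sup>2", symmetric]
    by (simp add: power2_eq_square)
  have B2: "0 \<le> B2" "B2 \<le> e" using d(3) by (auto simp: B2_def intro: sum_nonneg)
  have e: "0 \<le> e" using B2 by simp
  have B1: "0 \<le> B1" unfolding B1_def using S wnonneg by (intro sum_nonneg) auto
  have "B1 \<le> (\<Sum>i\<in>S \<inter> {i. T < w i}. (w i)\<^sup>2 / T)"
    unfolding B1_def
  proof (rule sum_mono)
    fix i assume i: "i \<in> S \<inter> {i. T < w i}"
    have "w i * T \<le> w i * w i" using i T by (intro mult_left_mono) auto
    thus "w i \<le> (w i)\<^sup>2 / T" using T by (simp add: field_simps power2_eq_square)
  qed
  also have "\<dots> = B2 / T" by (simp add: B2_def sum_divide_distrib)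
  also have "\<dots> \<le> e / T" using B2 T by (intro divide_right_mono) auto
  finally have B1': "B1 \<le> e / T" .
  have "e / T \<le> e / 1" using T e by (intro divide_left_mono) auto
  hence N: "f1 / 2 \<le> A1 + B1" using d(2) f1(2) B1 unfolding A1_def[symmetric] by linarith
  have "\<bar>avg w w S - r\<bar> \<le> (e + T * (e / T) + 2 * e) / (A1 + B1)"
    unfolding avg
  proof (rule ratio_deviation[where ?p1.0 = f1 and ?p2.0 = f2 and ?q1.0 = 0 and ?q2.0 = 0])
    show "\<bar>A2 - f2\<bar> \<le> e" "\<bar>A1 - f1\<bar> \<le> e / T" using d by (simp_all add: A1_def A2_def)
    show "\<bar>B2 - 0\<bar> \<le> e" "\<bar>B1 - 0\<bar> \<le> e / T" using B1 B1' B2 by auto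
  qed (use T r N f1 in auto)
  also have "\<dots> \<le> (e + T * (e / T) + 2 * e) / (f1 / 2)"
    using N f1 e T by (intro divide_left_mono) auto
  also have "\<dots> = 8 * e / f1" using T by simp
  finally show ?thesis .
qed

text \<open>On the bad event each weight is split by w <= \<alpha> w^2 + 1 / (4 \<alpha>). The
  square is bounded in expectation over the whole space, so it carries no factor
  \<open>\<beta>\<close> and has to be made small through \<open>\<alpha>\<close>; the constant
  carries \<open>\<beta>\<close>.\<close>

lemma expectation_off_bad:
  fixes c D \<alpha> \<beta> :: real
  assumes ij: "i \<le> j" "j \<le> m" "m \<le> n" and c: "0 \<le> c" and D: "0 \<le> D" and \<alpha>: "0 < \<alpha>"
    and good: "\<And>xs. length xs = m \<Longrightarrow> distinct xs \<Longrightarrow> set xs \<subseteq> I \<Longrightarrow> \<not> bad xs \<Longrightarrow> \<bar>window_sum w i j xs - c\<bar> \<le> D"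
    and bad: "draws w m I (\<lambda>xs. of_bool (bad xs)) \<le> \<beta>"
  shows "\<bar>draws w m I (window_sum w i j) - c\<bar> \<le> D + real (j - i) * (\<alpha> * (4 * C / a) + \<beta> / (4 * \<alpha>)) + c * \<beta>"
proof -
  let ?Q = "window_sum w i j"
  let ?B = "\<lambda>xs. of_bool (bad xs) :: real"
  let ?U = "\<lambda>xs. D + (\<Sum>k=i..<j. \<alpha> * (w (xs ! k))\<^sup>2 + 1 / (4 * \<alpha>) * ?B xs) + c * ?B xs"
  have pt: "\<bar>?Q xs - c\<bar> \<le> ?U xs" if xs: "length xs = m" "distinct xs" "set xs \<subseteq> I" for xs
  proof (cases "bad xs")
    case False
    have "0 \<le> (\<Sum>k=i..<j. \<alpha> * (w (xs ! k))\<^sup>2)" using \<alpha> by (intro sum_nonneg) auto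
    thus ?thesis using good[OF xs False] False by simp
  next
    case True
    have w0: "0 \<le> w (xs ! k)" if "k \<in> {i..<j}" for k
    proof -
      have "xs ! k \<in> set xs" using that ij xs by (intro nth_mem) auto
      thus ?thesis using xs wnonneg by auto
    qed
    have "?Q xs \<le> (\<Sum>k=i..<j. \<alpha> * (w (xs ! k))\<^sup>2 + 1 / (4 * \<alpha>))"
      unfolding window_sum_def
    proof (rule sum_mono)
      fix k
      have "0 \<le> (2 * \<alpha> * w (xs ! k) - 1)\<^sup>2 / (4 * \<alpha>)" using \<alpha> by simp
      also have "\<dots> = \<alpha> * (w (xs ! k))\<^sup>2 + 1 / (4 * \<alpha>) - w (xs ! k)"
        using \<alpha> by (simp add: field_simps power2_eq_square)
      finally show "w (xs ! k) \<le> \<alpha> * (w (xs ! k))\<^sup>2 + 1 / (4 * \<alpha>)" by simp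
    qed
    moreover have "0 \<le> ?Q xs" unfolding window_sum_def using w0 by (intro sum_nonneg) auto
    ultimately show ?thesis using True c D by simp
  qed
  have "\<bar>draws w m I ?Q - c\<bar> \<le> draws w m I (\<lambda>xs. \<bar>?Q xs - c\<bar>)"
  proof -
    have "draws w m I ?Q - c = draws w m I (\<lambda>xs. ?Q xs - c)"
      using draws_const[OF pos, of m c] ij by (simp add: draws_diff)
    moreover have "draws w m I (\<lambda>xs. ?Q xs - c) \<le> draws w m I (\<lambda>xs. \<bar>?Q xs - c\<bar>)"
      by (rule draws_mono[OF pos]) auto
    moreover have "draws w m I (\<lambda>xs. (-1) * (?Q xs - c)) \<le> draws w m I (\<lambda>xs. \<bar>?Q xs - c\<bar>)"
      by (rule draws_mono[OF pos]) auto
    ultimately show ?thesis unfolding draws_cmult by linarith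
  qed
  also have "\<dots> \<le> draws w m I ?U" by (rule draws_mono[OF pos pt])
  also have "\<dots> = D + (\<Sum>k=i..<j. \<alpha> * draws w m I (\<lambda>xs. (w (xs ! k))\<^sup>2) + 1 / (4 * \<alpha>) * draws w m I ?B)
      + c * draws w m I ?B"
    unfolding draws_add draws_sum draws_cmult using draws_const[OF pos, of m D] ij by simp
  also have "\<dots> \<le> D + (\<Sum>k=i..<j. \<alpha> * (4 * C / a) + 1 / (4 * \<alpha>) * \<beta>) + c * \<beta>"
  proof (intro add_mono sum_mono mult_left_mono bad order_refl)
    fix k assume "k \<in> {i..<j}"
    hence "draws w m I (\<lambda>xs. (w (xs ! k))\<^sup>2) \<le> avg w (\<lambda>y. (w y)\<^sup>2) I"
      using ij by (intro draws_nth_square_le[OF pos]) auto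
    also have "\<dots> \<le> 4 * C / a" by (rule avg_square_le_of_large) auto
    finally show "draws w m I (\<lambda>xs. (w (xs ! k))\<^sup>2) \<le> 4 * C / a" .
  qed (use \<alpha> c in auto)
  also have "\<dots> = D + real (j - i) * (\<alpha> * (4 * C / a) + \<beta> / (4 * \<alpha>)) + c * \<beta>" by simp
  finally show ?thesis .
qed

text \<open>After the cut a draw has weight at most \<kappa>, or it belongs to the larger weights
  still present, whose total bounds all such draws together.\<close>

lemma window_tail_le:
  fixes \<kappa> T :: real
  assumes xs: "length xs = m" "distinct xs" "set xs \<subseteq> I" and q: "q \<le> m" and \<kappa>: "0 \<le> \<kappa>" "\<kappa> \<le> T"
  defines "S \<equiv> I - set (take q xs)"
  shows "(\<Sum>k=q..<m. w (xs ! k)) \<le> \<kappa> * real (m - q)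
    + (\<Sum>i\<in>S \<inter> {i. \<kappa> < w i \<and> w i \<le> T}. w i) + (\<Sum>i\<in>S \<inter> {i. T < w i}. w i)"
proof -
  have finS: "finite S" by (simp add: S_def)
  define f where "f i = (if \<kappa> < w i then w i else 0)" for i
  have "(\<Sum>k=q..<m. w (xs ! k)) \<le> (\<Sum>k=q..<m. \<kappa> + f (xs ! k))"
    using \<kappa> by (intro sum_mono) (auto simp: f_def)
  also have "\<dots> = \<kappa> * real (m - q) + (\<Sum>k=q..<m. f (xs ! k))" by (simp add: sum.distrib)
  also have "(\<Sum>k=q..<m. f (xs ! k)) = (\<Sum>k<m - q. f (drop q xs ! k))"
    by (rule sum.reindex_bij_witness[of _ "\<lambda>k. q + k" "\<lambda>k. k - q"]) (use xs q in auto)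
  also have "\<dots> = sum f (set (drop q xs))"
    using xs by (simp add: sum_list_distinct_conv_sum_set[symmetric] sum_list_sum_nth atLeast0LessThan)
  also have "\<dots> \<le> sum f S"
  proof (rule sum_mono2[OF finS])
    show "set (drop q xs) \<subseteq> S"
      using xs set_take_disj_set_drop_if_distinct[of xs q q] set_drop_subset[of q xs] by (auto simp: S_def)
    show "0 \<le> f i" if "i \<in> S - set (drop q xs)" for i
      using that wnonneg by (auto simp: f_def S_def)
  qed
  also have "sum f S = (\<Sum>i\<in>S \<inter> {i. \<kappa> < w i \<and> w i \<le> T}. w i) + (\<Sum>i\<in>S \<inter> {i. T < w i}. w i)"
    using finS \<kappa>(2) by (simp add: sum.inter_restrict sum.distrib[symmetric] f_def) (auto intro!: sum.cong)
  finally show ?thesis by simp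
qed

text \<open>Heavy survivors are measured against the middle mass \<open>g\<close>. Their mean after
  halving the time takes at most half of the level \<eta> g, and the other half is left for the
  Chernoff exponent. Since w <= \<sigma>^2 u, the parameter may be of order 1 / (\<sigma>^2 u), so a
  small \<sigma> makes the exponent as large as desired.\<close>

lemma heavy_alive_le:
  fixes \<eta> T \<kappa> \<sigma> u \<epsilon> h :: real
  defines "g \<equiv> mass w w {i\<in>I. \<kappa> < w i \<and> w i \<le> T}"
  assumes p: "p \<le> n" and s: "1 / (4 * C) \<le> s" "real (n - p) \<le> mass w (\<lambda>_. 1) I s"
    and T: "1 \<le> T" "4 * b \<le> T" and \<kappa>: "0 < \<kappa>" "\<kappa> < a"
    and tail: "(\<Sum>i\<in>I. if w i \<le> T then 0 else (w i)^3) \<le> \<epsilon> * n" "0 \<le> \<epsilon>"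
    and \<eta>: "0 < \<eta>" "4 * \<epsilon> \<le> a * T * \<eta>" and h: "\<kappa> * h \<le> g s" "0 \<le> h"
    and u: "0 < \<sigma>" "0 < u" "\<And>i. i \<in> I \<Longrightarrow> w i \<le> \<sigma>\<^sup>2 * u"
  shows "draws w p I (\<lambda>xs. of_bool (\<eta> * g s \<le> (\<Sum>i\<in>(I - set xs) \<inter> {i. T < w i}. (w i)\<^sup>2)))
    \<le> exp (- (\<kappa> * h / (32 * C))) + exp (- (\<eta> * \<kappa> * h / (32 * C * \<sigma>\<^sup>2 * u)))"
proof -
  define t0 where "t0 = 1 / (4 * C)"
  have t0: "0 < t0" "t0 \<le> s" using C s by (auto simp: t0_def)
  define \<theta> where "\<theta> = t0 / (4 * \<sigma>\<^sup>2 * u)"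
  have \<theta>: "0 \<le> \<theta>" using t0 u by (simp add: \<theta>_def)
  have s0: "0 \<le> s" using t0 by simp
  have g0: "0 \<le> g s" using h \<kappa> by (meson mult_nonneg_nonneg less_imp_le order_trans)
  have "draws w p I (\<lambda>xs. of_bool (\<eta> * g s \<le> (\<Sum>i\<in>(I - set xs) \<inter> {i. T < w i}. (w i)\<^sup>2)))
      \<le> exp (- (s * mass w w I s / 8))
        + exp (- \<theta> * (\<eta> * g s) + \<theta> * (\<Sum>i\<in>I \<inter> {i. T < w i}. (w i)\<^sup>2 * exp (- (w i * s / 4))))"
  proof (rule draws_squares_ge_le[OF pos s0])
    fix i assume "i \<in> I"
    hence "\<theta> * w i \<le> \<theta> * (\<sigma>\<^sup>2 * u)" using u(3) \<theta> by (intro mult_left_mono) auto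
    also have "\<dots> = t0 / 4" using u by (simp add: \<theta>_def)
    finally show "\<theta> * w i \<le> s / 4" using t0 by simp
  qed (use p s \<theta> in auto)
  also have "exp (- (s * mass w w I s / 8)) \<le> exp (- (\<kappa> * h / (32 * C)))"
  proof -
    have "g s \<le> mass w w I s"
      unfolding g_def mass_def using wnonneg by (intro sum_mono2) (auto simp: survive_def)
    hence "t0 * (\<kappa> * h) \<le> s * mass w w I s" using t0 h \<kappa> by (intro mult_mono) auto
    thus ?thesis by (simp add: t0_def)
  qed
  also have "exp (- \<theta> * (\<eta> * g s) + \<theta> * (\<Sum>i\<in>I \<inter> {i. T < w i}. (w i)\<^sup>2 * exp (- (w i * s / 4))))
      \<le> exp (- (\<eta> * \<kappa> * h / (32 * C * \<sigma>\<^sup>2 * u)))"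
  proof -
    have "(\<Sum>i\<in>I \<inter> {i. T < w i}. (w i)\<^sup>2 * exp (- (w i * s / 4))) \<le> 2 * \<epsilon> / (a * T) * g s"
      unfolding g_def using T ab \<kappa> by (intro heavy_mass_le[OF T s0 _ _ tail]) auto
    also have "\<dots> \<le> \<eta> / 2 * g s"
      using \<eta> ab T g0 by (intro mult_right_mono) (auto simp: field_simps)
    finally have "\<theta> * (\<Sum>i\<in>I \<inter> {i. T < w i}. (w i)\<^sup>2 * exp (- (w i * s / 4))) \<le> \<theta> * (\<eta> / 2 * g s)"
      using \<theta> by (rule mult_left_mono)
    moreover have "\<theta> * (\<eta> / 2) * (\<kappa> * h) \<le> \<theta> * (\<eta> / 2) * g s"
      using h \<theta> \<eta> by (intro mult_left_mono) auto
    moreover have "\<theta> * (\<eta> / 2) * (\<kappa> * h) = \<eta> * \<kappa> * h / (32 * C * \<sigma>\<^sup>2 * u)"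
      by (simp add: \<theta>_def t0_def)
    ultimately show ?thesis by (simp add: algebra_simps)
  qed
  finally show ?thesis by simp
qed

text \<open>This is \<open>draws_weights_ge_le\<close> with \<delta> = 1/T. Its mean term is 6 times
  the expected mass \<kappa> h, so the level 8 \<kappa> h leaves the exponent 2 \<kappa> h /
  T.\<close>

lemma middle_alive_le:
  fixes T \<kappa> h \<tau> :: real
  defines "M \<equiv> {i\<in>I. \<kappa> < w i \<and> w i \<le> T}"
  assumes q: "q \<le> n" and t: "1 / (4 * C) \<le> t" "t \<le> \<tau>" "real (n - q) \<le> mass w (\<lambda>_. 1) I t"
    and T: "1 \<le> T" "4 * C \<le> T" and \<kappa>: "0 < \<kappa>" and h: "mass w w M t = \<kappa> * h" "0 \<le> h"
  shows "draws w q I (\<lambda>xs. of_bool (8 * (\<kappa> * h) \<le> (\<Sum>i\<in>(I - set xs) \<inter> {i. \<kappa> < w i \<and> w i \<le> T}. w i)))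
    \<le> exp (- (\<kappa> * h / (4 * T * (\<tau> * T + 1)))) + exp (- (2 * \<kappa> * h / T))"
proof -
  have T0: "0 < T" using T by simp
  have dt: "1 / T \<le> t" 
  proof -
    have "1 / T \<le> 1 / (4 * C)" using T C by (intro divide_left_mono) auto
    thus ?thesis using t by simp
  qed
  have J: "I \<inter> {i. \<kappa> < w i \<and> w i \<le> T} = M" by (auto simp: M_def)
  have "draws w q I (\<lambda>xs. of_bool (8 * (\<kappa> * h) \<le> (\<Sum>i\<in>(I - set xs) \<inter> {i. \<kappa> < w i \<and> w i \<le> T}. w i)))
      \<le> exp (- (1 / T * mass w w I t / (4 * (t / (1 / T) + 1))))
        + exp (- (1 / T) * (8 * (\<kappa> * h)) + 6 * (1 / T) * mass w w (I \<inter> {i. \<kappa> < w i \<and> w i \<le> T}) t)"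
    by (rule draws_weights_ge_le[OF pos]) (use q t T0 dt in \<open>auto simp: field_simps\<close>)
  also have "exp (- (1 / T * mass w w I t / (4 * (t / (1 / T) + 1)))) \<le> exp (- (\<kappa> * h / (4 * T * (\<tau> * T + 1))))"
  proof -
    have t0: "0 \<le> t" using dt T0 by (meson divide_nonneg_pos less_imp_le order_trans zero_le_one)
    have "mass w w M t \<le> mass w w I t"
      unfolding M_def mass_def using wnonneg by (intro sum_mono2) (auto simp: survive_def)
    moreover have "0 \<le> mass w w I t" using wnonneg by (intro mass_nonneg) auto
    ultimately have "\<kappa> * h / (4 * T * (\<tau> * T + 1)) \<le> mass w w I t / (4 * T * (t * T + 1))"
      using h \<kappa> T0 t t0 by (intro frac_le mult_left_mono add_right_mono mult_right_mono mult_pos_pos add_nonneg_pos mult_nonneg_nonneg) auto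
    also have "\<dots> = 1 / T * mass w w I t / (4 * (t / (1 / T) + 1))" using T0 by simp
    finally show ?thesis by simp
  qed
  also have "exp (- (1 / T) * (8 * (\<kappa> * h)) + 6 * (1 / T) * mass w w (I \<inter> {i. \<kappa> < w i \<and> w i \<le> T}) t)
      = exp (- (2 * \<kappa> * h / T))"
    unfolding J h(1) by simp
  finally show ?thesis by simp
qed


text \<open>\<open>\<Omega>\<close> adds up the failure probabilities: the martingale, two sums at
  each of at most 2 h draws before the cut (8 exponentials per draw), the heavy survivors at
  \<open>p\<close>, and the middle survivors at the cut. Because \<open>h \<le> K * y\<close>, a
  constant accuracy 8 \<eta> per draw suffices: 2 h times 8 \<eta> is at most y/8.\<close>

lemma end_window:
  fixes y K T \<epsilon> \<sigma> u h \<kappa> \<beta> :: real and p m :: nat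
  defines "\<eta> \<equiv> 1 / (128 * K)"
  defines "\<eta>' \<equiv> \<eta> * \<kappa> / (4 * T)"
  defines "\<tau> \<equiv> ln (C * n / \<kappa>) / \<kappa>"
  defines "L \<equiv> 1 + 4 * \<tau> * T\<^sup>2 / \<eta>"
  defines "\<Omega> \<equiv> 2 * exp (- (y / (32 * \<sigma> * u))) + 16 * h * exp (- (\<eta> * \<kappa> * h / (16 * T\<^sup>2 * L)))
    + (exp (- (\<kappa> * h / (32 * C))) + exp (- (\<eta>' * \<kappa> * h / (32 * C * \<sigma>\<^sup>2 * u))))
    + (exp (- (\<kappa> * h / (4 * T * (\<tau> * T + 1)))) + exp (- (2 * \<kappa> * h / T)))"
  assumes pm: "p < m" "m \<le> n" "n \<le> 4 * p" and h: "1 \<le> h" "real (m - p) \<le> 2 * h"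
    and y: "0 < y" and K: "1 \<le> K" "h \<le> K * y"
    and T: "1 \<le> T" "4 * b \<le> T" "4 * C \<le> T" and \<kappa>: "0 < \<kappa>" "\<kappa> < a" "88 * K * \<kappa> \<le> 1"
    and tail: "(\<Sum>i\<in>I. if w i \<le> T then 0 else (w i)^3) \<le> \<epsilon> * n" "0 \<le> \<epsilon>" "16 * \<epsilon> \<le> a * \<eta> * \<kappa>"
    and small: "\<kappa> * h < a * n / 2 * exp (- (b / (4 * C)))"
    and \<sigma>: "0 < \<sigma>" "\<sigma> \<le> 1" "64 * K * \<sigma> * (T + 1) \<le> 1" and u: "0 < u" "\<And>i. i \<in> I \<Longrightarrow> w i \<le> \<sigma>\<^sup>2 * u"
    and \<beta>: "\<Omega> \<le> \<beta>" "32 * K * \<beta> * (32 * K * C / a + T) \<le> 1"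
  shows "draws w m I (\<lambda>xs. of_bool (\<exists>i j. p \<le> i \<and> i \<le> j \<and> j \<le> m \<and>
      y \<le> \<bar>window_sum w i j xs - draws w m I (window_sum w i j)\<bar>)) \<le> \<Omega>"
proof -
  have a0: "0 < a" and b0: "0 < b" using ab by auto
  have n0: "0 < real n" using n by simp
  have T0: "0 < T" using T by simp
  have bT: "b \<le> T" using T b0 by linarith
  have \<kappa>T: "\<kappa> \<le> T" using \<kappa> ab bT by linarith
  have \<eta>: "0 < \<eta>" "\<eta> \<le> 1 / 128" using K by (auto simp: \<eta>_def field_simps)
  have \<eta>': "0 < \<eta>'" using \<eta> \<kappa> T0 by (simp add: \<eta>'_def)
  have \<kappa>h: "0 < \<kappa> * h" "\<kappa> \<le> \<kappa> * h" using \<kappa> h by auto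
  have \<eta>'T: "\<eta>' * (4 * T * h) = \<eta> * (\<kappa> * h)" using T0 by (simp add: \<eta>'_def)
  define mid where "mid = {i\<in>I. \<kappa> < w i \<and> w i \<le> T}"
  have midI: "mid \<subseteq> I" by (auto simp: mid_def)
  define g where "g = mass w w mid"
  have g_anti: "g t \<le> g s" if "s \<le> t" for s t
    unfolding g_def using that wnonneg
    by (intro mass_antimono pos_weights_subset[OF pos]) (auto simp: mid_def)
  have cnt_anti: "mass w (\<lambda>_. 1) I t \<le> mass w (\<lambda>_. 1) I s" if "s \<le> t" for s t
    using that by (intro mass_antimono[OF pos]) auto
  have g_diff: "g s \<le> g t + T * (mass w (\<lambda>_. 1) I s - mass w (\<lambda>_. 1) I t)" if st: "s \<le> t" for s t
  proof -
    have sv: "0 \<le> survive w s i - survive w t i" if "i \<in> I" for i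
      using survive_mono[of w i s t] wnonneg[OF that] st by simp
    have "g s - g t = (\<Sum>i\<in>mid. (survive w s i - survive w t i) * w i)"
      by (simp add: g_def mass_def sum_subtractf left_diff_distrib)
    also have "\<dots> \<le> (\<Sum>i\<in>mid. (survive w s i - survive w t i) * T)"
      using sv by (intro sum_mono mult_left_mono) (auto simp: mid_def)
    also have "\<dots> \<le> (\<Sum>i\<in>I. (survive w s i - survive w t i) * T)"
      using sv T0 by (intro sum_mono2 mult_nonneg_nonneg) (auto simp: mid_def)
    also have "\<dots> = T * (mass w (\<lambda>_. 1) I s - mass w (\<lambda>_. 1) I t)"
      by (simp add: mass_def sum_subtractf[symmetric] sum_distrib_left mult.commute)
    finally show ?thesis by simp
  qed
  define low1 where "low1 i = (if w i \<le> T then w i else 0)" for i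
  define low2 where "low2 i = (if w i \<le> T then (w i)\<^sup>2 else 0)" for i
  have low1: "0 \<le> low1 i \<and> low1 i \<le> T" if "i \<in> I" for i
    using wpos[OF that] T by (auto simp: low1_def)
  have low2: "0 \<le> low2 i \<and> low2 i \<le> T\<^sup>2" if "i \<in> I" for i
    using wpos[OF that] T by (auto simp: low2_def power_mono)
  have g_low1: "g t \<le> mass w low1 I t" for t
  proof -
    have "g t = mass w (\<lambda>i. if \<kappa> < w i \<and> w i \<le> T then w i else 0) I t"
      unfolding g_def mid_def by (rule mass_if[symmetric]) simp
    also have "\<dots> \<le> mass w low1 I t" using wnonneg by (intro mass_mono_weight) (auto simp: low1_def)
    finally show ?thesis .
  qed
  \<comment> \<open>For weights above T >= 1, w <= w^2 and exp (- w t) <= exp (- w t / 4), so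
    \<open>heavy_mass_le\<close> applies. The total mass and the mass of the bounded weights are
    thus interchangeable up to a factor 2.\<close>
  have heavy_le_g: "mass w w I t \<le> 2 * mass w low1 I t" if t: "0 \<le> t" for t
  proof -
    have "mass w w I t \<le> (\<Sum>i\<in>I. survive w t i * low1 i + (if T < w i then (w i)\<^sup>2 * exp (- (w i * t / 4)) else 0))"
      unfolding mass_def
    proof (rule sum_mono)
      fix i assume i: "i \<in> I"
      show "survive w t i * w i \<le> survive w t i * low1 i + (if T < w i then (w i)\<^sup>2 * exp (- (w i * t / 4)) else 0)"
      proof (cases "T < w i")
        case True
        have "w i * 1 \<le> w i * w i" using True T by (intro mult_left_mono) auto
        moreover have "0 \<le> w i * t" "0 \<le> t * w i" using t wnonneg[OF i] by simp_all
        ultimately have "exp (- (w i * t)) * w i \<le> exp (- (w i * t / 4)) * (w i)\<^sup>2"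
          using wnonneg[OF i] by (intro mult_mono) (auto simp: power2_eq_square)
        thus ?thesis using True by (simp add: survive_def low1_def mult.commute)
      qed (simp add: low1_def)
    qed
    also have "\<dots> = mass w low1 I t + (\<Sum>i\<in>I \<inter> {i. T < w i}. (w i)\<^sup>2 * exp (- (w i * t / 4)))"
      by (subst sum.inter_restrict) (auto simp: mass_def sum.distrib)
    also have "(\<Sum>i\<in>I \<inter> {i. T < w i}. (w i)\<^sup>2 * exp (- (w i * t / 4))) \<le> 2 * \<epsilon> / (a * T) * g t"
      unfolding g_def using \<kappa> bT by (intro heavy_mass_le[OF T(1,2) t _ _ tail(1,2)]) (auto simp: mid_def)
    also have "2 * \<epsilon> / (a * T) * g t \<le> 1 * g t"
    proof (rule mult_right_mono)
      have "a * \<eta> * \<kappa> \<le> a * 1 * T" using a0 \<eta> \<kappa> \<kappa>T by (intro mult_mono) auto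
      hence "2 * \<epsilon> \<le> a * 1 * T" using tail(2,3) by linarith
      thus "2 * \<epsilon> / (a * T) \<le> 1" using a0 T0 by (simp add: divide_le_eq_1)
      show "0 \<le> g t" unfolding g_def using wnonneg by (intro mass_nonneg) (auto simp: mid_def)
    qed
    finally show ?thesis using g_low1[of t] by simp
  qed
  have "\<forall>k\<in>{..<m}. \<exists>t. 0 \<le> t \<and> mass w (\<lambda>_. 1) I t = n - k"
  proof
    fix k assume "k \<in> {..<m}"
    hence "k < n" using pm by simp
    then obtain t where "0 \<le> t" "mass w (\<lambda>_. 1) I t = n - k" by (rule ex_time)
    thus "\<exists>t. 0 \<le> t \<and> mass w (\<lambda>_. 1) I t = n - k" by blast
  qed
  then obtain tm where tm: "\<And>k. k < m \<Longrightarrow> 0 \<le> tm k \<and> mass w (\<lambda>_. 1) I (tm k) = n - k"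
    using bchoice[of "{..<m}"] by (metis lessThan_iff)
  have tm_mono: "tm k \<le> tm k'" if "k \<le> k'" "k' < m" for k k'
  proof (rule ccontr)
    assume neg: "\<not> tm k \<le> tm k'"
    hence "k \<noteq> k'" by auto
    have "mass w (\<lambda>_. 1) I (tm k) \<le> mass w (\<lambda>_. 1) I (tm k')" using neg by (intro cnt_anti) simp
    thus False using tm[of k] tm[of k'] that \<open>k \<noteq> k'\<close> pm by simp
  qed
  \<comment> \<open>The cut. \<open>k = m\<close> always qualifies, so \<open>q = m\<close> means
    that nothing is cut off; it also avoids \<open>tm m\<close>, about which nothing is known.
    Before \<open>q\<close> the middle mass is at least \<kappa> h.\<close>
  define q where "q = (LEAST k. p \<le> k \<and> (k = m \<or> g (tm k) < \<kappa> * h))"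
  have "p \<le> q \<and> (q = m \<or> g (tm q) < \<kappa> * h)"
    unfolding q_def by (rule LeastI[of _ m]) (use pm in auto)
  hence q: "p \<le> q" "q = m \<or> g (tm q) < \<kappa> * h" by auto
  have qm: "q \<le> m" unfolding q_def by (rule Least_le) (use pm in auto)
  have qn: "q \<le> n" using qm pm by simp
  have precut: "\<kappa> * h \<le> g (tm k)" if "k \<in> {p..<q}" for k
  proof -
    have "\<not> (p \<le> k \<and> (k = m \<or> g (tm k) < \<kappa> * h))"
      using that not_less_Least[of k] unfolding q_def by auto
    thus ?thesis using that by auto
  qed
  \<comment> \<open>If the middle mass at \<open>tm k\<close> is already too small, some earlier
    time has mass exactly \<kappa> h. More elements are expected alive then, which is the direction
    that the upper bounds on survivors need.\<close>
  have cut_time: "\<exists>t. 1 / (4 * C) \<le> t \<and> g t = \<kappa> * h \<and> real (n - k) \<le> mass w (\<lambda>_. 1) I t"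
    if k: "k < m" "g (tm k) < \<kappa> * h" for k
  proof -
    have "a * n / 2 * exp (- (b * (1 / (4 * C)))) \<le> g (1 / (4 * C))"
      unfolding g_def using \<kappa> bT C by (intro sum_middle_ge) (auto simp: mid_def)
    hence "\<kappa> * h \<le> mass w w mid (1 / (4 * C))" using small by (simp add: g_def)
    then obtain t where t: "1 / (4 * C) \<le> t" "g t = \<kappa> * h"
      using mass_attains_above[OF pos_weights_subset[OF pos midI] \<kappa>h(1), of w "1 / (4 * C)"]
      by (auto simp: g_def)
    have "t \<le> tm k" using g_anti[of "tm k" t] t k by linarith
    hence "real (n - k) \<le> mass w (\<lambda>_. 1) I t" using cnt_anti[of t "tm k"] tm[OF k(1)] by simp
    thus ?thesis using t by blast
  qed
  have g_step: "g (tm p) \<le> g (tm k) + T * (2 * h)" if k: "p \<le> k" "k < m" for k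
  proof -
    have "mass w (\<lambda>_. 1) I (tm p) - mass w (\<lambda>_. 1) I (tm k) \<le> 2 * h"
      using tm[of p] tm[of k] k pm h(2) by (simp add: of_nat_diff)
    hence "T * (mass w (\<lambda>_. 1) I (tm p) - mass w (\<lambda>_. 1) I (tm k)) \<le> T * (2 * h)"
      using T0 by (intro mult_left_mono) auto
    thus ?thesis using g_diff[OF tm_mono[OF k]] by linarith
  qed
  \<comment> \<open>A reference time at which the heavy survivors are bounded once for the whole
    window: \<open>tm p\<close>, or the time of \<open>cut_time\<close> if the cut comes at once.
    Over 2 h draws the middle mass loses at most 2 h T, and before the cut it is at least \<kappa>
    h; hence the factor 4 T / \<kappa>, which \<open>\<eta>'\<close> undoes.\<close>
  have "\<exists>s. 1 / (4 * C) \<le> s \<and> real (n - p) \<le> mass w (\<lambda>_. 1) I s \<and> \<kappa> * h \<le> g s \<and>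
      (\<forall>k\<in>{p..<q}. g s \<le> 4 * T / \<kappa> * g (tm k)) \<and> (q < m \<longrightarrow> g s \<le> 4 * T * h)"
  proof (cases "\<kappa> * h \<le> g (tm p)")
    case True
    have "1 / (4 * C) \<le> tm p" by (rule time_ge[of p]) (use pm tm[of p] in auto)
    moreover have "g (tm p) \<le> 4 * T / \<kappa> * g (tm k)" if k: "k \<in> {p..<q}" for k
    proof -
      have gk: "\<kappa> * h \<le> g (tm k)" by (rule precut[OF k])
      hence gk0: "0 \<le> g (tm k)" using \<kappa>h by linarith
      have "T * (2 * h) = 2 * T / \<kappa> * (\<kappa> * h)" using \<kappa> by simp
      also have "\<dots> \<le> 2 * T / \<kappa> * g (tm k)" using gk T0 \<kappa> by (intro mult_left_mono) auto
      finally have "g (tm p) \<le> 1 * g (tm k) + 2 * T / \<kappa> * g (tm k)" using g_step[of k] k qm by simp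
      also have "\<dots> \<le> 2 * T / \<kappa> * g (tm k) + 2 * T / \<kappa> * g (tm k)"
        using gk0 \<kappa> \<kappa>T by (intro add_right_mono mult_right_mono) (auto simp: field_simps)
      finally show ?thesis by simp
    qed
    moreover have "g (tm p) \<le> 4 * T * h" if "q < m"
    proof -
      have "\<kappa> * h \<le> T * h" using \<kappa>T h by (intro mult_right_mono) auto
      hence "g (tm q) \<le> T * h" using q(2) that by auto
      moreover have "0 \<le> T * h" using T0 h by simp
      ultimately show ?thesis using g_step[of q] q(1) that by simp
    qed
    ultimately show ?thesis using True tm[of p] pm by auto
  next
    case False
    hence "q \<le> p" unfolding q_def by (intro Least_le) auto
    hence qp: "q = p" using q by simp
    obtain s where s: "1 / (4 * C) \<le> s" "g s = \<kappa> * h" "real (n - p) \<le> mass w (\<lambda>_. 1) I s"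
      using cut_time[of p] False pm by auto
    have "\<kappa> * h \<le> 4 * T * h" using \<kappa>T \<kappa> T0 h by (intro mult_right_mono) auto
    thus ?thesis using s qp by auto
  qed
  then obtain s where s: "1 / (4 * C) \<le> s" "real (n - p) \<le> mass w (\<lambda>_. 1) I s" "\<kappa> * h \<le> g s"
    "\<And>k. k \<in> {p..<q} \<Longrightarrow> g s \<le> 4 * T / \<kappa> * g (tm k)" "q < m \<Longrightarrow> g s \<le> 4 * T * h" by blast
  define f1 where "f1 k = mass w low1 I (tm k)" for k
  define f2 where "f2 k = mass w low2 I (tm k)" for k
  define r where "r k = f2 k / f1 k" for k
  have r: "0 \<le> r k \<and> r k \<le> T" for k
  proof -
    have "0 \<le> f1 k" "0 \<le> f2 k" unfolding f1_def f2_def using low1 low2 by (auto intro!: mass_nonneg)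
    moreover have "f2 k \<le> T * f1 k"
    proof -
      have "f2 k \<le> mass w (\<lambda>i. T * low1 i) I (tm k)" unfolding f2_def
        using wnonneg by (intro mass_mono_weight) (auto simp: low1_def low2_def power2_eq_square mult_right_mono)
      also have "\<dots> = T * f1 k" by (simp add: f1_def mass_def sum_distrib_left mult_ac)
      finally show ?thesis .
    qed
    ultimately show ?thesis using T0 by (cases "f1 k = 0") (auto simp: r_def divide_le_eq)
  qed
  have f1: "\<kappa> * h \<le> f1 k" "g (tm k) \<le> f1 k" "0 < f1 k" "r k * f1 k = f2 k" if k: "k \<in> {p..<q}" for k
  proof -
    show "g (tm k) \<le> f1 k" unfolding f1_def by (rule g_low1)
    thus 1: "\<kappa> * h \<le> f1 k" using precut[OF k] by simp
    show 2: "0 < f1 k" using 1 \<kappa>h by linarith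
    show "r k * f1 k = f2 k" using 2 by (simp add: r_def)
  qed
  have \<tau>: "0 \<le> \<tau>"
  proof -
    have "C * n \<ge> 1" using C n mult_mono[of 1 C 1 "real n"] by simp
    moreover have "\<kappa> \<le> 88 * K * \<kappa>" using K \<kappa> by simp
    hence "\<kappa> \<le> 1" using \<kappa>(3) by linarith
    ultimately have "1 \<le> C * n / \<kappa>" using \<kappa> by (simp add: field_simps)
    thus ?thesis using \<kappa> by (simp add: \<tau>_def)
  qed
  have L1: "1 \<le> L" using \<tau> \<eta> by (simp add: L_def)
  define E where "E = exp (- (\<eta> * \<kappa> * h / (16 * T\<^sup>2 * L)))"
  define d1 where "d1 k xs = \<bar>sum low1 (I - set (take k xs)) - f1 k\<bar>" for k xs
  define d2 where "d2 k xs = \<bar>sum low2 (I - set (take k xs)) - f2 k\<bar>" for k xs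
  have P12: "draws w m I (\<lambda>xs. of_bool (\<eta> * f1 k / T \<le> d1 k xs)) \<le> 4 * E"
    "draws w m I (\<lambda>xs. of_bool (\<eta> * f1 k \<le> d2 k xs)) \<le> 4 * E" if k: "k \<in> {p..<q}" for k
  proof -
    have km: "k < m" using k qm by simp
    define z where "z = \<eta> * f1 k / (2 * T\<^sup>2)"
    have z0: "0 < z" using \<eta> f1[OF k] T0 by (simp add: z_def)
    have "tm k \<le> \<tau>" unfolding \<tau>_def
    proof (rule time_le_of_mass_ge[OF \<kappa>(1) midI])
      show "\<kappa> \<le> mass w w mid (tm k)" using precut[OF k] \<kappa>h(2) unfolding g_def by linarith
    qed (use tm[OF km] in \<open>auto simp: mid_def\<close>)
    \<comment> \<open>The variance is at most 2 \<tau> times the mass of the bounded weights, while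
      \<open>z\<close> is a constant multiple of that mass. Their ratio \<open>L\<close> is
      therefore only logarithmic in n.\<close>
    have "mvar w I (tm k) \<le> tm k * mass w w I (tm k)" by (rule mvar_le_mass[OF pos])
    also have "\<dots> \<le> \<tau> * (2 * f1 k)"
      unfolding f1_def using \<open>tm k \<le> \<tau>\<close> \<tau> tm[OF km] heavy_le_g wnonneg
      by (intro mult_mono mass_nonneg) auto
    also have "\<dots> = 4 * \<tau> * T\<^sup>2 / \<eta> * z" using T0 \<eta> by (simp add: z_def)
    also have "\<dots> \<le> L * z" using z0 by (intro mult_right_mono) (auto simp: L_def)
    finally have v: "mvar w I (tm k) \<le> L * z" .
    have "\<eta> * \<kappa> * h / (16 * T\<^sup>2 * L) \<le> z / (8 * L)"
    proof -
      have "\<eta> * (\<kappa> * h) / (2 * T\<^sup>2) \<le> z"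
        unfolding z_def using f1(1)[OF k] \<eta> by (intro divide_right_mono mult_left_mono) auto
      hence "\<eta> * (\<kappa> * h) / (2 * T\<^sup>2) / (8 * L) \<le> z / (8 * L)" using L1 by (intro divide_right_mono) auto
      thus ?thesis by (simp add: mult_ac)
    qed
    hence E: "4 * exp (- z / (8 * L)) \<le> 4 * E" by (simp add: E_def)
    have "draws w m I (\<lambda>xs. of_bool (2 * T * z \<le> \<bar>sum low1 (I - set (take k xs)) - mass w low1 I (tm k)\<bar>))
        \<le> 4 * exp (- z / (8 * L))"
      using tm[OF km] low1 T z0 L1 v km pm by (intro draws_take_concentration) auto
    moreover have "2 * T * z = \<eta> * f1 k / T" using T by (simp add: z_def power2_eq_square)
    ultimately show "draws w m I (\<lambda>xs. of_bool (\<eta> * f1 k / T \<le> d1 k xs)) \<le> 4 * E"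
      using E unfolding d1_def f1_def by (metis order_trans)
    have "draws w m I (\<lambda>xs. of_bool (2 * T\<^sup>2 * z \<le> \<bar>sum low2 (I - set (take k xs)) - mass w low2 I (tm k)\<bar>))
        \<le> 4 * exp (- z / (8 * L))"
      using tm[OF km] low2 T z0 L1 v km pm by (intro draws_take_concentration) auto
    moreover have "2 * T\<^sup>2 * z = \<eta> * f1 k" using T by (simp add: z_def)
    ultimately show "draws w m I (\<lambda>xs. of_bool (\<eta> * f1 k \<le> d2 k xs)) \<le> 4 * E"
      using E unfolding d2_def f2_def by (metis order_trans)
  qed
  define heavy where "heavy xs = (\<Sum>i\<in>(I - set xs) \<inter> {i. T < w i}. (w i)\<^sup>2)" for xs
  have PH: "draws w m I (\<lambda>xs. of_bool (\<eta>' * g s \<le> heavy (take p xs)))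
      \<le> exp (- (\<kappa> * h / (32 * C))) + exp (- (\<eta>' * \<kappa> * h / (32 * C * \<sigma>\<^sup>2 * u)))"
  proof -
    have "draws w m I (\<lambda>xs. of_bool (\<eta>' * g s \<le> heavy (take p xs)))
        = draws w p I (\<lambda>xs. of_bool (\<eta>' * g s \<le> heavy xs))"
      by (rule draws_take[OF pos]) (use pm in auto)
    also have "\<dots> \<le> exp (- (\<kappa> * h / (32 * C))) + exp (- (\<eta>' * \<kappa> * h / (32 * C * \<sigma>\<^sup>2 * u)))"
      unfolding heavy_def g_def mid_def
    proof (rule heavy_alive_le[OF _ s(1,2) T(1,2) \<kappa>(1,2) tail(1,2) \<eta>'])
      show "4 * \<epsilon> \<le> a * T * \<eta>'" using tail(3) T0 by (simp add: \<eta>'_def)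
      show "\<kappa> * h \<le> mass w w {i\<in>I. \<kappa> < w i \<and> w i \<le> T} s" using s(3) by (simp add: g_def mid_def)
    qed (use pm h \<sigma> u in auto)
    finally show ?thesis .
  qed
  define PU where "PU = exp (- (\<kappa> * h / (4 * T * (\<tau> * T + 1)))) + exp (- (2 * \<kappa> * h / T))"
  define alive where "alive xs = (\<Sum>i\<in>(I - set xs) \<inter> {i. \<kappa> < w i \<and> w i \<le> T}. w i)" for xs
  have PU: "draws w m I (\<lambda>xs. of_bool (q < m \<and> 8 * (\<kappa> * h) \<le> alive (take q xs))) \<le> PU"
  proof (cases "q < m")
    case True
    then obtain t where t: "1 / (4 * C) \<le> t" "g t = \<kappa> * h" "real (n - q) \<le> mass w (\<lambda>_. 1) I t"
      using cut_time[of q] q(2) by auto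
    have t0: "0 \<le> t" using t(1) C by (smt (verit) divide_nonneg_nonneg)
    have "t \<le> \<tau>" unfolding \<tau>_def
    proof (rule time_le_of_mass_ge[OF \<kappa>(1) midI])
      show "\<kappa> \<le> mass w w mid t" using t(2) \<kappa>h(2) unfolding g_def by linarith
    qed (use t0 in \<open>auto simp: mid_def\<close>)
    have "draws w m I (\<lambda>xs. of_bool (8 * (\<kappa> * h) \<le> alive (take q xs)))
        = draws w q I (\<lambda>xs. of_bool (8 * (\<kappa> * h) \<le> alive xs))"
      by (rule draws_take[OF pos]) (use pm qm in auto)
    also have "\<dots> \<le> PU"
      unfolding alive_def PU_def
      using t(2) h by (intro middle_alive_le[OF qn t(1) \<open>t \<le> \<tau>\<close> t(3) T(1,3) \<kappa>(1)]) (auto simp: g_def mid_def)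
    finally show ?thesis using True by simp
  qed (simp add: PU_def add_nonneg_nonneg)
  \<comment> \<open>The stopping predicate sees only the set, so the number of draws made is
    recovered as \<open>n - card S\<close>. On such sets R(S) is at most T + 1, which yields the
    variance bound.\<close>
  define G where "G S \<longleftrightarrow> \<bar>avg w w S - r (n - card S)\<bar> \<le> 8 * \<eta>" for S
  define EM where "EM xs \<longleftrightarrow> (\<exists>s\<in>{p..q}. (\<forall>k\<in>{p..<s}. G (I - set (take k xs))) \<and>
      y / 16 \<le> \<bar>\<Sum>k=p..<s. w (xs ! k) - avg w w (I - set (take k xs))\<bar>)" for xs
  have PM: "draws w m I (\<lambda>xs. of_bool (EM (take q xs))) \<le> 2 * exp (- (y / (32 * \<sigma> * u)))"
  proof -
    \<comment> \<open>Of the factor \<sigma>^2 in w <= \<sigma>^2 u, one \<sigma> keeps \<theta> w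
      <= 1 and the other makes the exponent large. \<open>V\<close> comes from w^2 <= \<sigma>^2 u
      w, and the condition on 64 K \<sigma> (T + 1) makes the quadratic term at most half of the
      linear one.\<close>
    define \<theta> where "\<theta> = 1 / (\<sigma> * u)"
    have \<theta>: "0 < \<theta>" using \<sigma> u by (simp add: \<theta>_def)
    define V where "V = \<sigma>\<^sup>2 * u * (T + 1)"
    have "draws w m I (\<lambda>xs. of_bool (EM (take q xs))) = draws w q I (\<lambda>xs. of_bool (EM xs))"
      by (rule draws_take[OF pos]) (use pm qm in auto)
    also have "\<dots> \<le> 2 * exp (- \<theta> * (y / 16) + real (q - p) * (\<theta>\<^sup>2 * V))"
      unfolding EM_def
    proof (rule draws_window_martingale[OF pos q(1)])
      fix S x assume S: "S \<subseteq> I" "x \<in> S"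
      have "\<theta> * w x \<le> \<theta> * (\<sigma>\<^sup>2 * u)" using S \<theta> by (intro mult_left_mono u(2)) auto
      also have "\<dots> = \<sigma>" using \<sigma> u by (simp add: \<theta>_def power2_eq_square)
      finally show "\<theta> * w x \<le> 1" using \<sigma> by simp
    next
      fix S assume S: "S \<subseteq> I" "G S"
      have wS: "pos_weights w S" using pos S(1) by (rule pos_weights_subset)
      have "avg w (\<lambda>y. (w y)\<^sup>2) S \<le> avg w (\<lambda>y. (\<sigma>\<^sup>2 * u) * w y) S"
      proof (rule avg_mono[OF wS])
        fix x assume "x \<in> S"
        hence "x \<in> I" using S by auto
        thus "(w x)\<^sup>2 \<le> (\<sigma>\<^sup>2 * u) * w x"
          unfolding power2_eq_square[of "w x"] using u(2) wnonneg by (intro mult_right_mono) auto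
      qed
      also have "\<dots> = (\<sigma>\<^sup>2 * u) * avg w w S" by (rule avg_cmult)
      also have "\<dots> \<le> (\<sigma>\<^sup>2 * u) * (T + 1)"
      proof (rule mult_left_mono)
        show "avg w w S \<le> T + 1" using S(2) r[of "n - card S"] \<eta> unfolding G_def by linarith
      qed (use u in auto)
      finally show "avg w (\<lambda>y. (w y)\<^sup>2) S \<le> V" by (simp add: V_def)
    qed (use qn \<theta> u T in \<open>auto simp: V_def\<close>)
    also have "- \<theta> * (y / 16) + real (q - p) * (\<theta>\<^sup>2 * V) \<le> - (y / (32 * \<sigma> * u))"
    proof -
      have "real (q - p) * (\<theta>\<^sup>2 * V) = real (q - p) * ((T + 1) / u)"
        using \<sigma> u by (simp add: \<theta>_def V_def power2_eq_square)
      also have "\<dots> \<le> (2 * (K * y)) * ((T + 1) / u)"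
        using h(2) K qm q(1) T0 u by (intro mult_right_mono) auto
      also have "\<dots> = (64 * K * \<sigma> * (T + 1)) * (y / (32 * \<sigma> * u))" using \<sigma> u by (simp add: field_simps)
      also have "\<dots> \<le> 1 * (y / (32 * \<sigma> * u))"
        using \<sigma> y u by (intro mult_right_mono) auto
      finally show ?thesis by (simp add: \<theta>_def)
    qed
    finally show ?thesis by simp
  qed
  define bad where "bad xs \<longleftrightarrow> EM (take q xs) \<or> \<eta>' * g s \<le> heavy (take p xs)
      \<or> (q < m \<and> 8 * (\<kappa> * h) \<le> alive (take q xs))
      \<or> (\<exists>k\<in>{p..<q}. \<eta> * f1 k / T \<le> d1 k xs \<or> \<eta> * f1 k \<le> d2 k xs)" for xs
  define c where "c i j = (\<Sum>k\<in>{i..<j} \<inter> {..<q}. r k)" for i j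
  have hK: "real (q - p) * (8 * \<eta>) \<le> y / 8"
  proof -
    have "real (q - p) * (8 * \<eta>) \<le> (2 * (K * y)) * (8 * \<eta>)"
      using h(2) K qm q(1) \<eta> by (intro mult_right_mono) auto
    also have "\<dots> = y / 8" using K by (simp add: \<eta>_def)
    finally show ?thesis .
  qed
  \<comment> \<open>One y/8 each from the martingale (twice y/16), from the drift and from the draws
    after the cut.\<close>
  have good: "\<bar>window_sum w i j xs - c i j\<bar> \<le> 3 / 8 * y"
    if xs: "length xs = m" "distinct xs" "set xs \<subseteq> I" and nb: "\<not> bad xs" and ij: "p \<le> i" "i \<le> j" "j \<le> m"
    for xs i j
  proof -
    have heavy_mono: "heavy (take k xs) \<le> \<eta>' * g s" if k: "p \<le> k" for k
    proof -
      have "set (take p xs) \<subseteq> set (take k xs)" using k by (rule set_take_subset_set_take)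
      hence "heavy (take k xs) \<le> heavy (take p xs)"
        unfolding heavy_def by (intro sum_mono2) auto
      thus ?thesis using nb unfolding bad_def by linarith
    qed
    have dev: "\<bar>avg w w (I - set (take k xs)) - r k\<bar> \<le> 8 * \<eta>" if k: "k \<in> {p..<q}" for k
    proof -
      have "\<bar>avg w w (I - set (take k xs)) - r k\<bar> \<le> 8 * (\<eta> * f1 k) / f1 k"
      proof (rule ratio_end[OF _ T(1) f1(4)[OF k] _ _ f1(3)[OF k]])
        show "2 * (\<eta> * f1 k) \<le> f1 k" using \<eta> f1(3)[OF k] by simp
        show "\<bar>(\<Sum>i\<in>I - set (take k xs). if w i \<le> T then (w i)\<^sup>2 else 0) - f2 k\<bar> \<le> \<eta> * f1 k"
          "\<bar>(\<Sum>i\<in>I - set (take k xs). if w i \<le> T then w i else 0) - f1 k\<bar> \<le> \<eta> * f1 k / T"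
          using nb k unfolding bad_def d1_def d2_def low1_def low2_def by force+
        have "heavy (take k xs) \<le> \<eta>' * g s" using k by (intro heavy_mono) auto
        also have "\<dots> \<le> \<eta>' * (4 * T / \<kappa> * g (tm k))" using s(4)[OF k] \<eta>' by (intro mult_left_mono) auto
        also have "\<dots> = \<eta> * g (tm k)" using T0 \<kappa> by (simp add: \<eta>'_def)
        also have "\<dots> \<le> \<eta> * f1 k" using f1(2)[OF k] \<eta> by (intro mult_left_mono) auto
        finally show "(\<Sum>i\<in>(I - set (take k xs)) \<inter> {i. T < w i}. (w i)\<^sup>2) \<le> \<eta> * f1 k"
          by (simp add: heavy_def)
      qed (use r in auto)
      thus ?thesis using f1(3)[OF k] by simp
    qed
    have Gk: "G (I - set (take k xs))" if k: "k \<in> {p..<q}" for k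
      using dev[OF k] card_minus_take[OF xs, of k] k qm pm by (simp add: G_def)
    have tail_le: "(\<Sum>k=q..<m. w (xs ! k)) \<le> y / 8"
    proof (cases "q < m")
      case True
      have "(\<Sum>k=q..<m. w (xs ! k)) \<le> \<kappa> * real (m - q) + alive (take q xs)
          + (\<Sum>i\<in>(I - set (take q xs)) \<inter> {i. T < w i}. w i)"
        unfolding alive_def by (rule window_tail_le[OF xs qm less_imp_le[OF \<kappa>(1)] \<kappa>T])
      moreover have "(\<Sum>i\<in>(I - set (take q xs)) \<inter> {i. T < w i}. w i) \<le> heavy (take q xs)"
        unfolding heavy_def
      proof (rule sum_mono)
        fix i assume "i \<in> (I - set (take q xs)) \<inter> {i. T < w i}"
        hence "1 \<le> w i" using T by auto
        thus "w i \<le> (w i)\<^sup>2" by (simp add: power2_eq_square)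
      qed
      moreover have "heavy (take q xs) \<le> \<kappa> * h"
      proof -
        have "heavy (take q xs) \<le> \<eta>' * g s" by (rule heavy_mono[OF q(1)])
        also have "\<dots> \<le> \<eta>' * (4 * T * h)" using s(5)[OF True] \<eta>' by (intro mult_left_mono) auto
        also have "\<dots> \<le> 1 * (\<kappa> * h)" unfolding \<eta>'T using \<eta> \<kappa>h by (intro mult_right_mono) auto
        finally show ?thesis by simp
      qed
      moreover have "alive (take q xs) \<le> 8 * (\<kappa> * h)" using nb True unfolding bad_def by auto
      moreover have "\<kappa> * real (m - q) \<le> \<kappa> * (2 * h)" using h(2) q(1) \<kappa> by (intro mult_left_mono) auto
      \<comment> \<open>11 = 2 + 8 + 1: weights up to \<kappa>, middle survivors, heavy survivors.
        This explains 88 = 8 * 11 in the condition on \<kappa>.\<close>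
      ultimately have "(\<Sum>k=q..<m. w (xs ! k)) \<le> 11 * (\<kappa> * h)" by linarith
      also have "\<dots> \<le> 11 * (\<kappa> * (K * y))" using K \<kappa> by simp
      also have "\<dots> = (88 * K * \<kappa>) * (y / 8)" by simp
      also have "\<dots> \<le> 1 * (y / 8)" using \<kappa>(3) y by (intro mult_right_mono) auto
      finally show ?thesis by simp
    qed (use qm y in simp)
    define x where "x k = (if k < m then w (xs ! k) else 0)" for k
    have x_eq: "(\<Sum>k=s..<t. x k) = (\<Sum>k=s..<t. w (xs ! k))" if "t \<le> m" for s t
      using that by (intro sum.cong) (auto simp: x_def)
    have dvn: "\<bar>(\<Sum>k=i..<j. x k) - c i j\<bar> \<le> 2 * (y / 16) + real (q - p) * (8 * \<eta>) + y / 8"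
      unfolding c_def
    proof (rule window_deviation[OF q(1) ij, where R = "\<lambda>k. avg w w (I - set (take k xs))"])
      fix s assume s: "s \<in> {p..q}"
      \<comment> \<open>The martingale event was estimated for the first \<open>q\<close> draws
        only, so it refers to \<open>take q xs\<close>.\<close>
      have tk: "take k (take q xs) = take k xs" "take q xs ! k = xs ! k" if "k \<in> {p..<s}" for k
        using that s by (auto simp: min_def)
      have "\<forall>k\<in>{p..<s}. G (I - set (take k (take q xs)))" using Gk tk s by auto
      hence "\<not> y / 16 \<le> \<bar>\<Sum>k=p..<s. w (take q xs ! k) - avg w w (I - set (take k (take q xs)))\<bar>"
        using nb s unfolding bad_def EM_def by blast
      moreover have "(\<Sum>k=p..<s. x k - avg w w (I - set (take k xs)))
          = (\<Sum>k=p..<s. w (take q xs ! k) - avg w w (I - set (take k (take q xs))))"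
        using s qm tk by (intro sum.cong) (auto simp: x_def)
      ultimately show "\<bar>\<Sum>k=p..<s. x k - avg w w (I - set (take k xs))\<bar> \<le> y / 16" by simp
    next
      show "0 \<le> x k" for k
        using xs wnonneg by (auto simp: x_def dest: nth_mem)
      show "(\<Sum>k=q..<m. x k) \<le> y / 8" using tail_le x_eq[of m q] by simp
    qed (use dev \<eta> in auto)
    show ?thesis using dvn hK unfolding x_eq[OF ij(3)] window_sum_def by linarith
  qed
  have Pbad: "draws w m I (\<lambda>xs. of_bool (bad xs)) \<le> \<Omega>"
  proof -
    let ?s = "\<lambda>k xs. of_bool (\<eta> * f1 k / T \<le> d1 k xs) + of_bool (\<eta> * f1 k \<le> d2 k xs) :: real"
    have "draws w m I (\<lambda>xs. of_bool (bad xs))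
        \<le> draws w m I (\<lambda>xs. of_bool (EM (take q xs)) + (\<Sum>k=p..<q. ?s k xs)
          + of_bool (\<eta>' * g s \<le> heavy (take p xs)) + of_bool (q < m \<and> 8 * (\<kappa> * h) \<le> alive (take q xs)))"
    proof (rule draws_mono[OF pos])
      fix xs
      have s0: "0 \<le> (\<Sum>k=p..<q. ?s k xs)" by (intro sum_nonneg) auto
      have s1: "1 \<le> (\<Sum>k=p..<q. ?s k xs)"
        if "k \<in> {p..<q}" "\<eta> * f1 k / T \<le> d1 k xs \<or> \<eta> * f1 k \<le> d2 k xs" for k
      proof -
        have "?s k xs \<le> (\<Sum>k=p..<q. ?s k xs)" by (rule member_le_sum) (use that in auto)
        moreover have "1 \<le> ?s k xs" using that by auto
        ultimately show ?thesis by linarith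
      qed
      show "of_bool (bad xs) \<le> of_bool (EM (take q xs)) + (\<Sum>k=p..<q. ?s k xs)
          + of_bool (\<eta>' * g s \<le> heavy (take p xs)) + (of_bool (q < m \<and> 8 * (\<kappa> * h) \<le> alive (take q xs)) :: real)"
      proof (cases "\<exists>k\<in>{p..<q}. \<eta> * f1 k / T \<le> d1 k xs \<or> \<eta> * f1 k \<le> d2 k xs")
        case True
        then obtain k where "k \<in> {p..<q}" "\<eta> * f1 k / T \<le> d1 k xs \<or> \<eta> * f1 k \<le> d2 k xs" by blast
        from s1[OF this] have "1 \<le> (\<Sum>k=p..<q. ?s k xs)" .
        moreover have "(of_bool (bad xs) :: real) \<le> 1" by simp
        moreover have "0 \<le> (of_bool Q :: real)" for Q by simp
        ultimately show ?thesis by (smt (verit))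
      next
        case False
        thus ?thesis using s0 unfolding bad_def by auto
      qed
    qed
    also have "\<dots> \<le> 2 * exp (- (y / (32 * \<sigma> * u))) + (\<Sum>k=p..<q. 4 * E + 4 * E)
        + (exp (- (\<kappa> * h / (32 * C))) + exp (- (\<eta>' * \<kappa> * h / (32 * C * \<sigma>\<^sup>2 * u)))) + PU"
      unfolding draws_add draws_sum by (intro add_mono sum_mono PM PH PU P12) auto
    also have "(\<Sum>k=p..<q. 4 * E + 4 * E) \<le> 16 * h * E"
    proof -
      have "(\<Sum>k=p..<q. 4 * E + 4 * E) = real (q - p) * (8 * E)" by simp
      also have "\<dots> \<le> (2 * h) * (8 * E)" using h(2) qm by (intro mult_right_mono) (auto simp: E_def)
      finally show ?thesis by simp
    qed
    finally show ?thesis by (simp add: \<Omega>_def PU_def E_def)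
  qed
  have ctr: "\<bar>draws w m I (window_sum w i j) - c i j\<bar> \<le> y / 2" if ij: "p \<le> i" "i \<le> j" "j \<le> m" for i j
  proof -
    \<comment> \<open>Chosen so that the second moments cost at most 2 K y / (32 K) = y/16. The
      condition on \<open>\<beta>\<close> gives another y/16, and 3/8 + 1/8 = 1/2.\<close>
    define \<alpha> where "\<alpha> = a / (128 * K * C)"
    have \<alpha>: "0 < \<alpha>" using a0 K C by (simp add: \<alpha>_def)
    have ji: "real (j - i) \<le> 2 * (K * y)" using ij h(2) K(2) by auto
    have c0: "0 \<le> c i j" unfolding c_def using r by (intro sum_nonneg) auto
    have "c i j \<le> (\<Sum>k\<in>{i..<j} \<inter> {..<q}. T)" unfolding c_def using r by (intro sum_mono) auto
    also have "\<dots> \<le> real (j - i) * T"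
      using T0 card_mono[of "{i..<j}" "{i..<j} \<inter> {..<q}"] by (simp add: mult_right_mono)
    finally have cT: "c i j \<le> real (j - i) * T" .
    have b0: "0 \<le> \<beta>"
      using Pbad \<beta>(1) draws_nonneg_bool[OF pos, of m bad] by linarith
    have "\<bar>draws w m I (window_sum w i j) - c i j\<bar>
        \<le> 3 / 8 * y + real (j - i) * (\<alpha> * (4 * C / a) + \<beta> / (4 * \<alpha>)) + c i j * \<beta>"
    proof (rule expectation_off_bad[OF ij(2,3) pm(2) c0 _ \<alpha>])
      show "\<bar>window_sum w i j xs - c i j\<bar> \<le> 3 / 8 * y"
        if "length xs = m" "distinct xs" "set xs \<subseteq> I" "\<not> bad xs" for xs
        by (rule good[OF that ij])
      show "draws w m I (\<lambda>xs. of_bool (bad xs)) \<le> \<beta>" using Pbad \<beta>(1) by linarith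
    qed (use y in simp)
    also have "\<dots> \<le> 3 / 8 * y + real (j - i) * (\<alpha> * (4 * C / a) + \<beta> / (4 * \<alpha>)) + real (j - i) * T * \<beta>"
      using cT b0 by (intro add_left_mono mult_right_mono) auto
    also have "\<dots> = 3 / 8 * y + real (j - i) * (1 / (32 * K) + \<beta> * (32 * K * C / a + T))"
      using a0 K C by (simp add: \<alpha>_def field_simps)
    also have "\<dots> \<le> 3 / 8 * y + (2 * (K * y)) * (1 / (32 * K) + 1 / (32 * K))"
    proof (intro add_left_mono mult_mono)
      show "\<beta> * (32 * K * C / a + T) \<le> 1 / (32 * K)" using \<beta>(2) K by (simp add: field_simps)
    qed (use ji K y T0 C a0 b0 in \<open>auto intro!: add_nonneg_nonneg mult_nonneg_nonneg\<close>)
    also have "\<dots> = y / 2" using K by (simp add: field_simps)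
    finally show ?thesis .
  qed
  have "draws w m I (\<lambda>xs. of_bool (\<exists>i j. p \<le> i \<and> i \<le> j \<and> j \<le> m \<and>
      y \<le> \<bar>window_sum w i j xs - draws w m I (window_sum w i j)\<bar>))
      \<le> draws w m I (\<lambda>xs. of_bool (bad xs))"
  proof (rule draws_mono[OF pos])
    fix xs assume xs: "length xs = m" "distinct xs" "set xs \<subseteq> I"
    have "bad xs" if ij: "p \<le> i" "i \<le> j" "j \<le> m"
      "y \<le> \<bar>window_sum w i j xs - draws w m I (window_sum w i j)\<bar>" for i j
    proof (rule ccontr)
      assume "\<not> bad xs"
      from good[OF xs this ij(1-3)] ctr[OF ij(1-3)] ij(4) y show False by linarith
    qed
    thus "of_bool (\<exists>i j. p \<le> i \<and> i \<le> j \<and> j \<le> m \<and>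
      y \<le> \<bar>window_sum w i j xs - draws w m I (window_sum w i j)\<bar>) \<le> (of_bool (bad xs) :: real)"
      by auto
  qed
  thus ?thesis using Pbad by linarith
qed

end

subsection \<open>Consequences of the moment conditions\<close>

lemma conditions1_integral_conv:
  fixes g :: "real \<Rightarrow> real"
  assumes c: "conditions1 w M W" and g: "\<And>x. isCont g x" "\<And>x. norm (g x) \<le> B"
  shows "(\<lambda>n. (\<Sum>i=1..n. g (w n i)) / n) \<longlonglongrightarrow> (\<integral>x. g (W x) \<partial>M)"
proof -
  define \<mu> where "\<mu> n = distr (uniform_count_measure {1..n}) borel (w n)" for n
  interpret M: prob_space M using c by (simp add: conditions1_def)
  have W: "W \<in> borel_measurable M" using c by (simp add: conditions1_def)
  have wc: "weak_conv_m \<mu> (distr M borel W)" using c by (simp add: conditions1_def \<mu>_def[abs_def])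
  have meas: "w n \<in> borel_measurable (uniform_count_measure {1..n})" for n
    by (simp add: measurable_def uniform_count_measure_def point_measure_def space_count_space)
  have gm: "g \<in> borel_measurable borel"
    using g(1) by (intro borel_measurable_continuous_onI continuous_at_imp_continuous_on) auto
  \<comment> \<open>For n = 0 the uniform measure lives on the empty set and is no probability
    measure; the sequence is shifted by one.\<close>
  have "real_distribution (\<mu> (Suc n))" for n
  proof -
    interpret prob_space "uniform_count_measure {1..Suc n}"
      by (rule prob_space_uniform_count_measure) auto
    show ?thesis unfolding \<mu>_def by (rule real_distribution_distr[OF meas])
  qed
  moreover have "real_distribution (distr M borel W)" using W by simp
  moreover have "weak_conv_m (\<lambda>n. \<mu> (Suc n)) (distr M borel W)"
    using wc unfolding weak_conv_m_def weak_conv_def by (auto intro: LIMSEQ_Suc)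
  ultimately have conv: "(\<lambda>n. integral\<^sup>L (\<mu> (Suc n)) g) \<longlonglongrightarrow> integral\<^sup>L (distr M borel W) g"
    by (rule weak_conv_imp_integral_bdd_continuous_conv) (rule g)+
  have eq1: "integral\<^sup>L (\<mu> n) g = (\<Sum>i=1..n. g (w n i)) / n" for n
    unfolding \<mu>_def using integral_distr[OF meas gm, of n] by (simp add: integral_uniform_count_measure)
  have eq2: "integral\<^sup>L (distr M borel W) g = (\<integral>x. g (W x) \<partial>M)" by (rule integral_distr[OF W gm])
  from conv[unfolded eq1 eq2] show ?thesis by (rule LIMSEQ_imp_Suc)
qed

text \<open>\<open>g k\<close> is a continuous function equal to 1 up to 1/(k+1) on the positive
  axis and to 0 from 2/(k+1) on. As W > 0 almost surely, its expectation at W tends to 0, and weak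
  convergence carries a bound below 1/4 over to the empirical weights.\<close>

lemma conditions1_few_small:
  assumes c: "conditions1 w M W"
  shows "\<exists>a>0. \<forall>\<^sub>F n in sequentially. real (card {i\<in>{1..n}. w n i < a}) \<le> n / 4"
proof -
  interpret M: prob_space M using c by (simp add: conditions1_def)
  have W: "W \<in> borel_measurable M" and pos: "AE x in M. 0 < W x" using c by (auto simp: conditions1_def)
  define g where "g k x = max 0 (min 1 (2 - x * real (Suc k)))" for k and x :: real
  have gm: "g k \<in> borel_measurable borel" for k unfolding g_def by measurable
  have "(\<lambda>k. \<integral>x. g k (W x) \<partial>M) \<longlonglongrightarrow> (\<integral>x. 0 \<partial>M)"
  proof (rule integral_dominated_convergence[where w = "\<lambda>_. 1"])
    show "(\<lambda>x. g k (W x)) \<in> borel_measurable M" for k by (rule measurable_compose[OF W gm])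
    show "AE x in M. (\<lambda>k. g k (W x)) \<longlonglongrightarrow> 0"
      using pos
    proof eventually_elim
      case (elim x)
      obtain N :: nat where N: "2 / W x < N" using reals_Archimedean2 by blast
      have "\<forall>\<^sub>F k in sequentially. g k (W x) = 0"
        using eventually_ge_at_top[of N]
      proof eventually_elim
        case (elim k)
        have "2 < W x * N" using N \<open>0 < W x\<close> by (simp add: field_simps)
        also have "\<dots> \<le> W x * Suc k" using elim \<open>0 < W x\<close> by (intro mult_left_mono) auto
        finally show "g k (W x) = 0" by (simp add: g_def)
      qed
      thus ?case by (rule tendsto_eventually)
    qed
    show "AE x in M. norm (g k (W x)) \<le> 1" for k by (auto simp: g_def)
  qed auto
  hence "\<forall>\<^sub>F k in sequentially. (\<integral>x. g k (W x) \<partial>M) < 1 / 4"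
    by (intro order_tendstoD(2)[of _ 0]) auto
  then obtain k where k: "(\<integral>x. g k (W x) \<partial>M) < 1 / 4" using eventually_sequentially by auto
  have "(\<lambda>n. (\<Sum>i=1..n. g k (w n i)) / n) \<longlonglongrightarrow> (\<integral>x. g k (W x) \<partial>M)"
  proof (rule conditions1_integral_conv[OF c])
    show "isCont (g k) x" for x unfolding g_def by (intro continuous_intros)
    show "norm (g k x) \<le> 1" for x by (auto simp: g_def)
  qed
  from order_tendstoD(2)[OF this k]
  have "\<forall>\<^sub>F n in sequentially. (\<Sum>i=1..n. g k (w n i)) / n < 1 / 4" .
  hence "\<forall>\<^sub>F n in sequentially. real (card {i\<in>{1..n}. w n i < 1 / Suc k}) \<le> n / 4"
    using eventually_gt_at_top[of 0]
  proof eventually_elim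
    case (elim n)
    have "real (card {i\<in>{1..n}. w n i < 1 / Suc k}) = (\<Sum>i\<in>{i\<in>{1..n}. w n i < 1 / Suc k}. 1)" by simp
    also have "\<dots> \<le> (\<Sum>i\<in>{i\<in>{1..n}. w n i < 1 / Suc k}. g k (w n i))"
      by (intro sum_mono) (auto simp: g_def field_simps)
    also have "\<dots> \<le> (\<Sum>i=1..n. g k (w n i))" by (intro sum_mono2) (auto simp: g_def)
    also have "\<dots> \<le> n / 4" using elim by (simp add: field_simps)
    finally show ?case .
  qed
  thus ?thesis by (intro exI[of _ "1 / real (Suc k)"]) auto
qed

lemma smallo_affine_le:
  fixes f g :: "nat \<Rightarrow> real"
  assumes "(\<lambda>n. f n - c * real n) \<in> o(g)" and "\<And>n. 1 \<le> n \<Longrightarrow> \<bar>g n\<bar> \<le> n"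
  shows "\<forall>\<^sub>F n in sequentially. f n \<le> (\<bar>c\<bar> + 1) * n"
proof -
  have "\<forall>\<^sub>F n in sequentially. norm (f n - c * real n) \<le> 1 * norm (g n)"
    by (rule landau_o.smallD[OF assms(1)]) simp
  thus ?thesis using eventually_ge_at_top[of 1]
  proof eventually_elim
    case (elim n)
    have "c * n \<le> \<bar>c\<bar> * n" by (intro mult_right_mono) auto
    moreover have "\<bar>f n - c * real n\<bar> \<le> \<bar>g n\<bar>" "\<bar>g n\<bar> \<le> n" using elim assms(2)[of n] by auto
    ultimately show ?case unfolding distrib_right mult_1 by linarith
  qed
qed

lemma weight_vectors_pos: "weight_vectors w \<Longrightarrow> pos_weights (w n) {1..n}"
  by (simp add: weight_vectors_def pos_weights_def)

lemma conditions1_profile: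
  assumes wv: "weight_vectors w" and c: "conditions1 w M W"
  shows "\<exists>a b C. \<forall>\<^sub>F n in sequentially. weight_profile (w n) n a b C"
proof -
  obtain a where a: "a > 0" "\<forall>\<^sub>F n in sequentially. real (card {i\<in>{1..n}. w n i < a}) \<le> n / 4"
    using conditions1_few_small[OF c] by blast
  define C where "C = 1 + \<bar>\<integral>x. W x \<partial>M\<bar> + \<bar>\<integral>x. W x ^ 2 \<partial>M\<bar> + \<bar>\<integral>x. W x ^ 3 \<partial>M\<bar>"
  \<comment> \<open>Markov's inequality: at most C n / b <= n/4 weights exceed
    \<open>b\<close>.\<close>
  define b where "b = max a (4 * C)"
  have g: "\<bar>real n powr (2/3)\<bar> \<le> n" if "1 \<le> n" for n
    using powr_mono[of "2/3" 1 "real n"] that by simp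
  have 1: "\<forall>\<^sub>F n in sequentially. (\<Sum>i=1..n. w n i) \<le> (\<bar>\<integral>x. W x \<partial>M\<bar> + 1) * n"
    using c by (intro smallo_affine_le[OF _ g]) (auto simp: conditions1_def total_weight_def)
  have 2: "\<forall>\<^sub>F n in sequentially. (\<Sum>i=1..n. (w n i)\<^sup>2) \<le> (\<bar>\<integral>x. W x ^ 2 \<partial>M\<bar> + 1) * n"
    using c by (intro smallo_affine_le[OF _ g]) (auto simp: conditions1_def)
  have 3: "\<forall>\<^sub>F n in sequentially. (\<Sum>i=1..n. (w n i) ^ 3) \<le> (\<bar>\<integral>x. W x ^ 3 \<partial>M\<bar> + 1) * n"
    using c by (intro smallo_affine_le[of _ _ "\<lambda>_. 1"]) (auto simp: conditions1_def)
  have "\<forall>\<^sub>F n in sequentially. weight_profile (w n) n a b C"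
    using a(2) 1 2 3 eventually_ge_at_top[of 1]
  proof eventually_elim
    case (elim n)
    have pos: "pos_weights (w n) {1..n}" by (rule weight_vectors_pos[OF wv])
    have b: "0 < b" "4 * C \<le> b" using a by (auto simp: b_def)
    have C: "(\<bar>\<integral>x. W x \<partial>M\<bar> + 1) * n \<le> C * n" "(\<bar>\<integral>x. W x ^ 2 \<partial>M\<bar> + 1) * n \<le> C * n"
      "(\<bar>\<integral>x. W x ^ 3 \<partial>M\<bar> + 1) * n \<le> C * n" by (auto simp: C_def intro!: mult_right_mono)
    have "b * card {i\<in>{1..n}. b < w n i} = (\<Sum>i\<in>{i\<in>{1..n}. b < w n i}. b)" by simp
    also have "\<dots> \<le> (\<Sum>i\<in>{i\<in>{1..n}. b < w n i}. w n i)" by (intro sum_mono) auto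
    also have "\<dots> \<le> (\<Sum>i=1..n. w n i)"
      using pos_weightsD[OF pos] by (intro sum_mono2) (auto intro: less_imp_le)
    also have "\<dots> \<le> C * n" using elim(2) C by linarith
    also have "\<dots> = (4 * C) * (n / 4)" by simp
    also have "\<dots> \<le> b * (n / 4)" using b by (intro mult_right_mono) auto
    finally have few: "real (card {i\<in>{1..n}. b < w n i}) \<le> n / 4" using b by simp
    have "a \<le> b" "1 \<le> C" by (auto simp: b_def C_def)
    thus ?case
      using pos elim(1,5) few a(1) order_trans[OF elim(2) C(1)] order_trans[OF elim(3) C(2)]
        order_trans[OF elim(4) C(3)]
      by (intro weight_profile.intro)
  qed
  thus ?thesis by blast
qed

text \<open>Uniform integrability of the cubes. Weak convergence gives the limit of a truncated
  third moment, condition (vi) that of the full one; the tail is at most their difference.\<close>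

lemma conditions1_tail:
  fixes \<epsilon> T0 :: real
  assumes wv: "weight_vectors w" and c: "conditions1 w M W" and \<epsilon>: "0 < \<epsilon>"
  shows "\<exists>T\<ge>T0. \<forall>\<^sub>F n in sequentially. (\<Sum>i=1..n. if w n i \<le> T then 0 else (w n i) ^ 3) \<le> \<epsilon> * n"
proof -
  interpret M: prob_space M using c by (simp add: conditions1_def)
  have W: "W \<in> borel_measurable M" and pos: "AE x in M. 0 < W x"
    and int: "integrable M (\<lambda>x. W x ^ 3)" using c by (auto simp: conditions1_def)
  \<comment> \<open>A continuous bounded substitute for the truncated cube: for k >= 1 it equals x^3
    on [0, k - 1], and it vanishes from k on.\<close>
  define g where "g k x = (max 0 (min x (real k))) ^ 3 * max 0 (min 1 (real k - x))" for k and x :: real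
  have gm: "g k \<in> borel_measurable borel" for k unfolding g_def by measurable
  have g_le: "0 \<le> g k x \<and> g k x \<le> (if x \<le> k then x ^ 3 else 0)" if "0 < x" for k x
  proof -
    have "g k x \<le> x ^ 3 * 1" unfolding g_def using that by (intro mult_mono power_mono) auto
    moreover have "g k x = 0" if "\<not> x \<le> k" using that by (simp add: g_def)
    moreover have "0 \<le> g k x" unfolding g_def by (intro mult_nonneg_nonneg zero_le_power) auto
    ultimately show ?thesis by auto
  qed
  have "(\<lambda>k. \<integral>x. g k (W x) \<partial>M) \<longlonglongrightarrow> (\<integral>x. W x ^ 3 \<partial>M)"
  proof (rule integral_dominated_convergence[where w = "\<lambda>x. \<bar>W x ^ 3\<bar>"])
    show "(\<lambda>x. g k (W x)) \<in> borel_measurable M" for k by (rule measurable_compose[OF W gm])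
    show "AE x in M. (\<lambda>k. g k (W x)) \<longlonglongrightarrow> W x ^ 3"
      using pos
    proof eventually_elim
      case (elim x)
      obtain N :: nat where N: "W x + 1 < N" using reals_Archimedean2 by blast
      have "\<forall>\<^sub>F k in sequentially. g k (W x) = W x ^ 3"
        using eventually_ge_at_top[of N]
      proof eventually_elim
        case k: (elim k)
        have "W x + 1 < k" using k N by (meson less_le_trans of_nat_le_iff)
        thus "g k (W x) = W x ^ 3" using elim by (simp add: g_def min_def max_def)
      qed
      thus ?case by (rule tendsto_eventually)
    qed
    show "AE x in M. norm (g k (W x)) \<le> \<bar>W x ^ 3\<bar>" for k
      using pos
    proof eventually_elim
      case (elim x)
      have "0 \<le> W x ^ 3" using elim by simp
      thus ?case using g_le[OF elim, of k] by (auto split: if_splits)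
    qed
  qed (use int W in auto)
  hence "\<forall>\<^sub>F k in sequentially. (\<integral>x. W x ^ 3 \<partial>M) - \<epsilon> / 4 < (\<integral>x. g k (W x) \<partial>M)"
    by (rule order_tendstoD(1)) (use \<epsilon> in auto)
  moreover have "\<forall>\<^sub>F k :: nat in sequentially. nat \<lceil>T0\<rceil> \<le> k" by (rule eventually_ge_at_top)
  ultimately have "\<forall>\<^sub>F k in sequentially. (\<integral>x. W x ^ 3 \<partial>M) - \<epsilon> / 4 < (\<integral>x. g k (W x) \<partial>M) \<and> nat \<lceil>T0\<rceil> \<le> k"
    by (rule eventually_conj)
  then obtain k where k: "(\<integral>x. W x ^ 3 \<partial>M) - \<epsilon> / 4 < (\<integral>x. g k (W x) \<partial>M)" "T0 \<le> real k"
    unfolding eventually_sequentially by (auto simp: nat_ceiling_le_eq)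
  have "(\<lambda>n. (\<Sum>i=1..n. g k (w n i)) / n) \<longlonglongrightarrow> (\<integral>x. g k (W x) \<partial>M)"
  proof (rule conditions1_integral_conv[OF c])
    show "isCont (g k) x" for x unfolding g_def by (intro continuous_intros)
    show "norm (g k x) \<le> real k ^ 3 * 1" for x
    proof -
      have "g k x \<le> real k ^ 3 * 1" unfolding g_def by (intro mult_mono power_mono) auto
      moreover have "0 \<le> g k x" unfolding g_def by (intro mult_nonneg_nonneg zero_le_power) auto
      ultimately show ?thesis by simp
    qed
  qed
  from order_tendstoD(1)[OF this k(1)]
  have ev1: "\<forall>\<^sub>F n in sequentially. (\<integral>x. W x ^ 3 \<partial>M) - \<epsilon> / 4 < (\<Sum>i=1..n. g k (w n i)) / n" .
  have "(\<lambda>n. (\<Sum>k=1..n. w n k ^ 3) - (\<integral>x. W x ^ 3 \<partial>M) * real n) \<in> o(\<lambda>_. 1)"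
    using c by (simp add: conditions1_def)
  from landau_o.smallD[OF this, of 1]
  have ev2: "\<forall>\<^sub>F n in sequentially. \<bar>(\<Sum>k=1..n. w n k ^ 3) - (\<integral>x. W x ^ 3 \<partial>M) * real n\<bar> \<le> 1" by simp
  have ev3: "\<forall>\<^sub>F n in sequentially. 4 / \<epsilon> \<le> real n" by (rule eventually_compose_filterlim[OF eventually_ge_at_top filterlim_real_sequentially])
  have "\<forall>\<^sub>F n in sequentially. (\<Sum>i=1..n. if w n i \<le> real k then 0 else (w n i) ^ 3) \<le> \<epsilon> * n"
    using ev1 ev2 ev3 eventually_gt_at_top[of 0]
  proof eventually_elim
    case (elim n)
    have "(\<Sum>i=1..n. if w n i \<le> real k then 0 else (w n i) ^ 3) \<le> (\<Sum>i=1..n. (w n i) ^ 3 - g k (w n i))"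
    proof (rule sum_mono)
      fix i assume "i \<in> {1..n}"
      hence "0 < w n i" using weight_vectors_pos[OF wv, of n] by (auto simp: pos_weights_def)
      from g_le[OF this, of k] show "(if w n i \<le> real k then 0 else (w n i) ^ 3) \<le> (w n i) ^ 3 - g k (w n i)"
        by auto
    qed
    also have "\<dots> = (\<Sum>i=1..n. (w n i) ^ 3) - (\<Sum>i=1..n. g k (w n i))" by (rule sum_subtractf)
    also have "\<dots> \<le> ((\<integral>x. W x ^ 3 \<partial>M) * n + 1) - ((\<integral>x. W x ^ 3 \<partial>M) - \<epsilon> / 4) * n"
    proof (rule diff_mono)
      show "(\<Sum>i=1..n. (w n i) ^ 3) \<le> (\<integral>x. W x ^ 3 \<partial>M) * n + 1" using elim(2) by linarith
      show "((\<integral>x. W x ^ 3 \<partial>M) - \<epsilon> / 4) * n \<le> (\<Sum>i=1..n. g k (w n i))"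
        using elim(1,4) by (simp add: field_simps)
    qed
    also have "\<dots> = 1 + \<epsilon> / 4 * n" by (simp add: algebra_simps)
    also have "\<dots> \<le> \<epsilon> * n"
    proof -
      have "4 \<le> \<epsilon> * n" using elim(3) \<epsilon> by (simp add: field_simps)
      thus ?thesis by simp
    qed
    finally show ?case .
  qed
  thus ?thesis using k(2) by blast
qed

lemma conditions1_max:
  assumes wv: "weight_vectors w" and c: "conditions1 w M W" and \<zeta>: "0 < \<zeta>"
  shows "\<forall>\<^sub>F n in sequentially. \<forall>i\<in>{1..n}. w n i \<le> \<zeta> * real n powr (1/3)"
proof -
  have "(\<lambda>n. Max (w n ` {1..n})) \<in> o(\<lambda>n. real n powr (1/3))" using c by (simp add: conditions1_def)
  from landau_o.smallD[OF this \<zeta>]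
  have "\<forall>\<^sub>F n in sequentially. norm (Max (w n ` {1..n})) \<le> \<zeta> * norm (real n powr (1/3))" .
  thus ?thesis
  proof eventually_elim
    case (elim n)
    show ?case
    proof
      fix i assume "i \<in> {1..n}"
      hence "w n i \<le> Max (w n ` {1..n})" by (intro Max_ge) auto
      thus "w n i \<le> \<zeta> * real n powr (1/3)" using elim by simp
    qed
  qed
qed

subsection \<open>Assembling the estimates\<close>

text \<open>The supremum runs over a finite nonempty set of pairs and is attained. Only the larger
  event, stated in terms of the list of draws, is shown to be measurable, and monotonicity of the
  measure asks for no more.\<close>

lemma prob_sup_le_draws:
  assumes sb: "size_biased_permutation P n w v" and w: "pos_weights w {1..n}" and lm: "1 \<le> l" "l \<le> m" "m \<le> n"
  shows "\<P>(\<omega> in P. (SUP (i, j)\<in>{(i, j). l \<le> i \<and> i \<le> j \<and> j \<le> m}.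
      \<bar>(\<Sum>k=i..j. w (v \<omega> k)) - (\<integral>\<omega>'. (\<Sum>k=i..j. w (v \<omega>' k)) \<partial>P)\<bar>) \<ge> y)
    \<le> draws w m {1..n} (\<lambda>xs. of_bool (\<exists>i j. l - 1 \<le> i \<and> i \<le> j \<and> j \<le> m \<and>
      y \<le> \<bar>window_sum w i j xs - draws w m {1..n} (window_sum w i j)\<bar>))"
proof -
  interpret prob_space P using sb by (simp add: size_biased_permutation_def)
  define X where "X \<omega> = map (v \<omega>) [1..<Suc m]" for \<omega>
  define Q where "Q xs \<longleftrightarrow> (\<exists>i j. l - 1 \<le> i \<and> i \<le> j \<and> j \<le> m \<and>
      y \<le> \<bar>window_sum w i j xs - draws w m {1..n} (window_sum w i j)\<bar>)" for xs
  have v: "v \<in> measurable P (count_space {\<pi>. \<pi> permutes {1..n}})"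
    using sb by (simp add: size_biased_permutation_def)
  have ev: "{\<omega> \<in> space P. Q (X \<omega>)} \<in> events"
    unfolding X_def by (rule measurable_sets_Collect[OF v]) auto
  \<comment> \<open>The one-based closed range from i to j becomes the zero-based half-open range
    from i - 1 to j.\<close>
  have ws: "(\<Sum>k=i..j. w (v \<omega> k)) = window_sum w (i - 1) j (X \<omega>)" if "l \<le> i" "i \<le> j" "j \<le> m" for i j \<omega>
    unfolding window_sum_def
    by (rule sum.reindex_bij_witness[of _ Suc "\<lambda>k. k - 1"])
      (use that lm in \<open>auto simp: X_def nth_append simp del: upt_Suc\<close>)
  have sub: "{\<omega> \<in> space P. y \<le> (SUP (i, j)\<in>{(i, j). l \<le> i \<and> i \<le> j \<and> j \<le> m}.
      \<bar>(\<Sum>k=i..j. w (v \<omega> k)) - (\<integral>\<omega>'. (\<Sum>k=i..j. w (v \<omega>' k)) \<partial>P)\<bar>)} \<subseteq> {\<omega> \<in> space P. Q (X \<omega>)}"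
  proof safe
    fix \<omega>
    let ?A = "{(i, j). l \<le> i \<and> i \<le> j \<and> j \<le> m}"
    let ?f = "\<lambda>(i, j). \<bar>(\<Sum>k=i..j. w (v \<omega> k)) - (\<integral>\<omega>'. (\<Sum>k=i..j. w (v \<omega>' k)) \<partial>P)\<bar>"
    assume "y \<le> (SUP z\<in>?A. ?f z)"
    moreover have fin: "finite ?A" by (rule finite_subset[of _ "{..m} \<times> {..m}"]) auto
    moreover have ne: "?A \<noteq> {}" using lm by auto
    ultimately have "y \<le> Max (?f ` ?A)" by (simp add: cSup_eq_Max)
    then obtain i j where ij: "l \<le> i" "i \<le> j" "j \<le> m" "y \<le> ?f (i, j)"
      using Max_ge_iff[of "?f ` ?A" y] fin ne by auto
    have "(\<integral>\<omega>'. (\<Sum>k=i..j. w (v \<omega>' k)) \<partial>P) = (\<integral>\<omega>'. window_sum w (i - 1) j (X \<omega>') \<partial>P)"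
      unfolding ws[OF ij(1-3)] ..
    also have "\<dots> = draws w m {1..n} (window_sum w (i - 1) j)"
      unfolding X_def by (rule integral_prefix_eq_draws[OF sb w lm(3)])
    finally have "y \<le> \<bar>window_sum w (i - 1) j (X \<omega>) - draws w m {1..n} (window_sum w (i - 1) j)\<bar>"
      using ij(4) ws[OF ij(1-3), of \<omega>] by simp
    moreover have "l - 1 \<le> i - 1" "i - 1 \<le> j" using ij by auto
    ultimately show "Q (X \<omega>)" unfolding Q_def using ij(3) by blast
  qed
  have "prob {\<omega> \<in> space P. Q (X \<omega>)} = (\<integral>\<omega>. of_bool (Q (X \<omega>)) \<partial>P)"
  proof -
    have "(\<integral>\<omega>. of_bool (Q (X \<omega>)) \<partial>P) = (\<integral>\<omega>. indicator {\<omega> \<in> space P. Q (X \<omega>)} \<omega> \<partial>P :: real)"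
      by (rule Bochner_Integration.integral_cong) (auto simp: indicator_def)
    thus ?thesis using ev by simp
  qed
  also have "\<dots> = draws w m {1..n} (\<lambda>xs. of_bool (Q xs))"
    unfolding X_def by (rule integral_prefix_eq_draws[OF sb w lm(3)])
  finally show ?thesis using finite_measure_mono[OF sub ev] by (simp add: Q_def)
qed

section \<open>Asymptotics of the error terms\<close>

lemma eventually_linear_times_exp_le:
  fixes c d e :: real
  assumes "0 < c" "0 < e"
  shows "\<forall>\<^sub>F n :: nat in sequentially. d * n * exp (- (c * real n powr (1/3))) \<le> e"
proof -
  have "((\<lambda>n :: nat. d * n * exp (- (c * real n powr (1/3)))) \<longlongrightarrow> 0) sequentially"
    using assms(1) by real_asymp
  from order_tendstoD(2)[OF this assms(2)] show ?thesis by (rule eventually_mono) simp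
qed

text \<open>The denominator has the form of the factors built from the logarithmic clock time; ln n
  on the left pays for a union bound over the draws.\<close>

lemma eventually_ln_le_root_div_ln:
  fixes c1 c2 c3 c4 M :: real
  assumes "0 < c1" "0 < c2" "0 < c3"
  shows "\<forall>\<^sub>F n :: nat in sequentially. M + ln (16 * real n) \<le> c1 / (c4 + c2 * ln (c3 * n)) * real n powr (1/3)"
proof -
  have "filterlim (\<lambda>n :: nat. c1 / (c4 + c2 * ln (c3 * n)) * real n powr (1/3) - ln (16 * real n)) at_top sequentially"
    using assms by real_asymp
  hence "\<forall>\<^sub>F n in sequentially. M \<le> c1 / (c4 + c2 * ln (c3 * real n)) * real n powr (1/3) - ln (16 * real n)"
    unfolding filterlim_at_top by blast
  thus ?thesis by (rule eventually_mono) simp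
qed

lemma eventually_le_root:
  fixes c M :: real
  assumes "0 < c"
  shows "\<forall>\<^sub>F n :: nat in sequentially. M \<le> c * real n powr (1/3)"
proof -
  have "filterlim (\<lambda>n :: nat. c * real n powr (1/3)) at_top sequentially"
    using assms by real_asymp
  thus ?thesis unfolding filterlim_at_top by blast
qed

text \<open>One large exponent pays three times: exp (- N) for a polynomial prefactor, \<beta> / 16
  for smallness, and exp (- v) for the target. The factor \<open>v\<close> in the hypothesis lets a
  bound at v = 1 serve all larger v.\<close>

lemma exp_neg_le_split:
  fixes v X \<beta> N :: real
  assumes v: "1 \<le> v" and \<beta>: "0 < \<beta>" "\<beta> \<le> 1" and N: "0 \<le> N" and X: "v * (1 + ln (16 / \<beta>) + N) \<le> X"
  shows "exp (- X) \<le> exp (- N) * (\<beta> / 16) * exp (- v)"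
proof -
  have l: "0 \<le> ln (16 / \<beta>)" using \<beta> by simp
  have "1 * (ln (16 / \<beta>) + N) \<le> v * (ln (16 / \<beta>) + N)" using v l N by (intro mult_right_mono) auto
  hence "v + ln (16 / \<beta>) + N \<le> X" using X by (simp add: algebra_simps)
  hence "exp (- X) \<le> exp (- N + (- ln (16 / \<beta>)) + (- v))" by simp
  also have "\<dots> = exp (- N) * (\<beta> / 16) * exp (- v)" unfolding exp_add using \<beta> by (simp add: exp_minus)
  finally show ?thesis .
qed

lemma exp_neg_ratio_le:
  fixes y u h A :: real
  assumes "0 < y" "0 < u" "0 \<le> h" "1 \<le> A"
  shows "exp (- (y / u)) \<le> exp (- y\<^sup>2 / (A * (y * u + h)))"
proof -
  have yu: "0 < y * u" using assms by simp
  have "y * u \<le> y * u + h" using assms by simp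
  also have "\<dots> \<le> A * (y * u + h)" using assms yu mult_right_mono[of 1 A "y * u + h"] by simp
  finally have "y * u \<le> A * (y * u + h)" .
  hence "y\<^sup>2 / (A * (y * u + h)) \<le> y\<^sup>2 / (y * u)"
    using yu by (intro divide_left_mono[OF _ zero_le_power2] mult_pos_pos[OF _ yu]) auto
  also have "\<dots> = y / u" using assms by (simp add: power2_eq_square)
  finally show ?thesis by simp
qed

definition deviation_prob :: "(nat \<Rightarrow> real) \<Rightarrow> nat \<Rightarrow> nat \<Rightarrow> nat \<Rightarrow> real \<Rightarrow> real" where
  "deviation_prob w n p m y = draws w m {1..n} (\<lambda>xs. of_bool (\<exists>i j. p \<le> i \<and> i \<le> j \<and> j \<le> m \<and>
      y \<le> \<bar>window_sum w i j xs - draws w m {1..n} (window_sum w i j)\<bar>))"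

section \<open>Choice of the constants for large n\<close>

lemma bulk_eventually:
  fixes w :: "nat \<Rightarrow> nat \<Rightarrow> real" and l m :: "nat \<Rightarrow> nat" and y :: "nat \<Rightarrow> real" and a b C K :: real
  assumes wv: "weight_vectors w" and c: "conditions1 w M W"
    and prof: "\<forall>\<^sub>F n in sequentially. weight_profile (w n) n a b C" and K: "1 \<le> K"
    and lm: "\<forall>\<^sub>F n in sequentially. 1 \<le> l n \<and> l n \<le> m n \<and> m n \<le> n"
    and h: "\<forall>\<^sub>F n in sequentially. 1 \<le> real (m n) - real (l n)"
    and yu: "\<forall>\<^sub>F n in sequentially. real n powr (1/3) \<le> y n"
    and mh: "\<forall>\<^sub>F n in sequentially. real (m n) * (real (m n) - real (l n)) \<le> K * y n * n"
  shows "\<forall>\<^sub>F n in sequentially. 2 * m n \<le> n \<longrightarrow> deviation_prob (w n) n (l n - 1) (m n) (y n)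
    \<le> 2 * exp (- (y n)\<^sup>2 / (16 * (1 + 128 * C / a) * (y n * real n powr (1/3) + (real (m n) - real (l n)))))
      + 2 * exp (- (y n / real n powr (1/3)))"
proof -
  obtain n0 where "weight_profile (w n0) n0 a b C" using prof by (auto simp: eventually_sequentially)
  then interpret P0: weight_profile "w n0" n0 a b C .
  have a: "0 < a" and C: "1 \<le> C" using P0.ab P0.C by auto
  \<comment> \<open>Order of choice: \<epsilon> from \<open>a\<close> and \<open>K\<close>, then the
    truncation \<open>T\<close> from \<epsilon>, then \<gamma> from \<open>T\<close>, and only then
    n large.\<close>
  define \<epsilon> where "\<epsilon> = min (a\<^sup>2 / (8192 * K)) (a / (512 * K))"
  have \<epsilon>: "0 < \<epsilon>" "8192 * K * \<epsilon> \<le> a\<^sup>2" "512 * K * \<epsilon> \<le> a"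
  proof -
    show "0 < \<epsilon>" using a K by (simp add: \<epsilon>_def)
    have "\<epsilon> \<le> a\<^sup>2 / (8192 * K)" "\<epsilon> \<le> a / (512 * K)" by (auto simp: \<epsilon>_def)
    thus "8192 * K * \<epsilon> \<le> a\<^sup>2" "512 * K * \<epsilon> \<le> a" using K by (simp_all add: field_simps)
  qed
  define \<zeta> where "\<zeta> = min 1 (a / 1024)"
  have \<zeta>: "0 < \<zeta>" "\<zeta> \<le> 1" "1024 * \<zeta> \<le> a" using a by (auto simp: \<zeta>_def min_def)
  obtain T where T: "max 1 (max b (2 * C * exp (2 * b / a) / a)) \<le> T"
    and tail: "\<forall>\<^sub>F n in sequentially. (\<Sum>i=1..n. if w n i \<le> T then 0 else (w n i) ^ 3) \<le> \<epsilon> * n"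
    using conditions1_tail[OF wv c \<epsilon>(1)] by blast
  define \<gamma> where "\<gamma> = a / (4096 * T\<^sup>2 * (1 + 512 * K * T\<^sup>2 / a))"
  have \<gamma>: "0 < \<gamma>" using a K T by (auto simp: \<gamma>_def intro!: divide_pos_pos mult_pos_pos add_pos_nonneg)
  \<comment> \<open>Half of the exponent \<gamma> y pays for the factor 8 n; the other half exceeds
    y / n^(1/3) as soon as n^(1/3) >= 2 / \<gamma>.\<close>
  have s1: "\<forall>\<^sub>F n in sequentially. 8 * real n * exp (- (\<gamma> / 2 * real n powr (1/3))) \<le> 1"
    by (rule eventually_linear_times_exp_le) (use \<gamma> in auto)
  have s2: "\<forall>\<^sub>F n in sequentially. 2048 * T * C * real n * exp (- (\<gamma> * real n powr (1/3))) \<le> a"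
    by (rule eventually_linear_times_exp_le) (use \<gamma> a in auto)
  have s3: "\<forall>\<^sub>F n :: nat in sequentially. 2 / \<gamma> + 1 \<le> 1 * real n powr (1/3)"
    by (rule eventually_le_root) simp
  show ?thesis
    using prof lm h yu mh tail s1 s2 s3 conditions1_max[OF wv c \<zeta>(1)]
  proof eventually_elim
    case (elim n)
    interpret weight_profile "w n" n a b C by (rule elim(1))
    define u where "u = real n powr (1/3)"
    have u: "1 \<le> u" "2 / \<gamma> \<le> u" using elim(9) \<gamma> by (auto simp: u_def intro: order_trans[rotated])
    have u0: "0 < u" using u by simp
    have y: "u \<le> y n" "1 \<le> y n" using elim(4) u by (auto simp: u_def)
    have small1: "8 * n * exp (- (\<gamma> * y n)) \<le> exp (- (y n / u))"
    proof -
      have "8 * n * exp (- (\<gamma> * y n)) = (8 * n * exp (- (\<gamma> / 2 * y n))) * exp (- (\<gamma> / 2 * y n))"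
        by (simp add: exp_add[symmetric])
      also have "\<dots> \<le> (8 * n * exp (- (\<gamma> / 2 * u))) * exp (- (y n / u))"
      proof (intro mult_mono)
        have "1 / u \<le> \<gamma> / 2" using u(2) u0 \<gamma> by (simp add: field_simps)
        hence "1 / u * y n \<le> \<gamma> / 2 * y n" using y by (intro mult_right_mono) auto
        thus "exp (- (\<gamma> / 2 * y n)) \<le> exp (- (y n / u))" by simp
      qed (use y \<gamma> in auto)
      also have "\<dots> \<le> 1 * exp (- (y n / u))"
        using elim(7) unfolding u_def by (intro mult_right_mono) auto
      finally show ?thesis by simp
    qed
    have small2: "2048 * T * C * n * exp (- (\<gamma> * y n)) \<le> a * y n"
    proof -
      have "2048 * T * C * n * exp (- (\<gamma> * y n)) \<le> 2048 * T * C * n * exp (- (\<gamma> * u))"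
        using y \<gamma> T C by (intro mult_left_mono) auto
      also have "\<dots> \<le> a * 1" using elim(8) by (simp add: u_def)
      also have "\<dots> \<le> a * y n" using y a by (intro mult_left_mono) auto
      finally show ?thesis .
    qed
    show ?case
    proof
      assume m: "2 * m n \<le> n"
      have "deviation_prob (w n) n (l n - 1) (m n) (y n)
          \<le> 2 * exp (- (y n)\<^sup>2 / (16 * (1 + 128 * C / a) * (y n * u + (real (m n) - real (l n)))))
            + 2 * exp (- (y n / u))"
        unfolding deviation_prob_def
      proof (rule bulk_window[where T = T and K = K and \<epsilon> = \<epsilon> and \<zeta> = \<zeta>])
        show "real (m n - (l n - 1)) \<le> 2 * (real (m n) - real (l n))"
          using elim(2,3) by (simp add: of_nat_diff)
        show "8 * n * exp (- (a / (4096 * T\<^sup>2 * (1 + 512 * K * T\<^sup>2 / a)) * y n)) \<le> exp (- (y n / u))"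
          using small1 by (simp add: \<gamma>_def)
        show "2048 * T * C * n * exp (- (a / (4096 * T\<^sup>2 * (1 + 512 * K * T\<^sup>2 / a)) * y n)) \<le> a * y n"
          using small2 by (simp add: \<gamma>_def)
        show "w n i \<le> \<zeta> * u" if "i \<in> {1..n}" for i using elim(10) that by (simp add: u_def)
        show "real (m n) * (real (m n) - real (l n)) \<le> K * y n * n" by (rule elim(5))
      qed (use elim(2,3,6) m y u0 K T \<epsilon> \<zeta> in auto)
      thus "deviation_prob (w n) n (l n - 1) (m n) (y n)
          \<le> 2 * exp (- (y n)\<^sup>2 / (16 * (1 + 128 * C / a) * (y n * real n powr (1/3) + (real (m n) - real (l n)))))
            + 2 * exp (- (y n / real n powr (1/3)))" by (simp add: u_def)
    qed
  qed
qed

lemma end_eventually: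
  fixes w :: "nat \<Rightarrow> nat \<Rightarrow> real" and l m :: "nat \<Rightarrow> nat" and y :: "nat \<Rightarrow> real" and a b C K :: real
  assumes wv: "weight_vectors w" and c: "conditions1 w M W"
    and prof: "\<forall>\<^sub>F n in sequentially. weight_profile (w n) n a b C" and K: "1 \<le> K"
    and lm: "\<forall>\<^sub>F n in sequentially. 1 \<le> l n \<and> l n \<le> m n \<and> m n \<le> n"
    and h: "\<forall>\<^sub>F n in sequentially. 1 \<le> real (m n) - real (l n)"
    and yu: "\<forall>\<^sub>F n in sequentially. real n powr (1/3) \<le> y n"
    and yh: "\<forall>\<^sub>F n in sequentially. y n \<le> K * (real (m n) - real (l n))"
    and mh: "\<forall>\<^sub>F n in sequentially. real (m n) * (real (m n) - real (l n)) \<le> K * y n * n"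
    and mh_o: "\<And>\<nu>. 0 < \<nu> \<Longrightarrow> \<forall>\<^sub>F n in sequentially. real (m n) * (real (m n) - real (l n)) \<le> \<nu> * (real n)\<^sup>2"
  shows "\<forall>\<^sub>F n in sequentially. n < 2 * m n \<longrightarrow> deviation_prob (w n) n (l n - 1) (m n) (y n)
    \<le> exp (- (y n / real n powr (1/3)))"
proof -
  obtain n0 where "weight_profile (w n0) n0 a b C" using prof by (auto simp: eventually_sequentially)
  then interpret P0: weight_profile "w n0" n0 a b C .
  have a: "0 < a" and C: "1 \<le> C" and b: "0 < b" using P0.ab P0.C by auto
  \<comment> \<open>In the second half m > n/2, which turns m (m - l) <= K y n into m - l <= 2 K
    y.\<close>
  define K' where "K' = 2 * K"
  have K': "1 \<le> K'" using K by (simp add: K'_def)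
  define \<kappa> where "\<kappa> = min (a / 2) (1 / (88 * K'))"
  have \<kappa>: "0 < \<kappa>" "\<kappa> < a" "88 * K' * \<kappa> \<le> 1"
  proof -
    show "0 < \<kappa>" using a K' by (simp add: \<kappa>_def)
    show "\<kappa> < a" using a by (simp add: \<kappa>_def min_def)
    have "\<kappa> \<le> 1 / (88 * K')" by (simp add: \<kappa>_def)
    thus "88 * K' * \<kappa> \<le> 1" using K' by (simp add: field_simps)
  qed
  define \<eta> where "\<eta> = 1 / (128 * K')"
  have \<eta>: "0 < \<eta>" using K' by (simp add: \<eta>_def)
  define \<epsilon> where "\<epsilon> = a * \<eta> * \<kappa> / 16"
  have \<epsilon>: "0 < \<epsilon>" using a \<eta> \<kappa> by (simp add: \<epsilon>_def)
  obtain T where T: "max 1 (max (4 * b) (4 * C)) \<le> T"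
    and tail: "\<forall>\<^sub>F n in sequentially. (\<Sum>i=1..n. if w n i \<le> T then 0 else (w n i) ^ 3) \<le> \<epsilon> * n"
    using conditions1_tail[OF wv c \<epsilon>] by blast
  have T0: "0 < T" "1 \<le> T" using T by auto
  \<comment> \<open>A failure probability for which the terms carrying it move the expectation of a
    window by at most y/16 in \<open>end_window\<close>.\<close>
  define \<beta> where "\<beta> = 1 / (32 * K' * (32 * K' * C / a + T))"
  have kT: "1 \<le> 32 * K' * C / a + T" using T0 K' C a by (intro add_increasing) auto
  have \<beta>: "0 < \<beta>" "\<beta> \<le> 1" "32 * K' * \<beta> * (32 * K' * C / a + T) \<le> 1"
  proof -
    have "1 * 1 \<le> 32 * K' * (32 * K' * C / a + T)" using K' kT by (intro mult_mono) auto
    thus "0 < \<beta>" "\<beta> \<le> 1" by (auto simp: \<beta>_def)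
    have "32 * K' * \<beta> * (32 * K' * C / a + T) = \<beta> * (32 * K' * (32 * K' * C / a + T))" by (simp only: mult_ac)
    also have "\<dots> = 1"
    proof -
      have "1 / x * x = 1" if "1 * 1 \<le> x" for x :: real using that by simp
      thus ?thesis unfolding \<beta>_def using \<open>1 * 1 \<le> 32 * K' * (32 * K' * C / a + T)\<close> by blast
    qed
    finally show "32 * K' * \<beta> * (32 * K' * C / a + T) \<le> 1" by simp
  qed
  define \<mu> where "\<mu> = 1 + ln (16 / \<beta>)"
  have \<mu>: "1 \<le> \<mu>" using \<beta> by (simp add: \<mu>_def)
  define \<eta>' where "\<eta>' = \<eta> * \<kappa> / (4 * T)"
  have \<eta>': "0 < \<eta>'" using \<eta> \<kappa> T0 by (simp add: \<eta>'_def)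
  \<comment> \<open>Three demands: a small quadratic term in the martingale bound, and exponents at
    least \<mu> y / n^(1/3) for the martingale and for the heavy survivors. Being free to choose
    \<sigma> after \<open>K\<close>, \<open>T\<close> and \<beta> is what max w = o(n^(1/3))
    provides.\<close>
  define \<sigma> where "\<sigma> = min (1 / (64 * K' * (T + 1))) (min (1 / (32 * \<mu>)) (\<eta>' * \<kappa> / (32 * C * K * \<mu>)))"
  have \<sigma>: "0 < \<sigma>" "\<sigma> \<le> 1" "64 * K' * \<sigma> * (T + 1) \<le> 1" "32 * \<sigma> * \<mu> \<le> 1" "32 * C * K * \<sigma>\<^sup>2 * \<mu> \<le> \<eta>' * \<kappa>"
  proof -
    show \<sigma>0: "0 < \<sigma>" using K K' T0 \<mu> \<eta>' \<kappa> C by (simp add: \<sigma>_def)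
    have le: "\<sigma> \<le> 1 / (64 * K' * (T + 1))" "\<sigma> \<le> 1 / (32 * \<mu>)" "\<sigma> \<le> \<eta>' * \<kappa> / (32 * C * K * \<mu>)"
      by (auto simp: \<sigma>_def)
    have "\<sigma> * (64 * K' * (T + 1)) \<le> 1" using le(1) K' T0 by (simp add: pos_le_divide_eq)
    thus "64 * K' * \<sigma> * (T + 1) \<le> 1" by (simp only: mult_ac)
    have s2: "\<sigma> * (32 * \<mu>) \<le> 1" using le(2) \<mu> by (simp add: pos_le_divide_eq)
    thus "32 * \<sigma> * \<mu> \<le> 1" by (simp only: mult_ac)
    have "\<sigma> * 1 \<le> \<sigma> * (32 * \<mu>)" using \<sigma>0 \<mu> by (intro mult_left_mono) auto
    thus s1: "\<sigma> \<le> 1" using s2 by linarith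
    have "\<sigma> * (32 * C * K * \<mu>) \<le> \<eta>' * \<kappa>" using le(3) C K \<mu> by (simp add: pos_le_divide_eq)
    moreover have "\<sigma> * (\<sigma> * (32 * C * K * \<mu>)) \<le> 1 * (\<sigma> * (32 * C * K * \<mu>))"
      using s1 \<sigma>0 C K \<mu> by (intro mult_right_mono mult_nonneg_nonneg) auto
    ultimately show "32 * C * K * \<sigma>\<^sup>2 * \<mu> \<le> \<eta>' * \<kappa>" by (simp add: power2_eq_square mult_ac)
  qed
  define \<tau> where "\<tau> n = ln (C * n / \<kappa>) / \<kappa>" for n :: nat
  define L where "L n = 1 + 4 * \<tau> n * T\<^sup>2 / \<eta>" for n
  have e1: "\<forall>\<^sub>F n in sequentially. \<mu> + ln (16 * real n) \<le> \<eta> * \<kappa> / (16 * T\<^sup>2 * L n) / K * real n powr (1/3)"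
  proof -
    have ev: "\<forall>\<^sub>F n :: nat in sequentially. \<mu> + ln (16 * real n)
        \<le> (\<eta> * \<kappa> / K) / (16 * T\<^sup>2 + (16 * T\<^sup>2 * (4 * T\<^sup>2 / \<eta> / \<kappa>)) * ln ((C / \<kappa>) * n)) * real n powr (1/3)"
      by (rule eventually_ln_le_root_div_ln) (use \<eta> \<kappa> K T0 C in auto)
    have den: "16 * T\<^sup>2 + (16 * T\<^sup>2 * (4 * T\<^sup>2 / \<eta> / \<kappa>)) * ln ((C / \<kappa>) * n) = 16 * T\<^sup>2 * L n" for n :: nat
      by (simp add: L_def \<tau>_def algebra_simps)
    have "\<eta> * \<kappa> / K / x = \<eta> * \<kappa> / x / K" for x by (simp add: mult.commute)
    from ev[unfolded den this] show ?thesis .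
  qed
  have e2: "\<forall>\<^sub>F n in sequentially. \<mu> + ln (16 * real n) \<le> \<kappa> / (4 * T * (\<tau> n * T + 1)) / K * real n powr (1/3)"
  proof -
    have ev: "\<forall>\<^sub>F n :: nat in sequentially. \<mu> + ln (16 * real n)
        \<le> (\<kappa> / K) / (4 * T + (4 * T * T / \<kappa>) * ln ((C / \<kappa>) * n)) * real n powr (1/3)"
      by (rule eventually_ln_le_root_div_ln) (use \<kappa> K T0 C in auto)
    have den: "4 * T + (4 * T * T / \<kappa>) * ln ((C / \<kappa>) * n) = 4 * T * (\<tau> n * T + 1)" for n :: nat
      by (simp add: \<tau>_def algebra_simps)
    have "\<kappa> / K / x = \<kappa> / x / K" for x by (simp add: mult.commute)
    from ev[unfolded den this] show ?thesis .
  qed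
  have e3: "\<forall>\<^sub>F n :: nat in sequentially. \<mu> \<le> \<kappa> / (32 * C) / K * real n powr (1/3)"
    by (rule eventually_le_root) (use \<kappa> C K in auto)
  have e4: "\<forall>\<^sub>F n :: nat in sequentially. \<mu> \<le> 2 * \<kappa> / T / K * real n powr (1/3)"
    by (rule eventually_le_root) (use \<kappa> T0 K in auto)
  \<comment> \<open>The first bound gives m - l <= n/8, so l - 1 >= n/4 for n >= 8. The second keeps
    \<kappa> (m - l) below the middle mass at time 1 / (4 C), where the search for the cut time
    starts.\<close>
  define \<nu> where "\<nu> = min (1 / 16) (a / (8 * \<kappa>) * exp (- (b / (4 * C))))"
  have \<nu>: "0 < \<nu>" using a \<kappa> by (simp add: \<nu>_def)
  have big: "\<forall>\<^sub>F n :: nat in sequentially. 8 \<le> n" by (rule eventually_ge_at_top)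
  have max: "\<forall>\<^sub>F n in sequentially. \<forall>i\<in>{1..n}. w n i \<le> \<sigma>\<^sup>2 * real n powr (1/3)"
    by (rule conditions1_max[OF wv c]) (use \<sigma> in simp)
  show ?thesis
    using prof lm h yu yh mh mh_o[OF \<nu>] tail e1 e2 e3 e4 big max
  proof eventually_elim
    case (elim n)
    interpret weight_profile "w n" n a b C by (rule elim(1))
    define u where "u = real n powr (1/3)"
    define h where "h = real (m n) - real (l n)"
    define v where "v = y n / u"
    have n8: "8 \<le> real n" using elim(13) by simp
    have u0: "0 < u" using n8 by (simp add: u_def)
    have h1: "1 \<le> h" using elim(3) by (simp add: h_def)
    have "u \<le> y n" using elim(4) by (simp only: u_def)
    hence y0: "0 < y n" using u0 by linarith
    have v1: "1 \<le> v" using elim(4) u0 by (simp add: v_def u_def)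
    have yv: "y n = v * u" using u0 by (simp add: v_def)
    have "y n / K \<le> h" using elim(5) K by (simp add: h_def pos_divide_le_eq mult.commute)
    hence hv: "v * u / K \<le> h" by (simp only: yv)
    have hn: "h \<le> n" using elim(2) by (simp add: h_def)
    \<comment> \<open>\<open>h\<close> is at least v u / K, so an exponent q h is at least v times q
      u / K, and the latter factor grows with n.\<close>
    have exp_le: "exp (- (q * h)) \<le> exp (- N) * (\<beta> / 16) * exp (- v)"
      if q: "0 \<le> q" "0 \<le> N" "\<mu> + N \<le> q / K * u" for q N
    proof (rule exp_neg_le_split[OF v1 \<beta>(1,2) q(2)])
      have "v * (\<mu> + N) \<le> v * (q / K * u)" using q(3) v1 by (intro mult_left_mono) auto
      also have "\<dots> = q * (v * u / K)" by simp
      also have "\<dots> \<le> q * h" using hv q by (intro mult_left_mono) auto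
      finally show "v * (1 + ln (16 / \<beta>) + N) \<le> q * h" by (simp add: \<mu>_def)
    qed
    have ln16: "0 \<le> ln (16 * real n)" using n8 by simp
    have \<tau>0: "0 \<le> \<tau> n"
    proof -
      have "\<kappa> \<le> 88 * K' * \<kappa>" using K' \<kappa> by simp
      hence "\<kappa> \<le> 1" using \<kappa>(3) by linarith
      moreover have "1 * 1 \<le> C * n" using C n8 by (intro mult_mono) auto
      ultimately have "1 \<le> C * n / \<kappa>" using \<kappa> by (simp add: pos_le_divide_eq)
      thus ?thesis using \<kappa> by (simp add: \<tau>_def)
    qed
    have L0: "0 < L n" unfolding L_def using \<tau>0 \<eta> by (intro add_pos_nonneg) auto
    define \<Omega> where "\<Omega> = 2 * exp (- (y n / (32 * \<sigma> * u))) + 16 * h * exp (- (\<eta> * \<kappa> * h / (16 * T\<^sup>2 * L n)))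
      + (exp (- (\<kappa> * h / (32 * C))) + exp (- (\<eta>' * \<kappa> * h / (32 * C * \<sigma>\<^sup>2 * u))))
      + (exp (- (\<kappa> * h / (4 * T * (\<tau> n * T + 1)))) + exp (- (2 * \<kappa> * h / T)))"
    have "\<Omega> \<le> 2 * (\<beta> / 16 * exp (- v)) + \<beta> / 16 * exp (- v)
        + (\<beta> / 16 * exp (- v) + \<beta> / 16 * exp (- v)) + (\<beta> / 16 * exp (- v) + \<beta> / 16 * exp (- v))"
      unfolding \<Omega>_def
    proof (intro add_mono mult_left_mono)
      have "v * \<mu> * (32 * \<sigma>) \<le> v * 1" using \<sigma>(4) v1 mult_left_mono[of "32 * \<sigma> * \<mu>" 1 v] by (simp add: mult_ac)
      hence "v * (1 + ln (16 / \<beta>) + 0) \<le> y n / (32 * \<sigma> * u)"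
        using \<sigma>(1) u0 by (simp add: \<mu>_def[symmetric] yv pos_le_divide_eq mult_ac)
      from exp_neg_le_split[OF v1 \<beta>(1,2) order_refl this]
      show "exp (- (y n / (32 * \<sigma> * u))) \<le> \<beta> / 16 * exp (- v)" by simp
    next
      have "exp (- (\<eta> * \<kappa> * h / (16 * T\<^sup>2 * L n))) \<le> exp (- ln (16 * n)) * (\<beta> / 16) * exp (- v)"
        using exp_le[of "\<eta> * \<kappa> / (16 * T\<^sup>2 * L n)" "ln (16 * n)"] elim(9) \<eta> \<kappa> L0 ln16 by (simp add: u_def)
      hence "16 * h * exp (- (\<eta> * \<kappa> * h / (16 * T\<^sup>2 * L n))) \<le> 16 * n * (exp (- ln (16 * n)) * (\<beta> / 16) * exp (- v))"
        using hn h1 by (intro mult_mono) auto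
      also have "\<dots> = \<beta> / 16 * exp (- v)" using n8 by (simp add: exp_minus)
      finally show "16 * h * exp (- (\<eta> * \<kappa> * h / (16 * T\<^sup>2 * L n))) \<le> \<beta> / 16 * exp (- v)" .
    next
      show "exp (- (\<kappa> * h / (32 * C))) \<le> \<beta> / 16 * exp (- v)"
        using exp_le[of "\<kappa> / (32 * C)" 0] elim(11) \<kappa> C by (simp add: u_def)
    next
      have "v * \<mu> * (32 * C * K * \<sigma>\<^sup>2) \<le> v * (\<eta>' * \<kappa>)"
        using \<sigma>(5) v1 mult_left_mono[of "32 * C * K * \<sigma>\<^sup>2 * \<mu>" "\<eta>' * \<kappa>" v] by (simp add: mult_ac)
      hence "v * \<mu> \<le> v * (\<eta>' * \<kappa>) / (32 * C * K * \<sigma>\<^sup>2)"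
        using C K \<sigma>(1) by (subst pos_le_divide_eq) auto
      also have "\<dots> = \<eta>' * \<kappa> / (32 * C * \<sigma>\<^sup>2 * u) * (v * u / K)"
        using u0 by (simp add: mult_ac)
      also have "\<dots> \<le> \<eta>' * \<kappa> / (32 * C * \<sigma>\<^sup>2 * u) * h"
        using hv \<eta>' \<kappa> C \<sigma> u0 by (intro mult_left_mono) auto
      finally have "v * (1 + ln (16 / \<beta>) + 0) \<le> \<eta>' * \<kappa> * h / (32 * C * \<sigma>\<^sup>2 * u)"
        by (simp add: \<mu>_def)
      from exp_neg_le_split[OF v1 \<beta>(1,2) order_refl this]
      show "exp (- (\<eta>' * \<kappa> * h / (32 * C * \<sigma>\<^sup>2 * u))) \<le> \<beta> / 16 * exp (- v)" by simp
    next
      have "0 \<le> \<kappa> / (4 * T * (\<tau> n * T + 1))" using \<kappa> T0 \<tau>0 by simp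
      moreover have "\<mu> + 0 \<le> \<kappa> / (4 * T * (\<tau> n * T + 1)) / K * u" using elim(10) ln16 unfolding u_def by linarith
      ultimately show "exp (- (\<kappa> * h / (4 * T * (\<tau> n * T + 1)))) \<le> \<beta> / 16 * exp (- v)"
        using exp_le[of "\<kappa> / (4 * T * (\<tau> n * T + 1))" 0] by simp
    next
      show "exp (- (2 * \<kappa> * h / T)) \<le> \<beta> / 16 * exp (- v)"
        using exp_le[of "2 * \<kappa> / T" 0] elim(12) \<kappa> T0 by (simp add: u_def)
    qed auto
    \<comment> \<open>Seven shares: two from the martingale, one from the concentration before the
      cut, two each from heavy and middle survivors.\<close>
    also have "\<dots> = 7 / 16 * (\<beta> * exp (- v))" by simp
    also have "\<dots> \<le> \<beta> * exp (- v)" using \<beta> by simp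
    finally have \<Omega>: "\<Omega> \<le> \<beta> * exp (- v)" .
    have "\<beta> * exp (- v) \<le> 1 * exp (- v)" using \<beta> by (intro mult_right_mono) auto
    hence \<Omega>1: "\<Omega> \<le> exp (- v)" using \<Omega> by linarith
    have "\<beta> * exp (- v) \<le> \<beta> * 1" using \<beta> v1 by (intro mult_left_mono) auto
    hence \<Omega>2: "\<Omega> \<le> \<beta>" using \<Omega> by linarith
    show ?case
    proof
      assume mn: "n < 2 * m n"
      have half: "real n / 2 < m n" using mn by simp
      have hK: "h \<le> K' * y n"
      proof -
        have "real n / 2 * h \<le> m n * h" using half h1 by (intro mult_right_mono) auto
        also have "\<dots> \<le> K * y n * n" using elim(6) by (simp add: h_def)
        finally have "n * h \<le> n * (K' * y n)" by (simp add: K'_def mult_ac)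
        thus ?thesis using n8 by simp
      qed
      have h\<nu>: "h \<le> 2 * \<nu> * n"
      proof -
        have "real n / 2 * h \<le> m n * h" using half h1 by (intro mult_right_mono) auto
        also have "\<dots> \<le> \<nu> * (real n)\<^sup>2" using elim(7) by (simp add: h_def)
        finally have "n * h \<le> n * (2 * \<nu> * n)" by (simp add: power2_eq_square mult_ac)
        thus ?thesis using n8 by simp
      qed
      have h8: "h \<le> n / 8"
      proof -
        have "2 * \<nu> * n \<le> 2 * (1 / 16) * n" by (intro mult_right_mono mult_left_mono) (auto simp: \<nu>_def)
        thus ?thesis using h\<nu> by simp
      qed
      have "deviation_prob (w n) n (l n - 1) (m n) (y n) \<le> \<Omega>"
        unfolding deviation_prob_def \<Omega>_def \<tau>_def L_def \<eta>_def \<eta>'_def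
      proof (rule end_window[where \<epsilon> = \<epsilon> and \<beta> = \<beta> and K = K'])
        show "l n - 1 < m n" using elim(2) by linarith
        show "n \<le> 4 * (l n - 1)"
        proof -
          have "real n / 2 - n / 8 - 1 \<le> real (l n - 1)"
            using half h8 elim(2) by (simp add: h_def of_nat_diff)
          hence "real n \<le> real (4 * (l n - 1))" using n8 by simp
          thus ?thesis by linarith
        qed
        show "real (m n - (l n - 1)) \<le> 2 * h" using elim(2) h1 by (simp add: h_def of_nat_diff)
        show "\<kappa> * h < a * n / 2 * exp (- (b / (4 * C)))"
        proof -
          have "\<kappa> * h \<le> \<kappa> * (2 * (a / (8 * \<kappa>) * exp (- (b / (4 * C)))) * n)"
          proof (rule mult_left_mono)
            have "2 * \<nu> * n \<le> 2 * (a / (8 * \<kappa>) * exp (- (b / (4 * C)))) * n"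
              by (intro mult_right_mono mult_left_mono) (auto simp: \<nu>_def)
            thus "h \<le> 2 * (a / (8 * \<kappa>) * exp (- (b / (4 * C)))) * n" using h\<nu> by linarith
          qed (use \<kappa> in auto)
          also have "\<dots> = 1 / 2 * (a * n / 2 * exp (- (b / (4 * C))))" using \<kappa> by simp
          also have "\<dots> < 1 * (a * n / 2 * exp (- (b / (4 * C))))"
            using a n8 by (intro mult_strict_right_mono mult_pos_pos) auto
          finally show ?thesis by simp
        qed
        show "16 * \<epsilon> \<le> a * (1 / (128 * K')) * \<kappa>" by (simp add: \<epsilon>_def \<eta>_def mult.commute)
        show "w n i \<le> \<sigma>\<^sup>2 * u" if "i \<in> {1..n}" for i using elim(14) that by (simp add: u_def)
        show "2 * exp (- (y n / (32 * \<sigma> * u)))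
          + 16 * h * exp (- (1 / (128 * K') * \<kappa> * h / (16 * T\<^sup>2 * (1 + 4 * (ln (C * n / \<kappa>) / \<kappa>) * T\<^sup>2 / (1 / (128 * K'))))))
          + (exp (- (\<kappa> * h / (32 * C)))
            + exp (- (1 / (128 * K') * \<kappa> / (4 * T) * \<kappa> * h / (32 * C * \<sigma>\<^sup>2 * u))))
          + (exp (- (\<kappa> * h / (4 * T * (ln (C * n / \<kappa>) / \<kappa> * T + 1)))) + exp (- (2 * \<kappa> * h / T))) \<le> \<beta>"
          using \<Omega>2 unfolding \<Omega>_def \<tau>_def L_def \<eta>'_def \<eta>_def .
      qed (use elim(2,8) h1 y0 hK K' T \<kappa> \<epsilon> \<sigma> u0 \<beta> in auto)
      thus "deviation_prob (w n) n (l n - 1) (m n) (y n) \<le> exp (- (y n / real n powr (1/3)))"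
        using \<Omega>1 by (simp add: v_def u_def)
    qed
  qed
qed

theorem theorem21:
  fixes w :: "nat \<Rightarrow> nat \<Rightarrow> real"
    and M :: "'a measure" and W :: "'a \<Rightarrow> real"
    and P :: "nat \<Rightarrow> 'b measure" and v :: "nat \<Rightarrow> 'b \<Rightarrow> nat \<Rightarrow> nat"
  assumes "weight_vectors w"
    and "conditions1 w M W"
    and "\<forall>n\<ge>1. size_biased_permutation (P n) n (w n) (v n)"
  shows "\<exists>A>0. \<exists>Abar>A. \<forall>(l :: nat \<Rightarrow> nat) (m :: nat \<Rightarrow> nat) (y :: nat \<Rightarrow> real).
    (\<forall>\<^sub>F n in sequentially. 1 \<le> l n \<and> l n \<le> m n \<and> m n \<le> n) \<and>
    conditions2 Abar (total_weight w) (\<lambda>n. sqrt (real (m n) * (real (m n) - real (l n)))) y \<and>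
    filterlim (\<lambda>n. real (m n) - real (l n)) at_top sequentially \<and>
    y \<in> O(\<lambda>n. real (m n) - real (l n)) \<longrightarrow>
    (\<forall>\<^sub>F n in sequentially.
      \<P>(\<omega> in P n.
        (SUP (i, j)\<in>{(i, j). l n \<le> i \<and> i \<le> j \<and> j \<le> m n}.
          \<bar>(\<Sum>k=i..j. w n (v n \<omega> k)) - (\<integral>\<omega>'. (\<Sum>k=i..j. w n (v n \<omega>' k)) \<partial>P n)\<bar>) \<ge> y n)
      \<le> A * exp (- (y n)\<^sup>2 / (A * (y n * real n powr (1/3) + (real (m n) - real (l n))))))"
proof -
  from conditions1_profile[OF assms(1,2)] obtain a b C
    where prof: "\<forall>\<^sub>F n in sequentially. weight_profile (w n) n a b C" by blast
  obtain n0 where "weight_profile (w n0) n0 a b C" using prof by (auto simp: eventually_sequentially)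
  then interpret P0: weight_profile "w n0" n0 a b C .
  have C: "1 \<le> C" and a: "0 < a" using P0.C P0.ab by auto
  define B where "B = 16 * (1 + 128 * C / a)"
  \<comment> \<open>\<open>B\<close> is the Bernstein constant of the first half; adding 4 lets the
    prefactor \<open>A\<close> cover the sum 2 + 2 of the two exponentials.\<close>
  define A where "A = B + 4"
  have B: "16 \<le> B" using C a by (simp add: B_def)
  have A: "4 \<le> A" "B \<le> A" using B by (auto simp: A_def)
  show ?thesis
  proof (rule exI[of _ A], rule conjI, use A in simp, rule exI[of _ "A + 1"], rule conjI, simp,
      intro allI impI, elim conjE)
    fix l m :: "nat \<Rightarrow> nat" and y :: "nat \<Rightarrow> real"
    let ?h = "\<lambda>n. real (m n) - real (l n)"
    let ?a = "\<lambda>n. sqrt (real (m n) * ?h n)"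
    let ?u = "\<lambda>n. real n powr (1/3)"
    assume lm: "\<forall>\<^sub>F n in sequentially. 1 \<le> l n \<and> l n \<le> m n \<and> m n \<le> n"
      and c2: "conditions2 (A + 1) (total_weight w) ?a y"
      and h_top: "filterlim ?h at_top sequentially" and yO: "y \<in> O(?h)"
    have h1: "\<forall>\<^sub>F n in sequentially. 1 \<le> ?h n" using h_top by (simp add: filterlim_at_top)
    have pos: "\<forall>\<^sub>F n in sequentially. 0 < ?a n \<and> 0 < y n" using c2 by (simp add: conditions2_def)
    have quarter: "\<forall>\<^sub>F n in sequentially. exp (- (y n)\<^sup>2 / ((A + 1) * (y n * ?u n + ?a n))) < 1/4"
      using c2 by (simp add: conditions2_def)
    obtain K1 where K1: "\<forall>\<^sub>F n in sequentially. norm (y n) \<le> K1 * norm (?h n)"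
      using yO by (auto elim!: landau_o.bigE)
    have "(\<lambda>n. (?a n)\<^sup>2) \<in> O(\<lambda>n. y n * total_weight w n)" using c2 by (simp add: conditions2_def)
    then obtain K2 where K2: "K2 > 0" "\<forall>\<^sub>F n in sequentially. norm ((?a n)\<^sup>2) \<le> K2 * norm (y n * total_weight w n)"
      by (auto elim!: landau_o.bigE)
    define K where "K = max 1 (max K1 (K2 * C))"
    have K: "1 \<le> K" "K1 \<le> K" "K2 * C \<le> K" by (auto simp: K_def)
    \<comment> \<open>As exp (- 1) is at least 1/4, the threshold in Conditions 2 forces y^2 > (A +
      1) (y n^(1/3) + a(n)), hence y > n^(1/3).\<close>
    have yu: "\<forall>\<^sub>F n in sequentially. ?u n \<le> y n"
      using pos quarter
    proof eventually_elim
      case (elim n)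
      define D where "D = (A + 1) * (y n * ?u n + ?a n)"
      have yu0: "0 \<le> y n * ?u n" using elim by simp
      have D: "0 < D" unfolding D_def using A elim yu0 by (intro mult_pos_pos add_nonneg_pos) auto
      have "1 < (y n)\<^sup>2 / D"
      proof (rule ccontr)
        assume "\<not> 1 < (y n)\<^sup>2 / D"
        hence "exp (- 1) \<le> exp (- (y n)\<^sup>2 / D)" by simp
        moreover have "1 / 4 \<le> exp (- 1 :: real)" using exp_le by (simp add: exp_minus field_simps)
        ultimately show False using elim(2) unfolding D_def by linarith
      qed
      hence "D < (y n)\<^sup>2" using D by (simp add: field_simps)
      moreover have "1 * (y n * ?u n) \<le> D"
        unfolding D_def using A elim yu0 by (intro mult_mono) auto
      ultimately have "y n * ?u n < y n * y n" by (simp add: power2_eq_square)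
      thus ?case using elim by simp
    qed
    have yh: "\<forall>\<^sub>F n in sequentially. y n \<le> K * ?h n"
      using K1 h1
    proof eventually_elim
      case (elim n)
      have "K1 * ?h n \<le> K * ?h n" using K elim by (intro mult_right_mono) auto
      moreover have "y n \<le> K1 * ?h n" using elim by simp
      ultimately show ?case by linarith
    qed
    \<comment> \<open>The square of the first sequence in Conditions 2 is m (m - l), and the total
      weight is at most C n.\<close>
    have mh: "\<forall>\<^sub>F n in sequentially. real (m n) * ?h n \<le> K * y n * n"
      using K2(2) h1 pos prof
    proof eventually_elim
      case (elim n)
      interpret weight_profile "w n" n a b C by (rule elim(4))
      have "total_weight w n \<le> C * n" using moments(1) by (simp add: total_weight_def)
      moreover have tw: "0 \<le> total_weight w n" unfolding total_weight_def using wnonneg by (intro sum_nonneg) auto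
      ultimately have "K2 * (y n * total_weight w n) \<le> K2 * (y n * (C * n))"
        using K2(1) elim(3) by (intro mult_left_mono) auto
      also have "\<dots> = (K2 * C) * (y n * n)" by simp
      also have "\<dots> \<le> K * (y n * n)" using K elim(3) by (intro mult_right_mono) auto
      finally have "K2 * (y n * total_weight w n) \<le> K * (y n * n)" .
      moreover have "real (m n) * ?h n \<le> K2 * (y n * total_weight w n)" using elim(1-3) tw by simp
      ultimately show ?case by (simp only: mult.assoc)
    qed
    have mh_o: "\<forall>\<^sub>F n in sequentially. real (m n) * ?h n \<le> \<nu> * (real n)\<^sup>2" if \<nu>: "0 < \<nu>" for \<nu>
    proof -
      have "?a \<in> o(\<lambda>n. real n)" using c2 by (simp add: conditions2_def)
      from landau_o.smallD[OF this, of "sqrt \<nu>"] \<nu>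
      have "\<forall>\<^sub>F n in sequentially. norm (?a n) \<le> sqrt \<nu> * norm (real n)" by simp
      thus ?thesis using h1
      proof eventually_elim
        case (elim n)
        have "(?a n)\<^sup>2 \<le> (sqrt \<nu> * real n)\<^sup>2" using elim by (intro power_mono) auto
        thus ?case using elim(2) \<nu> by (simp add: power_mult_distrib)
      qed
    qed
    have upper: "\<forall>\<^sub>F n in sequentially. n < 2 * m n \<longrightarrow> deviation_prob (w n) n (l n - 1) (m n) (y n)
        \<le> exp (- (y n / ?u n))"
      by (rule end_eventually[OF assms(1,2) prof K(1) lm h1 yu yh mh]) (rule mh_o)
    show "\<forall>\<^sub>F n in sequentially.
      \<P>(\<omega> in P n.
        (SUP (i, j)\<in>{(i, j). l n \<le> i \<and> i \<le> j \<and> j \<le> m n}.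
          \<bar>(\<Sum>k=i..j. w n (v n \<omega> k)) - (\<integral>\<omega>'. (\<Sum>k=i..j. w n (v n \<omega>' k)) \<partial>P n)\<bar>) \<ge> y n)
      \<le> A * exp (- (y n)\<^sup>2 / (A * (y n * ?u n + ?h n)))"
      using bulk_eventually[OF assms(1,2) prof K(1) lm h1 yu mh]
        upper lm h1 pos eventually_gt_at_top[of 0]
    proof eventually_elim
      case (elim n)
      define D where "D = y n * ?u n + ?h n"
      have D: "0 < D" using elim by (simp add: D_def add_nonneg_pos)
      let ?e = "exp (- (y n)\<^sup>2 / (A * D))"
      have eu: "exp (- (y n / ?u n)) \<le> ?e"
        unfolding D_def using elim A by (intro exp_neg_ratio_le) auto
      have eB: "exp (- (y n)\<^sup>2 / (B * D)) \<le> ?e"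
      proof -
        have "(y n)\<^sup>2 / (A * D) \<le> (y n)\<^sup>2 / (B * D)"
          using A B D by (intro divide_left_mono mult_right_mono mult_pos_pos) auto
        thus ?thesis by simp
      qed
      have "deviation_prob (w n) n (l n - 1) (m n) (y n) \<le> 4 * ?e"
      proof (cases "2 * m n \<le> n")
        case True
        hence "deviation_prob (w n) n (l n - 1) (m n) (y n)
            \<le> 2 * exp (- (y n)\<^sup>2 / (B * D)) + 2 * exp (- (y n / ?u n))"
          using elim(1) by (simp add: B_def D_def)
        thus ?thesis using eu eB by linarith
      next
        case False
        hence "deviation_prob (w n) n (l n - 1) (m n) (y n) \<le> exp (- (y n / ?u n))"
          using elim(2) by simp
        moreover have "0 \<le> ?e" by simp
        ultimately show ?thesis using eu by linarith
      qed
      also have "\<dots> \<le> A * ?e" using A by (intro mult_right_mono) auto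
      finally have "deviation_prob (w n) n (l n - 1) (m n) (y n) \<le> A * ?e" .
      moreover have "size_biased_permutation (P n) n (w n) (v n)" using assms(3) elim(6) by simp
      note prob_sup_le_draws[OF this weight_vectors_pos[OF assms(1)], of "l n" "m n" "y n"]
      ultimately show ?case using elim(3) unfolding deviation_prob_def D_def by linarith
    qed
  qed
qed

end
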